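(* Let $0<\kappa\le 4$. There exists $c<\infty$ such that for every $x_1<y_1<x_2<y_2$ (real) the following holds. (1) Suppose $D\subset\mathbb H$ is a simply connected domain whose boundary contains an open real neighborhood of $[x_1,y_1]$ and suppose that $$\delta:=\min\big\{|x_1-y_1|,\ \mathrm{dist}[\{x_1,y_1\},\mathbb H\setminus D]\big\}>0.$$ Then if $z_1,z_2\in\{x_1,y_1\}$, $$|\partial_{z_1}H_D(x_1,y_1)|\le c\,\delta^{-1}H_D(x_1,y_1),\qquad |\partial_{z_1z_2}H_D(x_1,y_1)|\le c\,\delta^{-2}H_D(x_1,y_1).$$ (2) Suppose $D\subset\mathbb H$ is a simply connected domain whose boundary contains open real neighborhoods of $[x_1,y_1]$ and $[x_2,y_2]$, and let $$\delta:=\min\Big\{\{|w_1-w_2|:\ w_1\ne w_2,\ w_1,w_2\in\{x_1,x_2,y_1,y_2\}\},\ \mathrm{dist}[\{x_1,y_1,x_2,y_2\},\mathbb H\setminus D]\Big\}.$$ Then if $z_1\in\{x_1,y_1\}$, $z_2\in\{x_2,y_2\}$, with $\mathbf x=(x_1,x_2)$, $\mathbf y=(y_1,y_2)$, $$|\partial_{z_1z_2}\tilde\Psi_D(\mathbf x,\mathbf y)|\le c\,\delta^{-2}\,\tilde\Psi_D(\mathbf x,\mathbf y).$$ Moreover, the constant can be chosen uniformly in neighborhoods of $x_1,y_1,x_2,y_2$.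
   Context: $\mathbb H$ is the upper half-plane; the distance to the empty set is $+\infty$; a bound with $\delta=0$ is vacuous. $H_D$ is the boundary Poisson kernel of $D$, normalized so that $H_{\mathbb H}(x,y)=(y-x)^{-2}$ and $H_D(z,w)=|f'(z)||f'(w)|H_{f(D)}(f(z),f(w))$ for conformal transformations $f$; thus $H_D(x,y)=\frac{|f'(x)||f'(y)|}{(f(y)-f(x))^2}$ for a conformal map $f:D\to\mathbb H$ finite at $x,y$. It is regarded as a function of real boundary points, and partial derivatives are taken in those real variables. With $a=2/\kappa$, let $$\phi(x)=\frac{\Gamma(2a)\Gamma(6a-1)}{\Gamma(4a)\Gamma(4a-1)}\,x^a\,{}_2F_1(2a,1-2a,4a;x).$$ For $x_1<y_1<x_2<y_2$ and $D$ as in (2), the normalized two-path $SLE_\kappa$ partition function is $$\tilde\Psi_D(\mathbf x,\mathbf y)=\phi\Big(\exp\Big\{-\int_{x_1}^{y_1}\int_{x_2}^{y_2}H_D(r,s)\,ds\,dr\Big\}\Big),$$ where the integration variable $r$ ranges over $[x_1,y_1]$ and $s$ over $[x_2,y_2]$. *)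

theory Defs
  imports "HOL-Complex_Analysis.Complex_Analysis"
begin

abbreviation upper_half_plane :: "complex set" where
  "upper_half_plane \<equiv> {z. Im z > 0}"

definition simply_connected_domain :: "complex set \<Rightarrow> bool" where
  "simply_connected_domain D \<longleftrightarrow> D \<noteq> {} \<and> open D \<and> connected D \<and> simply_connected D"

definition conformal_map :: "(complex \<Rightarrow> complex) \<Rightarrow> complex set \<Rightarrow> complex set \<Rightarrow> bool" where
  "conformal_map f A B \<longleftrightarrow> f holomorphic_on A \<and> bij_betw f A B"

definition boundary_contains_nhd :: "complex set \<Rightarrow> real \<Rightarrow> real \<Rightarrow> bool" where
  "boundary_contains_nhd D x y \<longleftrightarrow>
     (\<exists>U :: real set. open U \<and> {x..y} \<subseteq> U \<and> complex_of_real ` U \<subseteq> frontier D)"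

definition real_analytic_boundary_point :: "complex set \<Rightarrow> real \<Rightarrow> bool" where
  "real_analytic_boundary_point D x \<longleftrightarrow>
     (\<exists>e>0. ball (complex_of_real x) e \<inter> upper_half_plane \<subseteq> D)"

text \<open>
  The boundary Poisson kernel, normalized so that its value for the upper half plane is
  \<open>1 / (y - x)\<^sup>2\<close>. A conformal map of \<open>D\<close> onto the upper half plane that is finite at \<open>x\<close> and \<open>y\<close>
  extends holomorphically (and real on the real line) across these points by Schwarz reflection,
  and the derivatives at \<open>x\<close> and \<open>y\<close> are those of the extension. Any two such maps differ by a
  real Moebius transformation, which leaves the expression unchanged, so the choice of \<open>f\<close> is
  immaterial. The kernel is set to 0 if \<open>D\<close> is not a half plane locally at \<open>x\<close> or at \<open>y\<close>. This
  can happen inside an interval of the topological boundary, for instance at a point where slits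
  of the upper half plane accumulate.
\<close>

definition boundary_poisson :: "complex set \<Rightarrow> real \<Rightarrow> real \<Rightarrow> real" where
  "boundary_poisson D x y =
     (if real_analytic_boundary_point D x \<and> real_analytic_boundary_point D y
      then let f = (SOME f. conformal_map f D upper_half_plane \<and>
                        f analytic_on (D \<union> {complex_of_real x, complex_of_real y}))
           in norm (deriv f (of_real x)) * norm (deriv f (of_real y)) /
              (norm (f (of_real y) - f (of_real x)))\<^sup>2
      else 0)"

definition phi :: "real \<Rightarrow> real \<Rightarrow> real" where
  "phi \<kappa> x =
     (let a = 2 / \<kappa>
      in Gamma (2 * a) * Gamma (6 * a - 1) / (Gamma (4 * a) * Gamma (4 * a - 1)) *
         x powr a * eval_fps (fps_hypergeo [2 * a, 1 - 2 * a] [4 * a] 1) x)"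

definition Psi_tilde ::
    "real \<Rightarrow> complex set \<Rightarrow> real \<times> real \<Rightarrow> real \<times> real \<Rightarrow> real" where
  "Psi_tilde \<kappa> D = (\<lambda>(x1, x2) (y1, y2).
     phi \<kappa> (exp (- integral {x1..y1} (\<lambda>r. integral {x2..y2} (\<lambda>s. boundary_poisson D r s)))))"

text \<open>
  The library's \<open>setdist\<close> is 0 if one of the sets is empty; here an empty set is at infinite
  distance and hence does not contribute to the minimum.
\<close>

definition min_with_dist :: "real \<Rightarrow> real set \<Rightarrow> complex set \<Rightarrow> real" where
  "min_with_dist m S B =
     (if B = {} then m else min m (setdist (complex_of_real ` S) B))"

definition delta1 :: "complex set \<Rightarrow> real \<Rightarrow> real \<Rightarrow> real" where
  "delta1 D x1 y1 = min_with_dist \<bar>x1 - y1\<bar> {x1, y1} (upper_half_plane - D)"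

definition delta2 :: "complex set \<Rightarrow> real \<Rightarrow> real \<Rightarrow> real \<Rightarrow> real \<Rightarrow> real" where
  "delta2 D x1 y1 x2 y2 =
     min_with_dist
       (Min {\<bar>w1 - w2\<bar> |w1 w2. w1 \<in> {x1, x2, y1, y2} \<and> w2 \<in> {x1, x2, y1, y2} \<and> w1 \<noteq> w2})
       {x1, y1, x2, y2} (upper_half_plane - D)"

text \<open>
  Functions of several real variables are functions of the list of their arguments, and the
  variables are numbered from 0. Since \<open>deriv\<close> is total, existence of the partial derivatives
  is expressed separately.
\<close>

definition has_partial :: "nat \<Rightarrow> (real list \<Rightarrow> real) \<Rightarrow> real list \<Rightarrow> bool" where
  "has_partial i F v \<longleftrightarrow> (\<lambda>t. F (v[i := t])) field_differentiable at (v ! i)"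

definition partial :: "nat \<Rightarrow> (real list \<Rightarrow> real) \<Rightarrow> real list \<Rightarrow> real" where
  "partial i F v = deriv (\<lambda>t. F (v[i := t])) (v ! i)"

definition has_partial2 :: "nat \<Rightarrow> nat \<Rightarrow> (real list \<Rightarrow> real) \<Rightarrow> real list \<Rightarrow> bool" where
  "has_partial2 i j F v \<longleftrightarrow>
     (\<forall>\<^sub>F t in nhds (v ! i). has_partial j F (v[i := t])) \<and> has_partial i (partial j F) v"

definition partial2 :: "nat \<Rightarrow> nat \<Rightarrow> (real list \<Rightarrow> real) \<Rightarrow> real list \<Rightarrow> real" where
  "partial2 i j F = partial i (partial j F)"

definition kernel_bounds :: "real \<Rightarrow> real \<Rightarrow> complex set \<Rightarrow> real \<Rightarrow> real \<Rightarrow> bool" where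
  "kernel_bounds c \<delta> D x1 y1 \<longleftrightarrow>
     (let H = (\<lambda>v. boundary_poisson D (v ! 0) (v ! 1)); p = [x1, y1]
      in (\<forall>i\<in>{0, 1}. has_partial i H p \<and> \<bar>partial i H p\<bar> \<le> c / \<delta> * H p) \<and>
         (\<forall>i\<in>{0, 1}. \<forall>j\<in>{0, 1}. has_partial2 i j H p \<and> \<bar>partial2 i j H p\<bar> \<le> c / \<delta>\<^sup>2 * H p))"

text \<open>
  In the list \<open>[x1, y1, x2, y2]\<close> the indices 0, 1 stand for \<open>x1\<close>, \<open>y1\<close> and 2, 3 for \<open>x2\<close>, \<open>y2\<close>.
\<close>

definition Psi_bounds ::
    "real \<Rightarrow> real \<Rightarrow> real \<Rightarrow> complex set \<Rightarrow> real \<Rightarrow> real \<Rightarrow> real \<Rightarrow> real \<Rightarrow> bool" where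
  "Psi_bounds \<kappa> c \<delta> D x1 y1 x2 y2 \<longleftrightarrow>
     (let F = (\<lambda>v. Psi_tilde \<kappa> D (v ! 0, v ! 2) (v ! 1, v ! 3)); p = [x1, y1, x2, y2]
      in \<forall>i\<in>{0, 1}. \<forall>j\<in>{2, 3}. has_partial2 i j F p \<and> \<bar>partial2 i j F p\<bar> \<le> c / \<delta>\<^sup>2 * F p)"

definition admissible1 :: "complex set \<Rightarrow> real \<Rightarrow> real \<Rightarrow> bool" where
  "admissible1 D x1 y1 \<longleftrightarrow>
     simply_connected_domain D \<and> D \<subseteq> upper_half_plane \<and> boundary_contains_nhd D x1 y1"

definition admissible2 :: "complex set \<Rightarrow> real \<Rightarrow> real \<Rightarrow> real \<Rightarrow> real \<Rightarrow> bool" where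
  "admissible2 D x1 y1 x2 y2 \<longleftrightarrow>
     simply_connected_domain D \<and> D \<subseteq> upper_half_plane \<and>
     boundary_contains_nhd D x1 y1 \<and> boundary_contains_nhd D x2 y2"

text \<open>
  Uniformity in neighborhoods of the points: near \<open>x1, y1, x2, y2\<close> the bounds hold with the same
  constant \<open>c\<close> and with \<open>\<delta>\<close> evaluated at the centre \<open>x1, y1, x2, y2\<close>, not at the moving points.
  The neighborhoods are common to all domains whose \<open>\<delta>\<close> is at least \<open>d\<close>.
\<close>

definition locally_uniform_bounds ::
    "real \<Rightarrow> real \<Rightarrow> real \<Rightarrow> real \<Rightarrow> real \<Rightarrow> real \<Rightarrow> bool" where
  "locally_uniform_bounds \<kappa> c x1 y1 x2 y2 \<longleftrightarrow>
     (\<forall>d>0. \<exists>U1 V1 U2 V2. open U1 \<and> open V1 \<and> open U2 \<and> open V2 \<and>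
        x1 \<in> U1 \<and> y1 \<in> V1 \<and> x2 \<in> U2 \<and> y2 \<in> V2 \<and>
        (\<forall>x1'\<in>U1. \<forall>y1'\<in>V1. \<forall>x2'\<in>U2. \<forall>y2'\<in>V2.
           (\<forall>D. admissible1 D x1 y1 \<and> d \<le> delta1 D x1 y1 \<longrightarrow>
              kernel_bounds c (delta1 D x1 y1) D x1' y1') \<and>
           (\<forall>D. admissible2 D x1 y1 x2 y2 \<and> d \<le> delta2 D x1 y1 x2 y2 \<longrightarrow>
              Psi_bounds \<kappa> c (delta2 D x1 y1 x2 y2) D x1' y1' x2' y2')))"

end

theory Submission
  imports Defs
begin

text \<open>
  Let \<open>f\<close> map \<open>D\<close> conformally onto the upper half plane and be holomorphic across \<open>x\<close> and \<open>y\<close>, so that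
  \<open>H(x,y) = f'(x) f'(y) / (f(x) - f(y))\<^sup>2\<close>. The Schwarz-Pick inequality at \<open>x + i\<epsilon>\<close> and \<open>y + i\<epsilon>\<close>, divided by
  \<open>\<epsilon>\<^sup>2\<close>, has a limit as \<open>\<epsilon>\<close> tends to 0. This limit shows that \<open>H\<close> does not depend on \<open>f\<close>, that
  \<open>H(x,y) \<le> 1/(x - y)\<^sup>2\<close>, and that \<open>f\<close> is injective on the boundary (boundary_chart_kernel_limit,
  boundary_chart_kernel_bound, boundary_chart_inj). Such an \<open>f\<close> comes from the Riemann map \<open>\<phi>\<close> onto the disc:
  where \<open>D\<close> contains half discs, a quadratic barrier and the maximum principle give \<open>1 - |\<phi>| = O(Im z)\<close>, the
  Schwarz lemma then bounds \<open>\<phi>'\<close>, so \<open>\<phi>\<close> extends continuously, and after a Moebius map Schwarz reflection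
  applies (barrier_estimate, riemann_map_continuous_extension, boundary_charts_exist).

  For the bounds in one variable, send \<open>y\<close> to infinity: \<open>F = -1/(f - f(y))\<close> maps a half disc at \<open>x\<close> into the
  half plane and its diameter into the real line, and \<open>H(t,y)\<close> is a constant multiple of \<open>F'(t)\<close>. The Taylor
  coefficients of such a typically real \<open>F\<close> on a disc of radius \<open>R\<close> satisfy \<open>|a\<^sub>n| R\<^sup>n \<le> n a\<^sub>1 R\<close>, because
  \<open>Im F\<close> and \<open>sin \<theta>\<close> have the same sign on circles and \<open>|sin n\<theta>| \<le> n |sin \<theta>|\<close>
  (typically_real_coefficient_bound, pole_map, H_derivs). The mixed derivative follows from
  \<open>\<partial>\<^sub>x\<partial>\<^sub>y log H = -2H\<close> and the bound on \<open>H\<close> (H_mixed_deriv).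

  For two paths put \<open>\<Psi> = G(I)\<close>, where \<open>I\<close> is the double integral of \<open>H\<close> and \<open>G(I) = \<phi>(exp(-I))\<close>. Then
  \<open>\<partial>\<^sub>i\<partial>\<^sub>j\<Psi> = G''(I) I\<^sub>i I\<^sub>j + G'(I) I\<^sub>i\<^sub>j\<close> with \<open>|I\<^sub>i|, |I\<^sub>j| \<le> 1/R\<close> and \<open>|I\<^sub>i\<^sub>j| = H \<le> 1/R\<^sup>2\<close>. The hypergeometric
  series is differentiable up to its singularity 1 but its second derivative may be unbounded there, so
  \<open>|G''| \<le> C G\<close> can fail for small \<open>I\<close>; what holds is \<open>|G'| \<le> C G\<close> and \<open>min(1,I) |G''| \<le> C G\<close>
  (phi_exp_bounds). The missing factor comes from the kernel: by the Harnack inequality H_harnack the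
  inner integral varies slowly near an end point, hence \<open>|I\<^sub>i| \<le> const * I / R\<close> (double_integral_lower).

  The kernel vanishes where \<open>D\<close> is not a half plane locally. The remaining boundary points form an open
  set on which the kernel is continuous, and this makes all integrals meaningful. Every estimate is proved
  with \<open>R = \<delta>/2\<close>, which leaves room for moving each point by \<open>\<delta>/4\<close> and gives the local uniformity.
\<close>

section \<open>The Schwarz-Pick inequality\<close>

lemma norm_diff_cnj_sq:
  "(norm (a - cnj b))\<^sup>2 = (norm (a - b))\<^sup>2 + 4 * Im a * Im b"
  unfolding cmod_power2 by (simp add: power2_eq_square algebra_simps)

lemma diff_cnj_nonzero:
  assumes "Im a > 0" "Im b > 0"
  shows "a - cnj b \<noteq> 0"
proof
  assume "a - cnj b = 0"
  then have "Im (a - cnj b) = 0" by simp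
  then show False using assms by simp
qed

lemma cayley_norm_less_1:
  assumes "Im a > 0" "Im b > 0"
  shows "norm ((a - b) / (a - cnj b)) < 1"
proof -
  have "(norm (a - b))\<^sup>2 < (norm (a - cnj b))\<^sup>2"
    using norm_diff_cnj_sq[of a b] assms by simp
  then have "norm (a - b) < norm (a - cnj b)"
    using power_less_imp_less_base by fastforce
  then show ?thesis using diff_cnj_nonzero[OF assms] by (simp add: norm_divide divide_simps)
qed

text \<open>
  The Cayley transforms centred at \<open>w\<close> and \<open>h w\<close> turn \<open>h\<close> into a self map of the disc that fixes 0, so the
  Schwarz lemma applies. Passing to \<open>1 - |\<cdot>|\<^sup>2\<close> with norm_diff_cnj_sq gives a form in which both
  imaginary parts are factors, and these may be divided by \<open>\<epsilon>\<close> at the boundary.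
\<close>

lemma schwarz_pick_upper_half_plane:
  assumes holo: "h holomorphic_on {z. Im z > 0}"
    and into: "\<And>z. Im z > 0 \<Longrightarrow> Im (h z) > 0"
    and z: "Im z > 0" and w: "Im w > 0"
  shows "Im z * Im w * (norm (h z - cnj (h w)))\<^sup>2 \<le> Im (h z) * Im (h w) * (norm (z - cnj w))\<^sup>2"
proof -
  define T where "T = (\<lambda>\<zeta>. (w - cnj w * \<zeta>) / (1 - \<zeta>))"
  define u where "u = (\<lambda>\<zeta>. (h (T \<zeta>) - h w) / (h (T \<zeta>) - cnj (h w)))"
  have ne1: "1 - \<zeta> \<noteq> 0" if "norm \<zeta> < 1" for \<zeta> :: complex using that by auto
  have T: "Im (T \<zeta>) > 0" if "norm \<zeta> < 1" for \<zeta>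
  proof -
    have "T \<zeta> = ((w - cnj w * \<zeta>) * cnj (1 - \<zeta>)) / of_real ((norm (1 - \<zeta>))\<^sup>2)"
      unfolding T_def by (subst complex_div_cnj) simp
    then have "Im (T \<zeta>) = Im ((w - cnj w * \<zeta>) * cnj (1 - \<zeta>)) / (norm (1 - \<zeta>))\<^sup>2"
      by (simp only: Im_divide_of_real)
    also have "Im ((w - cnj w * \<zeta>) * cnj (1 - \<zeta>)) = Im w * (1 - (norm \<zeta>)\<^sup>2)"
      unfolding cmod_power2 by (simp add: power2_eq_square algebra_simps)
    also have "Im w * (1 - (norm \<zeta>)\<^sup>2) / (norm (1 - \<zeta>))\<^sup>2 > 0"
      using ne1[OF that] that w by (simp add: power_less_one_iff abs_square_less_1)
    finally show ?thesis .
  qed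
  have Thol: "T holomorphic_on ball 0 1"
    unfolding T_def using ne1 by (intro holomorphic_intros) auto
  have hT: "(\<lambda>\<zeta>. h (T \<zeta>)) holomorphic_on ball 0 1"
    using holomorphic_on_compose_gen[OF Thol holo] T by (simp add: o_def image_subset_iff)
  have uhol: "u holomorphic_on ball 0 1"
    unfolding u_def using diff_cnj_nonzero[OF into[OF T] into[OF w]]
    by (intro holomorphic_intros hT) auto
  have u1: "norm (u \<zeta>) < 1" if "norm \<zeta> < 1" for \<zeta>
    unfolding u_def using cayley_norm_less_1[OF into[OF T[OF that]] into[OF w]] .
  have "T 0 = w" by (simp add: T_def)
  then have u0: "u 0 = 0" by (simp add: u_def)
  define \<zeta> where "\<zeta> = (z - w) / (z - cnj w)"
  have zeta: "norm \<zeta> < 1" unfolding \<zeta>_def by (rule cayley_norm_less_1[OF z w])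
  have nz: "z - cnj w \<noteq> 0" by (rule diff_cnj_nonzero[OF z w])
  have ww: "w - cnj w \<noteq> 0" by (rule diff_cnj_nonzero[OF w w])
  have "1 - \<zeta> = (w - cnj w) / (z - cnj w)"
    using nz by (simp add: \<zeta>_def divide_simps)
  moreover have "w - cnj w * \<zeta> = z * (w - cnj w) / (z - cnj w)"
    using nz by (simp add: \<zeta>_def divide_simps) (simp add: algebra_simps)
  ultimately have "T \<zeta> = z" unfolding T_def using nz ww by simp
  then have "norm ((h z - h w) / (h z - cnj (h w))) \<le> norm \<zeta>"
    using Schwarz_Lemma(1)[OF uhol u0 u1 zeta] by (simp add: u_def)
  then have "(norm ((h z - h w) / (h z - cnj (h w))))\<^sup>2 \<le> (norm \<zeta>)\<^sup>2"
    by (simp add: power_mono)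
  then have le: "(norm (h z - h w))\<^sup>2 * (norm (z - cnj w))\<^sup>2
      \<le> (norm (z - w))\<^sup>2 * (norm (h z - cnj (h w)))\<^sup>2"
    using diff_cnj_nonzero[OF z w] diff_cnj_nonzero[OF into[OF z] into[OF w]]
    by (simp add: \<zeta>_def norm_divide power_divide divide_simps)
  show ?thesis
    using le norm_diff_cnj_sq[of "h z" "h w"] norm_diff_cnj_sq[of z w] by (simp add: algebra_simps)
qed

text \<open>
  A Moebius map of the disc moves \<open>\<phi> z\<close> to 0; the Schwarz lemma then bounds the derivative at the centre.
\<close>

lemma schwarz_pick_deriv:
  assumes holo: "\<phi> holomorphic_on ball z y" and y: "y > 0"
    and into: "\<And>w. w \<in> ball z y \<Longrightarrow> norm (\<phi> w) < 1"
  shows "norm (deriv \<phi> z) \<le> (1 - (norm (\<phi> z))\<^sup>2) / y"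
proof -
  define a where "a = \<phi> z"
  have a1: "norm a < 1" using into[of z] y by (simp add: a_def)
  have inb: "z + of_real y * \<zeta> \<in> ball z y" if "norm \<zeta> < 1" for \<zeta>
    using that y by (simp add: dist_norm norm_mult)
  define u where "u = (\<lambda>\<zeta>. Moebius_function 0 a (\<phi> (z + of_real y * \<zeta>)))"
  have \<phi>1: "(\<lambda>\<zeta>. \<phi> (z + of_real y * \<zeta>)) holomorphic_on ball 0 1"
  proof -
    have "(\<lambda>\<zeta>. z + of_real y * \<zeta>) holomorphic_on ball 0 1" by (intro holomorphic_intros)
    then show ?thesis
      using holomorphic_on_compose_gen[OF _ holo] inb by (simp add: o_def image_subset_iff)
  qed
  have uh: "u holomorphic_on ball 0 1"
    using holomorphic_on_compose_gen[OF \<phi>1 Moebius_function_holomorphic[OF a1, of 0]] into[OF inb]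
    by (simp add: u_def o_def image_subset_iff)
  have u0: "u 0 = 0" by (simp add: u_def a_def Moebius_function_eq_zero)
  have u1: "norm (u \<zeta>) < 1" if "norm \<zeta> < 1" for \<zeta>
    unfolding u_def by (rule Moebius_function_norm_lt_1[OF a1 into[OF inb[OF that]]])
  have le: "norm (deriv u 0) \<le> 1" by (rule Schwarz_Lemma(2)[OF uh u0 u1, of 0]) auto
  have na: "1 - cnj a * a \<noteq> 0"
  proof -
    have "(norm a)\<^sup>2 < 1" using a1 by (simp add: power_less_one_iff)
    then have "norm (cnj a * a) < 1" by (simp add: norm_mult power2_eq_square)
    then show ?thesis by auto
  qed
  have "(\<phi> has_field_derivative deriv \<phi> z) (at z)"
    by (rule holomorphic_derivI[OF holo open_ball]) (use y in auto)
  then have "((\<lambda>\<zeta>. \<phi> (z + of_real y * \<zeta>)) has_field_derivative deriv \<phi> z * of_real y) (at 0)"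
    by (intro DERIV_chain2[where g = "\<lambda>\<zeta>. z + of_real y * \<zeta>"]) (auto intro!: derivative_eq_intros)
  then have "(u has_field_derivative
      (deriv \<phi> z * of_real y * (1 - cnj a * a) - (a - a) * - (cnj a * (deriv \<phi> z * of_real y))) / ((1 - cnj a * a) * (1 - cnj a * a))) (at 0)"
    unfolding u_def Moebius_function_simple using na
    by (auto intro!: derivative_eq_intros simp: a_def)
  then have "deriv u 0 = (deriv \<phi> z * of_real y * (1 - cnj a * a)) / ((1 - cnj a * a) * (1 - cnj a * a))"
    by (simp add: DERIV_imp_deriv)
  then have "deriv u 0 = deriv \<phi> z * of_real y / (1 - cnj a * a)"
    using na by simp
  moreover have "cmod (1 - cnj a * a) = 1 - (norm a)\<^sup>2"
  proof -
    have "1 - cnj a * a = of_real (1 - (norm a)\<^sup>2)"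
      by (simp only: of_real_diff of_real_1 complex_norm_square mult.commute)
    then show ?thesis using a1 by (simp only: norm_of_real) (simp add: power_le_one)
  qed
  moreover have "1 - (norm a)\<^sup>2 > 0" using a1 by (simp add: power_less_one_iff)
  ultimately have "cmod (deriv \<phi> z) * y / (1 - (norm a)\<^sup>2) \<le> 1"
    using le y by (simp only: norm_divide norm_mult norm_of_real abs_of_pos)
  with \<open>1 - (norm a)\<^sup>2 > 0\<close> y show ?thesis by (simp add: a_def divide_simps split: if_splits)
qed

section \<open>Typically real functions\<close>

lemma abs_sin_mult_le: "\<bar>sin (real n * t)\<bar> \<le> real n * \<bar>sin t\<bar>"
proof (induction n)
  case (Suc n)
  have "\<bar>sin (real (Suc n) * t)\<bar> = \<bar>sin (real n * t) * cos t + cos (real n * t) * sin t\<bar>"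
  proof -
    have "real (Suc n) * t = real n * t + t" by (simp add: algebra_simps)
    then show ?thesis by (simp add: sin_add)
  qed
  also have "\<dots> \<le> \<bar>sin (real n * t)\<bar> * 1 + 1 * \<bar>sin t\<bar>"
    by (intro order_trans[OF abs_triangle_ineq] add_mono)
       (auto simp: abs_mult intro!: mult_left_le mult_left_le_one_le)
  also have "\<dots> \<le> real (Suc n) * \<bar>sin t\<bar>" using Suc by (simp add: algebra_simps)
  finally show ?case .
qed simp

text \<open>
  The derivative is the limit of the difference quotients along the real line, which are real.
\<close>

lemma deriv_real_on_reals:
  assumes "open S" "f holomorphic_on S" "\<And>t. of_real t \<in> S \<Longrightarrow> f (of_real t) \<in> \<real>" "of_real x \<in> S"
  shows "deriv f (of_real x) \<in> \<real>"
proof -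
  have D: "(f has_field_derivative deriv f (of_real x)) (at (of_real x))"
    using assms holomorphic_derivI by blast
  then have *: "((\<lambda>h. (f (of_real x + h) - f (of_real x)) / h) \<longlongrightarrow> deriv f (of_real x)) (at 0)"
    by (simp add: DERIV_def)
  have lim: "((\<lambda>h::real. (f (of_real x + of_real h) - f (of_real x)) / of_real h) \<longlongrightarrow> deriv f (of_real x)) (at 0)"
    by (rule filterlim_compose[OF *]) (auto simp: filterlim_at intro!: tendsto_eq_intros simp: eventually_at_filter)
  obtain e where e: "e > 0" "ball (of_real x) e \<subseteq> S" using assms(1,4) open_contains_ball by blast
  have "\<forall>\<^sub>F h in at (0::real). (f (of_real x + of_real h) - f (of_real x)) / of_real h \<in> \<real>"
    unfolding eventually_at
  proof (intro exI conjI ballI impI)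
    fix h :: real assume "h \<in> UNIV" "h \<noteq> 0 \<and> dist h 0 < e"
    then have "of_real (x + h) \<in> S" using e by (auto simp: dist_norm intro!: subsetD[OF e(2)])
    then have "f (of_real x + of_real h) \<in> \<real>" using assms(3)[of "x + h"] by simp
    then show "(f (of_real x + of_real h) - f (of_real x)) / of_real h \<in> \<real>"
      using assms(3,4) by auto
  qed (use e in auto)
  then show ?thesis
    by (rule Lim_in_closed_set[OF closed_complex_Reals _ _ lim]) auto
qed

lemma higher_deriv_real_on_reals:
  assumes "open S" "f holomorphic_on S" "\<And>t. of_real t \<in> S \<Longrightarrow> f (of_real t) \<in> \<real>" "of_real x \<in> S"
  shows "(deriv ^^ n) f (of_real x) \<in> \<real>"
  using assms(4)
proof (induction n arbitrary: x)
  case 0 then show ?case using assms by simp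
next
  case (Suc n)
  show ?case
    using deriv_real_on_reals[OF assms(1) holomorphic_higher_deriv[OF assms(2,1)] _ Suc.prems, of n] Suc.IH by simp
qed

text \<open>
  The Taylor coefficients at a real centre are real, so the power series commutes with conjugation.
\<close>

lemma cnj_symmetric_of_real_on_reals:
  assumes holo: "f holomorphic_on ball (of_real x) R"
    and real: "\<And>t. \<bar>t - x\<bar> < R \<Longrightarrow> f (of_real t) \<in> \<real>"
    and z: "z \<in> ball (of_real x) R"
  shows "f (cnj z) = cnj (f z)"
proof -
  have zR: "cmod (of_real x - z) < R" using z by (simp add: dist_norm)
  then have R: "0 < R" using norm_ge_zero le_less_trans by blast
  have "cmod (of_real x - cnj z) < R"
    using zR complex_mod_cnj[of "of_real x - z"] by simp
  then have cz: "cnj z \<in> ball (of_real x) R" by (simp add: dist_norm)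
  define a where "a = (\<lambda>n. (deriv ^^ n) f (of_real x) / fact n)"
  have real': "f (of_real t) \<in> \<real>" if "of_real t \<in> ball (complex_of_real x) R" for t
  proof -
    have "cmod (of_real (x - t)) < R" using that by (simp add: dist_norm)
    then show ?thesis using real[of t] unfolding norm_of_real by (simp add: abs_minus_commute)
  qed
  have "(deriv ^^ n) f (of_real x) \<in> \<real>" for n
    by (rule higher_deriv_real_on_reals[OF open_ball holo real']) (use R in auto)
  then have a: "cnj (a n) = a n" for n
    by (simp add: a_def Reals_cnj_iff)
  have "(\<lambda>n. cnj (a n * (z - of_real x) ^ n)) sums cnj (f z)"
    unfolding sums_cnj a_def using holomorphic_power_series[OF holo z] by simp
  then have "(\<lambda>n. a n * (cnj z - of_real x) ^ n) sums cnj (f z)"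
    by (simp add: a)
  moreover have "(\<lambda>n. a n * (cnj z - of_real x) ^ n) sums f (cnj z)"
    using holomorphic_power_series[OF holo cz] by (simp add: a_def)
  ultimately show ?thesis using sums_unique2 by blast
qed

text \<open>
  On the circle \<open>x + r exp(i\<theta>)\<close> Cauchy's formula gives the coefficient of \<open>f\<close> at the frequency \<open>n\<close>, and
  Cauchy's theorem shows that the one at \<open>-n\<close> vanishes. Combining the two with a conjugation leaves the
  sine coefficient of \<open>Im f\<close>. The circle is parametrized by \<open>t = \<theta> / (2\<pi>)\<close>.
\<close>

lemma typically_real_fourier:
  assumes holo: "f holomorphic_on ball (of_real x) R"
    and r: "0 < r" "r < R" and n: "0 < n"
  shows "((\<lambda>t. Im (f (of_real x + of_real r * exp (2 * of_real pi * \<i> * of_real t))) * sin (real n * (2 * pi * t)))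
     has_integral (Re ((deriv ^^ n) f (of_real x)) * r ^ n / fact n / 2)) {0..1}"
proof -
  define \<gamma> where "\<gamma> = (\<lambda>t::real. of_real x + of_real r * exp (2 * of_real pi * \<i> * of_real t))"
  define E where "E = (\<lambda>t::real. exp (2 * of_real pi * \<i> * of_real t))"
  define b where "b = (deriv ^^ n) f (of_real x) * of_real r ^ n / fact n"
  have E0: "E t \<noteq> 0" for t by (simp add: E_def)
  have gE: "\<gamma> t - of_real x = of_real r * E t" for t by (simp add: \<gamma>_def E_def)
  have circ: "circlepath (of_real x) r t = \<gamma> t" for t by (simp add: circlepath \<gamma>_def)
  have vd: "vector_derivative (circlepath (of_real x) r) (at t within {0..1}) = 2 * pi * \<i> * r * E t"
    if "t \<in> {0..1}" for t
    using that by (simp add: vector_derivative_circlepath01 E_def)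
  have cont: "continuous_on (cball (of_real x) r) f"
    using r by (intro holomorphic_on_imp_continuous_on holomorphic_on_subset[OF holo]) auto
  have holr: "f holomorphic_on ball (of_real x) r"
    using r by (intro holomorphic_on_subset[OF holo]) auto
  have "((\<lambda>u. f u / (u - of_real x) ^ Suc n) has_contour_integral
      (2 * pi * \<i> / fact n * (deriv ^^ n) f (of_real x))) (circlepath (of_real x) r)"
    by (rule Cauchy_has_contour_integral_higher_derivative_circlepath[OF cont holr]) (use r in auto)
  then have "((\<lambda>t. f (\<gamma> t) / (of_real r * E t) ^ Suc n * (2 * pi * \<i> * r * E t)) has_integral
      (2 * pi * \<i> / fact n * (deriv ^^ n) f (of_real x))) {0..1}"
    unfolding has_contour_integral_def
    by (rule has_integral_eq[rotated]) (simp add: circ vd gE)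
  then have "((\<lambda>t. (of_real r ^ n / (2 * pi * \<i>)) * (f (\<gamma> t) / (of_real r * E t) ^ Suc n * (2 * pi * \<i> * r * E t)))
      has_integral (of_real r ^ n / (2 * pi * \<i>)) * (2 * pi * \<i> / fact n * (deriv ^^ n) f (of_real x))) {0..1}"
    by (rule has_integral_mult_right)
  then have "((\<lambda>t. f (\<gamma> t) / E t ^ n) has_integral b) {0..1}"
    using r E0 by (simp add: b_def power_mult_distrib field_simps)
  then have 1: "((\<lambda>t. cnj (f (\<gamma> t) / E t ^ n)) has_integral cnj b) {0..1}"
    by (subst (asm) has_integral_cnj[symmetric]) (simp add: o_def)
  have cE: "cnj (E t) = 1 / E t" for t
    by (simp add: E_def exp_cnj exp_minus divide_inverse)
  have 2: "((\<lambda>t. cnj (f (\<gamma> t)) * E t ^ n) has_integral cnj b) {0..1}"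
    using 1 by (simp add: cE power_divide)
  have "((\<lambda>u. f u * (u - of_real x) ^ (n - 1)) has_contour_integral 0) (circlepath (of_real x) r)"
    by (rule Cauchy_theorem_convex_simple[of _ "ball (of_real x) R"])
       (use r in \<open>auto intro!: holomorphic_intros holo\<close>)
  then have "((\<lambda>t. f (\<gamma> t) * (of_real r * E t) ^ (n - 1) * (2 * pi * \<i> * r * E t)) has_integral 0) {0..1}"
    unfolding has_contour_integral_def
    by (rule has_integral_eq[rotated]) (simp add: circ vd gE)
  then have "((\<lambda>t. 1 / (of_real r ^ n * (2 * pi * \<i>)) * (f (\<gamma> t) * (of_real r * E t) ^ (n - 1) * (2 * pi * \<i> * r * E t)))
      has_integral 1 / (of_real r ^ n * (2 * pi * \<i>)) * 0) {0..1}"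
    by (rule has_integral_mult_right)
  moreover have "1 / (of_real r ^ n * (2 * pi * \<i>)) * (f (\<gamma> t) * (of_real r * E t) ^ (n - 1) * (2 * pi * \<i> * r * E t))
      = f (\<gamma> t) * E t ^ n" for t
    using r n by (cases n) (auto simp: power_mult_distrib field_simps)
  ultimately have 3: "((\<lambda>t. f (\<gamma> t) * E t ^ n) has_integral 0) {0..1}" by simp
  have "((\<lambda>t. - (Re (f (\<gamma> t) * E t ^ n - cnj (f (\<gamma> t)) * E t ^ n) / 2)) has_integral - (Re (0 - cnj b) / 2)) {0..1}"
    by (intro has_integral_neg has_integral_divide has_integral_Re has_integral_diff 2 3)
  moreover have "- (Re (f (\<gamma> t) * E t ^ n - cnj (f (\<gamma> t)) * E t ^ n) / 2) = Im (f (\<gamma> t)) * sin (real n * (2 * pi * t))" for t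
  proof -
    have "E t ^ n = cis (real n * (2 * pi * t))"
      by (simp add: E_def cis_conv_exp exp_of_nat_mult[symmetric] algebra_simps)
    then show ?thesis by simp
  qed
  moreover have "- (Re (0 - cnj b) / 2) = Re ((deriv ^^ n) f (of_real x)) * r ^ n / fact n / 2"
  proof -
    have "b = (deriv ^^ n) f (of_real x) * of_real (r ^ n / fact n)" by (simp add: b_def)
    then have "Re b = Re ((deriv ^^ n) f (of_real x)) * (r ^ n / fact n)" by (simp only: times_complex.sel Re_complex_of_real Im_complex_of_real mult_zero_right diff_zero)
    then show ?thesis by simp
  qed
  ultimately show ?thesis by (simp only: \<gamma>_def)
qed

text \<open>
  By symmetry under conjugation \<open>Im f\<close> and \<open>sin \<theta>\<close> have the same sign on all of the circle, so
  \<open>|Im f sin n\<theta>| \<le> n Im f sin \<theta>\<close>, and integration compares the \<open>n\<close>-th with the first coefficient. This is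
  Rogosinski's bound for typically real functions.
\<close>

lemma typically_real_coefficient_bound:
  assumes holo: "f holomorphic_on ball (of_real x) R" and R: "0 < R"
    and real: "\<And>t. \<bar>t - x\<bar> < R \<Longrightarrow> f (of_real t) \<in> \<real>"
    and pos: "\<And>z. z \<in> ball (of_real x) R \<Longrightarrow> Im z > 0 \<Longrightarrow> Im (f z) > 0"
    and n: "0 < n"
  shows "\<bar>Re ((deriv ^^ n) f (of_real x))\<bar> * R ^ (n - 1) \<le> real n * fact n * Re (deriv f (of_real x))"
proof -
  let ?D = "\<lambda>n. Re ((deriv ^^ n) f (of_real x))"
  have main: "\<bar>?D n\<bar> * r ^ (n - 1) \<le> real n * fact n * Re (deriv f (of_real x))" if r: "0 < r" "r < R" for r
  proof -
    let ?g = "\<lambda>t. of_real x + of_real r * exp (2 * of_real pi * \<i> * of_real t)"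
    have Img: "Im (?g t) = r * sin (2 * pi * t)" for t by (simp add: Im_exp)
    have inb: "?g t \<in> ball (of_real x) R" for t
    proof -
      have "cmod (of_real x - ?g t) = cmod (of_real r * exp (2 * of_real pi * \<i> * of_real t))"
        by (simp add: norm_minus_commute)
      also have "\<dots> = r" using r by (simp add: norm_mult)
      finally show ?thesis using r by (simp only: mem_ball dist_norm)
    qed
    have sgn: "Im (f (?g t)) * sin (2 * pi * t) = \<bar>Im (f (?g t))\<bar> * \<bar>sin (2 * pi * t)\<bar>" for t
    proof (cases "sin (2 * pi * t)" "0::real" rule: linorder_cases)
      case greater
      then have "Im (?g t) > 0" unfolding Img using r by simp
      with pos[OF inb] have "Im (f (?g t)) > 0" .
      with greater show ?thesis by simp
    next
      case less
      have ib: "cnj (?g t) \<in> ball (of_real x) R"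
        using inb[of t] complex_mod_cnj[of "of_real x - ?g t"] by (simp add: dist_norm)
      have "Im (cnj (?g t)) > 0" using Img[of t] less r by (simp add: mult_less_0_iff)
      with pos[OF ib] have "Im (f (cnj (?g t))) > 0" .
      then have "Im (f (?g t)) < 0"
        using cnj_symmetric_of_real_on_reals[OF holo real inb, of t] by (simp del: complex_cnj_add complex_cnj_mult)
      with less show ?thesis by (simp add: abs_if)
    qed simp
    have F: "((\<lambda>t. Im (f (?g t)) * sin (real k * (2 * pi * t))) has_integral (?D k * r ^ k / fact k / 2)) {0..1}"
      if "0 < k" for k by (rule typically_real_fourier[OF holo r that])
    have F1: "((\<lambda>t. real n * (Im (f (?g t)) * sin (real 1 * (2 * pi * t)))) has_integral (real n * (?D 1 * r ^ 1 / fact 1 / 2))) {0..1}"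
      by (rule has_integral_mult_right[OF F]) simp
    have bd: "\<bar>Im (f (?g t)) * sin (real n * (2 * pi * t))\<bar> \<le> real n * (Im (f (?g t)) * sin (real 1 * (2 * pi * t)))" for t
    proof -
      have "\<bar>Im (f (?g t)) * sin (real n * (2 * pi * t))\<bar> \<le> \<bar>Im (f (?g t))\<bar> * (real n * \<bar>sin (2 * pi * t)\<bar>)"
        unfolding abs_mult by (intro mult_left_mono abs_sin_mult_le) simp
      then show ?thesis using sgn[of t] by (simp add: algebra_simps)
    qed
    have "?D n * r ^ n / fact n / 2 \<le> real n * (?D 1 * r ^ 1 / fact 1 / 2)"
      by (rule has_integral_le[OF F[OF n] F1]) (use bd abs_le_iff in blast)
    moreover have "- (?D n * r ^ n / fact n / 2) \<le> real n * (?D 1 * r ^ 1 / fact 1 / 2)"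
      by (rule has_integral_le[OF has_integral_neg[OF F[OF n]] F1]) (use bd abs_le_iff in blast)
    ultimately have "\<bar>?D n * r ^ n / fact n / 2\<bar> \<le> real n * (?D 1 * r ^ 1 / fact 1 / 2)" by linarith
    moreover have "\<bar>?D n * r ^ n / fact n / 2\<bar> = \<bar>?D n\<bar> * r ^ n / fact n / 2"
      using r by (simp add: abs_mult)
    ultimately have "\<bar>?D n\<bar> * r ^ n \<le> (real n * fact n * ?D 1) * r"
      by (simp add: field_simps)
    moreover have "r ^ n = r ^ (n - 1) * r" using n by (simp add: power_eq_if)
    ultimately show ?thesis using r by simp
  qed
  have "((\<lambda>r. \<bar>?D n\<bar> * r ^ (n - 1)) \<longlongrightarrow> \<bar>?D n\<bar> * R ^ (n - 1)) (at_left R)"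
    by (intro tendsto_intros)
  moreover have "\<forall>\<^sub>F r in at_left R. \<bar>?D n\<bar> * r ^ (n - 1) \<le> real n * fact n * Re (deriv f (of_real x))"
    using eventually_at_left_real[OF R] by eventually_elim (use main in auto)
  ultimately show ?thesis
    by (rule tendsto_upperbound) simp
qed

text \<open>
  Otherwise the coefficient bound makes all derivatives at \<open>x\<close> vanish, and \<open>f\<close> is a real constant.
\<close>

lemma typically_real_deriv_pos:
  assumes holo: "f holomorphic_on ball (of_real x) R" and R: "0 < R"
    and real: "\<And>t. \<bar>t - x\<bar> < R \<Longrightarrow> f (of_real t) \<in> \<real>"
    and pos: "\<And>z. z \<in> ball (of_real x) R \<Longrightarrow> Im z > 0 \<Longrightarrow> Im (f z) > 0"
  shows "Re (deriv f (of_real x)) > 0"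
proof (rule ccontr)
  assume neg: "\<not> Re (deriv f (of_real x)) > 0"
  have xb: "of_real x \<in> ball (complex_of_real x) R" using R by simp
  have real': "f (of_real t) \<in> \<real>" if "of_real t \<in> ball (complex_of_real x) R" for t
  proof -
    have "cmod (of_real (x - t)) < R" using that by (simp add: dist_norm)
    then show ?thesis using real[of t] unfolding norm_of_real by (simp add: abs_minus_commute)
  qed
  have "(deriv ^^ n) f (of_real x) = 0" if n: "0 < n" for n
  proof -
    have "\<bar>Re ((deriv ^^ n) f (of_real x))\<bar> * R ^ (n - 1) \<le> 0"
      using typically_real_coefficient_bound[OF assms n] neg
      by (smt (verit) mult_nonneg_nonpos of_nat_0_le_iff fact_ge_zero mult_nonneg_nonneg)
    then have "Re ((deriv ^^ n) f (of_real x)) = 0"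
      using R by (smt (verit) mult_pos_pos zero_less_power)
    moreover have "(deriv ^^ n) f (of_real x) \<in> \<real>"
      by (rule higher_deriv_real_on_reals[OF open_ball holo real' xb])
    ultimately show ?thesis by (auto simp: complex_is_Real_iff complex_eq_iff)
  qed
  then have eq: "f w = f (of_real x)" if "w \<in> ball (of_real x) R" for w
    using holomorphic_fun_eq_const_on_connected[OF holo open_ball _ _ xb that] by auto
  define w where "w = of_real x + \<i> * of_real (R / 2)"
  have w: "w \<in> ball (of_real x) R" "Im w > 0" using R by (auto simp: w_def dist_norm norm_mult)
  have "Im (f w) = 0" using eq[OF w(1)] real[of x] R by (simp add: complex_is_Real_iff)
  with pos[OF w] show False by simp
qed

section \<open>Continuous extension of the Riemann map to the flat part of the boundary\<close>

text \<open>
  The inverse map sends the closed disc of radius \<open>r\<close> onto a compact subset of \<open>D\<close>, which therefore stays at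
  a positive height above the real line.
\<close>

lemma riemann_map_near_boundary:
  assumes D: "D \<subseteq> upper_half_plane"
    and f: "continuous_on (ball 0 1) g" "\<And>w. w \<in> ball 0 1 \<Longrightarrow> g w \<in> D"
    and gf: "\<And>z. z \<in> D \<Longrightarrow> \<phi> z \<in> ball (0::complex) 1 \<and> g (\<phi> z) = z"
    and r: "0 \<le> r" "r < 1"
  obtains \<eta> where "\<eta> > 0" "\<And>z. z \<in> D \<Longrightarrow> Im z < \<eta> \<Longrightarrow> norm (\<phi> z) > r"
proof -
  have sub: "cball (0::complex) r \<subseteq> ball 0 1" using r by auto
  have "continuous_on (cball 0 r) (\<lambda>w. Im (g w))"
    by (intro continuous_intros continuous_on_subset[OF f(1) sub])
  moreover have "cball (0::complex) r \<noteq> {}" using r by simp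
  ultimately obtain w0 where w0: "w0 \<in> cball 0 r" "\<And>w. w \<in> cball 0 r \<Longrightarrow> Im (g w0) \<le> Im (g w)"
    using continuous_attains_inf[OF compact_cball, of 0 r "\<lambda>w. Im (g w)"] by blast
  show ?thesis
  proof
    show "Im (g w0) > 0" using w0(1) sub f(2) D by blast
    show "norm (\<phi> z) > r" if "z \<in> D" "Im z < Im (g w0)" for z
    proof (rule ccontr)
      assume "\<not> norm (\<phi> z) > r"
      then have "\<phi> z \<in> cball 0 r" by simp
      from w0(2)[OF this] gf[OF that(1)] that(2) show False by simp
    qed
  qed
qed

text \<open>
  With \<open>z - t = X + iY\<close> the function \<open>X\<^sup>2 - Y\<^sup>2 + 2\<rho>Y = Re ((z - t)\<^sup>2 - 2i\<rho>(z - t))\<close> is a harmonic barrier: it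
  is at least \<open>\<rho>\<^sup>2\<close> on the upper half of the circle of radius \<open>\<rho>\<close>, nonnegative near the diameter, and at
  most \<open>2\<rho>y\<close> at \<open>t + iy\<close>. Multiplied by \<open>k = ln 2 / \<rho>\<^sup>2\<close> it dominates \<open>-ln |\<phi>|\<close> on the circle, where
  \<open>|\<phi>| > 1/2\<close>, and almost dominates it near the diameter, where \<open>|\<phi>|\<close> is almost 1. The maximum modulus
  principle for \<open>E\<close> carries this over to the half disc.
\<close>

lemma barrier_estimate:
  fixes \<phi> :: "complex \<Rightarrow> complex"
  assumes \<rho>: "0 < \<rho>" and y: "0 < y" "y < \<rho>"
    and holo: "\<phi> holomorphic_on {z. norm (z - of_real t) < 2 * \<rho> \<and> Im z > 0}"
    and half: "\<And>z. norm (z - of_real t) < 2 * \<rho> \<Longrightarrow> Im z > 0 \<Longrightarrow> norm (\<phi> z) > 1 / 2"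
    and lim: "\<And>r. 0 \<le> r \<Longrightarrow> r < 1 \<Longrightarrow> \<exists>\<eta>>0. \<forall>z. norm (z - of_real t) < 2 * \<rho> \<longrightarrow> 0 < Im z \<longrightarrow> Im z < \<eta> \<longrightarrow> norm (\<phi> z) > r"
  shows "1 - norm (\<phi> (of_real t + \<i> * of_real y)) \<le> 2 * ln 2 / \<rho> * y"
proof -
  define k where "k = ln 2 / \<rho>\<^sup>2"
  have k: "k > 0" using \<rho> by (simp add: k_def)
  define z0 where "z0 = of_real t + \<i> * of_real y"
  define E where "E = (\<lambda>z. exp (- of_real k * ((z - of_real t)\<^sup>2 - 2 * \<i> * of_real \<rho> * (z - of_real t))) / \<phi> z)"
  have nE: "norm (E z) = exp (- k * ((Re z - t)\<^sup>2 - (Im z)\<^sup>2 + 2 * \<rho> * Im z)) / norm (\<phi> z)" for z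
    by (simp add: E_def norm_divide power2_eq_square)
  have main: "norm (E z0) \<le> 1 / r" if r: "1 / 2 < r" "r < 1" for r
  proof -
    obtain \<eta> where \<eta>: "\<eta> > 0" "\<And>z. norm (z - of_real t) < 2 * \<rho> \<Longrightarrow> 0 < Im z \<Longrightarrow> Im z < \<eta> \<Longrightarrow> norm (\<phi> z) > r"
      using lim[of r] r by force
    \<comment> \<open>Below height \<open>\<eta>\<close> the bound \<open>|\<phi>| > r\<close> holds, so the half disc is cut off at a height \<open>\<theta> < \<eta>\<close>. This
      also keeps the closure of \<open>V\<close> inside the domain of \<open>\<phi>\<close>, which is not defined on the real line.\<close>
    define \<theta> where "\<theta> = min \<eta> y / 2"
    have \<theta>: "0 < \<theta>" "\<theta> < \<eta>" "\<theta> < y" using \<eta> y by (auto simp: \<theta>_def)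
    define V where "V = ball (of_real t) \<rho> \<inter> {z. Im z > \<theta>}"
    define W where "W = cball (of_real t) \<rho> \<inter> {z. Im z \<ge> \<theta>}"
    have oV: "open V" unfolding V_def by (intro open_Int open_ball open_halfspace_Im_gt)
    have cW: "closed W" unfolding W_def by (intro closed_Int closed_cball closed_halfspace_Im_ge)
    have VW: "V \<subseteq> W" by (auto simp: V_def W_def)
    have clV: "closure V \<subseteq> W" using closure_minimal[OF VW cW] .
    have Wsub: "W \<subseteq> {z. norm (z - of_real t) < 2 * \<rho> \<and> Im z > 0}"
      using \<rho> \<theta> by (auto simp: W_def dist_norm norm_minus_commute)
    have Ehol: "E holomorphic_on {z. norm (z - of_real t) < 2 * \<rho> \<and> Im z > 0}"
      unfolding E_def using half by (intro holomorphic_intros holo) force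
    have fr: "norm (E z) \<le> 1 / r" if z: "z \<in> frontier V" for z
    proof -
      have zW: "z \<in> W" using z clV by (auto simp: frontier_def)
      have zV: "z \<notin> V" using z oV by (simp add: frontier_def interior_open)
      have zz: "norm (z - of_real t) < 2 * \<rho>" "Im z > 0" using zW Wsub by auto
      have imle: "Im z \<le> \<rho>"
        using zW abs_Im_le_cmod[of "z - of_real t"] by (auto simp: W_def dist_norm norm_minus_commute)
      have ph: "norm (\<phi> z) > 1/2" by (rule half[OF zz])
      show ?thesis
      proof (cases "norm (z - of_real t) = \<rho>")
        case True
        have "(Re z - t)\<^sup>2 + (Im z)\<^sup>2 = \<rho>\<^sup>2"
          using True cmod_power2[of "z - of_real t"] by simp
        then have "(Re z - t)\<^sup>2 - (Im z)\<^sup>2 + 2 * \<rho> * Im z = \<rho>\<^sup>2 + 2 * Im z * (\<rho> - Im z)"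
          by (simp add: power2_eq_square algebra_simps)
        also have "\<dots> \<ge> \<rho>\<^sup>2" using zz imle by simp
        finally have "k * ((Re z - t)\<^sup>2 - (Im z)\<^sup>2 + 2 * \<rho> * Im z) \<ge> k * \<rho>\<^sup>2"
          using k by simp
        also have "k * \<rho>\<^sup>2 = ln 2" using \<rho> by (simp add: k_def)
        finally have "exp (- k * ((Re z - t)\<^sup>2 - (Im z)\<^sup>2 + 2 * \<rho> * Im z)) \<le> exp (- ln 2)" by simp
        also have "exp (- ln 2 :: real) = 1 / 2" by (simp add: exp_minus)
        finally have "norm (E z) \<le> (1/2) / (1/2)" unfolding nE using ph by (intro frac_le) auto
        also have "\<dots> \<le> 1 / r" using r by simp
        finally show ?thesis .
      next
        case False
        then have "Im z = \<theta>" using zW zV by (auto simp: V_def W_def dist_norm norm_minus_commute)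
        then have "norm (\<phi> z) > r" using \<eta>(2)[OF zz] \<theta> by simp
        moreover have "(Re z - t)\<^sup>2 - (Im z)\<^sup>2 + 2 * \<rho> * Im z \<ge> 0"
        proof -
          have "Im z * Im z \<le> 2 * \<rho> * Im z" using imle zz by (intro mult_right_mono) auto
          then show ?thesis using zero_le_power2[of "Re z - t"] unfolding power2_eq_square by linarith
        qed
        ultimately show ?thesis unfolding nE using r k by (intro frac_le) auto
      qed
    qed
    have "norm (E z0) \<le> 1 / r"
    proof (rule maximum_modulus_frontier[of E V "1 / r" z0])
      show "E holomorphic_on interior V"
        using Wsub VW by (intro holomorphic_on_subset[OF Ehol]) (auto dest: interior_subset[THEN subsetD])
      show "continuous_on (closure V) E"
        using Wsub clV by (intro holomorphic_on_imp_continuous_on[OF holomorphic_on_subset[OF Ehol]]) auto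
      show "bounded V" by (auto simp: V_def intro: bounded_subset[OF bounded_ball])
      show "z0 \<in> V" using y \<theta> by (auto simp: V_def z0_def dist_norm norm_mult)
    qed (rule fr)
    then show ?thesis .
  qed
  have E1: "norm (E z0) \<le> 1"
  proof -
    have "((\<lambda>r. 1 / r) \<longlongrightarrow> 1 / 1) (at_left (1::real))" by (intro tendsto_intros) simp
    moreover have "\<forall>\<^sub>F r in at_left (1::real). norm (E z0) \<le> 1 / r"
      by (rule eventually_mono[OF eventually_at_left_real[of "1/2" 1]]) (use main in auto)
    ultimately show ?thesis by (intro tendsto_lowerbound[where F = "at_left (1::real)"]) auto
  qed
  have z0: "norm (z0 - of_real t) < 2 * \<rho>" "Im z0 > 0" using y \<rho> by (auto simp: z0_def norm_mult)
  have p: "norm (\<phi> z0) > 0" using half[OF z0] by linarith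
  have "exp (- k * (2 * \<rho> * y)) \<le> exp (- k * (2 * \<rho> * y - y\<^sup>2))"
    using k by (simp add: mult_left_mono)
  also have "\<dots> = norm (E z0) * norm (\<phi> z0)" using p unfolding nE by (simp add: z0_def)
  also have "\<dots> \<le> norm (\<phi> z0)" using E1 by (simp add: mult_left_le_one_le)
  finally have "1 + (- k * (2 * \<rho> * y)) \<le> norm (\<phi> z0)"
    using exp_ge_add_one_self[of "- k * (2 * \<rho> * y)"] by linarith
  moreover have "k * (2 * \<rho> * y) = 2 * ln 2 / \<rho> * y" using \<rho> by (simp add: k_def power2_eq_square)
  ultimately show ?thesis by (simp add: z0_def)
qed

abbreviation half_disc :: "real \<Rightarrow> real \<Rightarrow> complex set" where
  "half_disc x R \<equiv> ball (of_real x) R \<inter> upper_half_plane"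

lemma near_half_disc:
  assumes "\<bar>t - x\<bar> + norm (z - of_real t) < R" "Im z > 0"
  shows "z \<in> half_disc x R"
proof -
  have "norm (of_real x - z) \<le> norm (complex_of_real (x - t)) + norm (of_real t - z)"
    using norm_triangle_ineq[of "complex_of_real (x - t)" "of_real t - z"] by simp
  then show ?thesis using assms unfolding norm_of_real by (simp add: dist_norm norm_minus_commute abs_minus_commute)
qed

text \<open>
  The Schwarz-Pick inequality bounds \<open>|\<phi>'|\<close> by \<open>(1 - |\<phi>|\<^sup>2) / Im z\<close>, and by the barrier estimate this quotient
  stays bounded up to the real line.
\<close>

lemma riemann_map_lipschitz_near_boundary:
  assumes D: "D \<subseteq> upper_half_plane"
    and g: "continuous_on (ball 0 1) g" "\<And>w. w \<in> ball 0 1 \<Longrightarrow> g w \<in> D"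
    and gf: "\<And>z. z \<in> D \<Longrightarrow> \<phi> z \<in> ball (0::complex) 1 \<and> g (\<phi> z) = z"
    and holo: "\<phi> holomorphic_on D"
    and x: "real_analytic_boundary_point D x"
  obtains \<rho> L where "\<rho> > 0" "half_disc x \<rho> \<subseteq> D"
    "\<And>z w. z \<in> half_disc x \<rho> \<Longrightarrow> w \<in> half_disc x \<rho> \<Longrightarrow> norm (\<phi> z - \<phi> w) \<le> L * norm (z - w)"
proof -
  obtain R where R: "R > 0" "half_disc x R \<subseteq> D"
    using x unfolding real_analytic_boundary_point_def by blast
  obtain \<eta> where \<eta>: "\<eta> > 0" "\<And>z. z \<in> D \<Longrightarrow> Im z < \<eta> \<Longrightarrow> norm (\<phi> z) > 1 / 2"
    using riemann_map_near_boundary[OF D g gf, of "1/2"] by auto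
  define \<rho> where "\<rho> = min (R / 4) (\<eta> / 4)"
  have \<rho>: "\<rho> > 0" "4 * \<rho> \<le> R" "4 * \<rho> \<le> \<eta>" using R \<eta> by (auto simp: \<rho>_def)
  have inD: "z \<in> D" if "\<bar>t - x\<bar> < \<rho>" "norm (z - of_real t) < 2 * \<rho>" "Im z > 0" for t z
    using near_half_disc[of t x z R] R \<rho> that by auto
  have sub: "half_disc x \<rho> \<subseteq> half_disc x R" using \<rho> by auto
  have gap: "1 - norm (\<phi> z) \<le> 2 * ln 2 / \<rho> * Im z" if z: "z \<in> half_disc x \<rho>" for z
  proof -
    have zx: "norm (z - of_real x) < \<rho>" using z by (simp add: dist_norm norm_minus_commute)
    have t: "\<bar>Re z - x\<bar> < \<rho>" using abs_Re_le_cmod[of "z - of_real x"] zx by simp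
    have y: "0 < Im z" "Im z < \<rho>" using abs_Im_le_cmod[of "z - of_real x"] zx z by auto
    have "1 - norm (\<phi> (of_real (Re z) + \<i> * of_real (Im z))) \<le> 2 * ln 2 / \<rho> * Im z"
    proof (rule barrier_estimate[OF \<rho>(1) y])
      show "\<phi> holomorphic_on {w. cmod (w - of_real (Re z)) < 2 * \<rho> \<and> 0 < Im w}"
        by (rule holomorphic_on_subset[OF holo]) (use inD[OF t] in auto)
      show "1/2 < norm (\<phi> w)" if "norm (w - of_real (Re z)) < 2 * \<rho>" "0 < Im w" for w
      proof (rule \<eta>(2)[OF inD[OF t that]])
        show "Im w < \<eta>" using abs_Im_le_cmod[of "w - of_real (Re z)"] that \<rho> by simp
      qed
      show "\<exists>\<eta>>0. \<forall>w. norm (w - of_real (Re z)) < 2 * \<rho> \<longrightarrow> 0 < Im w \<longrightarrow> Im w < \<eta> \<longrightarrow> r < norm (\<phi> w)"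
        if r: "0 \<le> r" "r < 1" for r
      proof -
        obtain \<theta> where "\<theta> > 0" "\<And>z. z \<in> D \<Longrightarrow> Im z < \<theta> \<Longrightarrow> norm (\<phi> z) > r"
          using riemann_map_near_boundary[OF D g gf r] by auto
        then show ?thesis using inD[OF t] by blast
      qed
    qed
    then show ?thesis by (simp only: complex_eq[of z, symmetric])
  qed
  define L where "L = 2 * (2 * ln 2 / \<rho>)"
  have der: "norm (deriv \<phi> z) \<le> L" if z: "z \<in> half_disc x \<rho>" for z
  proof -
    have zx: "norm (z - of_real x) < \<rho>" and y: "Im z > 0" using z by (auto simp: dist_norm norm_minus_commute)
    have yr: "Im z < \<rho>" using abs_Im_le_cmod[of "z - of_real x"] zx by simp
    have bD: "ball z (Im z) \<subseteq> D"
    proof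
      fix w assume w: "w \<in> ball z (Im z)"
      then have nw: "norm (w - z) < Im z" by (simp add: dist_norm norm_minus_commute)
      have "Im w > 0" using abs_Im_le_cmod[of "w - z"] nw by simp
      moreover have "norm (w - of_real x) < 2 * \<rho>"
        using norm_triangle_ineq[of "w - z" "z - of_real x"] nw zx yr by simp
      ultimately show "w \<in> D" using inD[of x w] \<rho> by simp
    qed
    have n1: "norm (\<phi> z) < 1" using gf[of z] subsetD[OF bD, of z] y by simp
    have "norm (deriv \<phi> z) \<le> (1 - (norm (\<phi> z))\<^sup>2) / Im z"
      by (rule schwarz_pick_deriv[OF holomorphic_on_subset[OF holo bD] y]) (use gf bD in auto)
    also have "1 - (norm (\<phi> z))\<^sup>2 = (1 + norm (\<phi> z)) * (1 - norm (\<phi> z))" by (simp add: power2_eq_square algebra_simps)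
    also have "\<dots> \<le> 2 * (2 * ln 2 / \<rho> * Im z)"
      using n1 gap[OF z] by (intro mult_mono) auto
    finally show ?thesis using y by (simp add: L_def divide_right_mono)
  qed
  show ?thesis
  proof
    show "\<rho> > 0" by fact
    show hD: "half_disc x \<rho> \<subseteq> D" using sub R by blast
    show "norm (\<phi> z - \<phi> w) \<le> L * norm (z - w)" if "z \<in> half_disc x \<rho>" "w \<in> half_disc x \<rho>" for z w
    proof (rule field_differentiable_bound[where S = "half_disc x \<rho>" and f' = "deriv \<phi>"])
      show "convex (half_disc x \<rho>)"
        by (intro convex_Int convex_ball convex_halfspace_Im_gt)
      have hN: "\<phi> holomorphic_on half_disc x \<rho>" by (rule holomorphic_on_subset[OF holo hD])
      have oN: "open (half_disc x \<rho>)" by (intro open_Int open_ball open_halfspace_Im_gt)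
      show "(\<phi> has_field_derivative deriv \<phi> u) (at u within half_disc x \<rho>)" if "u \<in> half_disc x \<rho>" for u
        by (rule has_field_derivative_at_within[OF holomorphic_derivI[OF hN oN that]])
    qed (use that der in auto)
  qed
qed

lemma of_real_notin_half_plane_domain:
  assumes "D \<subseteq> upper_half_plane" shows "of_real x \<notin> D"
  using assms by force

lemma real_analytic_boundary_point_nhd:
  assumes "half_disc x R \<subseteq> D" "\<bar>t - x\<bar> < R"
  shows "real_analytic_boundary_point D t" "half_disc t (R - \<bar>t - x\<bar>) \<subseteq> D"
proof -
  show *: "half_disc t (R - \<bar>t - x\<bar>) \<subseteq> D"
    using near_half_disc[of t x _ R] assms by (fastforce simp: dist_norm norm_minus_commute)
  then show "real_analytic_boundary_point D t"
    unfolding real_analytic_boundary_point_def using assms by (intro exI[of _ "R - \<bar>t - x\<bar>"]) auto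
qed

lemma half_disc_closure_real:
  assumes "\<bar>t - x\<bar> < R"
  shows "of_real t \<in> closure (half_disc x R)" "at (complex_of_real t) within half_disc x R \<noteq> bot"
proof -
  have "of_real t islimpt half_disc x R"
    unfolding islimpt_approachable
  proof (intro allI impI)
    fix e :: real assume e: "e > 0"
    define w where "w = of_real t + \<i> * of_real (min e (R - \<bar>t - x\<bar>) / 2)"
    have m: "min e (R - \<bar>t - x\<bar>) / 2 > 0" using e assms by simp
    have nw: "norm (w - of_real t) = min e (R - \<bar>t - x\<bar>) / 2"
      using m by (simp add: w_def norm_mult)
    have iw: "Im w > 0" using m by (simp add: w_def)
    have "w \<in> half_disc x R"
      by (rule near_half_disc[of t]) (use nw iw m in auto)
    moreover have "w \<noteq> of_real t" using iw by auto
    moreover have "dist w (of_real t) < e" unfolding dist_norm nw using m e by (simp add: min_def split: if_splits)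
    ultimately show "\<exists>x'\<in>half_disc x R. x' \<noteq> of_real t \<and> dist x' (of_real t) < e" by blast
  qed
  then show "of_real t \<in> closure (half_disc x R)" "at (complex_of_real t) within half_disc x R \<noteq> bot"
    by (auto simp: closure_def trivial_limit_within)
qed

text \<open>
  The Lipschitz bound yields a continuous extension near each boundary point. All these extensions are
  limits of \<open>\<phi>\<close> along \<open>D\<close>, hence they agree with each other; their values are unimodular by
  riemann_map_near_boundary.
\<close>

lemma riemann_map_continuous_extension:
  assumes D: "D \<subseteq> upper_half_plane" "open D"
    and g: "continuous_on (ball 0 1) g" "\<And>w. w \<in> ball 0 1 \<Longrightarrow> g w \<in> D"
    and gf: "\<And>z. z \<in> D \<Longrightarrow> \<phi> z \<in> ball (0::complex) 1 \<and> g (\<phi> z) = z"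
    and holo: "\<phi> holomorphic_on D"
  obtains \<Phi> where "continuous_on (D \<union> of_real ` {x. real_analytic_boundary_point D x}) \<Phi>"
    "\<And>z. z \<in> D \<Longrightarrow> \<Phi> z = \<phi> z" "\<And>x. real_analytic_boundary_point D x \<Longrightarrow> norm (\<Phi> (of_real x)) = 1"
proof -
  define S where "S = D \<union> complex_of_real ` {x. real_analytic_boundary_point D x}"
  define \<Phi> where "\<Phi> = (\<lambda>z. if z \<in> D then \<phi> z else Lim (at z within D) \<phi>)"
  have main: "continuous (at (of_real x) within S) \<Phi> \<and> norm (\<Phi> (of_real x)) = 1"
    if x: "real_analytic_boundary_point D x" for x
  proof -
    obtain \<rho> L where \<rho>: "\<rho> > 0" "half_disc x \<rho> \<subseteq> D"
      and L: "\<And>z w. z \<in> half_disc x \<rho> \<Longrightarrow> w \<in> half_disc x \<rho> \<Longrightarrow> norm (\<phi> z - \<phi> w) \<le> L * norm (z - w)"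
      using riemann_map_lipschitz_near_boundary[OF D(1) g gf holo x] by blast
    let ?N = "half_disc x \<rho>"
    have uc: "uniformly_continuous_on ?N \<phi>"
      unfolding uniformly_continuous_on_def
    proof (intro allI impI)
      fix e :: real assume e: "e > 0"
      show "\<exists>d>0. \<forall>z\<in>?N. \<forall>w\<in>?N. dist w z < d \<longrightarrow> dist (\<phi> w) (\<phi> z) < e"
      proof (intro exI[of _ "e / (\<bar>L\<bar> + 1)"] conjI ballI impI)
        fix z w assume zw: "z \<in> ?N" "w \<in> ?N" and d: "dist w z < e / (\<bar>L\<bar> + 1)"
        have "dist (\<phi> w) (\<phi> z) \<le> L * dist w z" using L[OF zw(2,1)] by (simp add: dist_norm)
        also have "\<dots> \<le> (\<bar>L\<bar> + 1) * dist w z" by (intro mult_right_mono) auto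
        also have "\<dots> < e" using d by (simp add: field_simps)
        finally show "dist (\<phi> w) (\<phi> z) < e" .
      qed (use e in auto)
    qed
    obtain h where h: "uniformly_continuous_on (closure ?N) h" "\<And>z. z \<in> ?N \<Longrightarrow> \<phi> z = h z"
      by (rule uniformly_continuous_on_extension_on_closure[OF uc]) (rule that)
    have hc: "continuous_on (closure ?N) h" by (rule uniformly_continuous_imp_continuous[OF h(1)])
    have DN: "z \<in> ?N" if "z \<in> D" "z \<in> ball (of_real x) \<rho>" for z using that D by blast
    have bnd: "of_real t \<in> closure ?N" "at (complex_of_real t) within D \<noteq> bot"
        "(\<phi> \<longlongrightarrow> h (of_real t)) (at (of_real t) within D)" "\<Phi> (of_real t) = h (of_real t)"
      if t: "of_real t \<in> ball (complex_of_real x) \<rho>" for t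
    proof -
      have tx: "\<bar>t - x\<bar> < \<rho>" using t unfolding mem_ball dist_of_real by (simp add: dist_norm)
      show cl: "of_real t \<in> closure ?N" by (rule half_disc_closure_real[OF tx])
      have eq: "at (complex_of_real t) within D = at (of_real t) within ?N"
        by (rule at_within_nhd[OF t open_ball]) (use DN \<rho> in auto)
      show nt: "at (complex_of_real t) within D \<noteq> bot"
        unfolding eq by (rule half_disc_closure_real[OF tx])
      have "(h \<longlongrightarrow> h (of_real t)) (at (of_real t) within closure ?N)"
        using hc cl by (simp add: continuous_on_def)
      then have "(h \<longlongrightarrow> h (of_real t)) (at (of_real t) within ?N)"
        by (rule tendsto_within_subset) (rule closure_subset)
      then have "(\<phi> \<longlongrightarrow> h (of_real t)) (at (of_real t) within ?N)"
        by (rule Lim_transform_eventually) (use h(2) in \<open>auto simp: eventually_at_filter\<close>)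
      then show lim: "(\<phi> \<longlongrightarrow> h (of_real t)) (at (of_real t) within D)" unfolding eq .
      show "\<Phi> (of_real t) = h (of_real t)"
        using tendsto_Lim[OF nt lim] of_real_notin_half_plane_domain[OF D(1), of t] by (simp add: \<Phi>_def)
    qed
    let ?T = "S \<inter> ball (of_real x) \<rho>"
    have T: "z \<in> closure ?N \<and> \<Phi> z = h z" if "z \<in> ?T" for z
    proof (cases "z \<in> D")
      case True
      with that have "z \<in> ?N" using DN by blast
      then show ?thesis using True h(2) closure_subset[of ?N] by (auto simp: \<Phi>_def)
    next
      case False
      with that obtain t where "z = of_real t" by (auto simp: S_def)
      with that show ?thesis using bnd(1,4)[of t] by blast
    qed
    have xb: "of_real x \<in> ball (complex_of_real x) \<rho>" using \<rho> by simp
    have xT: "of_real x \<in> ?T" using \<rho> x by (auto simp: S_def)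
    have "continuous_on ?T \<Phi>"
      by (rule continuous_on_eq[OF continuous_on_subset[OF hc]]) (use T in auto)
    then have "continuous (at (of_real x) within ?T) \<Phi>"
      using xT by (simp add: continuous_on_eq_continuous_within)
    moreover have "at (of_real x) within ?T = at (of_real x) within S"
      by (rule at_within_nhd[OF xb open_ball]) auto
    ultimately have c: "continuous (at (of_real x) within S) \<Phi>" by simp
    have lim: "(\<phi> \<longlongrightarrow> \<Phi> (of_real x)) (at (of_real x) within D)" using bnd(3,4)[OF xb] by simp
    have nlim: "((\<lambda>z. norm (\<phi> z)) \<longlongrightarrow> norm (\<Phi> (of_real x))) (at (of_real x) within D)"
      by (rule tendsto_norm[OF lim])
    have "norm (\<Phi> (of_real x)) \<le> 1"
    proof (rule tendsto_upperbound[OF nlim _ bnd(2)[OF xb]])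
      show "\<forall>\<^sub>F z in at (of_real x) within D. norm (\<phi> z) \<le> 1"
        unfolding eventually_at_filter
        by (rule always_eventually) (use gf in \<open>auto intro: less_imp_le\<close>)
    qed
    moreover have "r \<le> norm (\<Phi> (of_real x))" if r: "0 \<le> r" "r < 1" for r
    proof (rule tendsto_lowerbound[OF nlim _ bnd(2)[OF xb]])
      obtain \<eta> where \<eta>: "\<eta> > 0" "\<And>z. z \<in> D \<Longrightarrow> Im z < \<eta> \<Longrightarrow> norm (\<phi> z) > r"
        using riemann_map_near_boundary[OF D(1) g gf r] by auto
      show "\<forall>\<^sub>F z in at (of_real x) within D. r \<le> norm (\<phi> z)"
        unfolding eventually_at
      proof (intro exI[of _ \<eta>] conjI ballI impI)
        fix z assume z: "z \<in> D" "z \<noteq> of_real x \<and> dist z (of_real x) < \<eta>"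
        have "Im z < \<eta>" using abs_Im_le_cmod[of "z - of_real x"] z by (auto simp: dist_norm)
        from \<eta>(2)[OF z(1) this] show "r \<le> norm (\<phi> z)" by simp
      qed fact
    qed
    then have "1 \<le> norm (\<Phi> (of_real x))"
      by (intro dense_le_bounded[of 0 1]) auto
    ultimately show ?thesis using c by simp
  qed
  have "continuous_on S \<Phi>"
    unfolding continuous_on_eq_continuous_within
  proof
    fix z assume "z \<in> S"
    then consider "z \<in> D" | x where "z = of_real x" "real_analytic_boundary_point D x" by (auto simp: S_def)
    then show "continuous (at z within S) \<Phi>"
    proof cases
      case 1
      have "continuous_on D \<Phi>"
        by (rule continuous_on_eq[OF holomorphic_on_imp_continuous_on[OF holo]]) (simp add: \<Phi>_def)
      then have "continuous (at z) \<Phi>" using 1 D(2) by (simp add: continuous_on_eq_continuous_at)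
      then show ?thesis by (rule continuous_at_imp_continuous_at_within)
    next
      case 2
      then show ?thesis using main[of x] by simp
    qed
  qed
  show ?thesis
  proof (rule that)
    show "continuous_on (D \<union> of_real ` {x. real_analytic_boundary_point D x}) \<Phi>"
      using \<open>continuous_on S \<Phi>\<close> by (simp only: S_def)
    show "\<Phi> z = \<phi> z" if "z \<in> D" for z using that by (simp add: \<Phi>_def)
    show "norm (\<Phi> (of_real x)) = 1" if "real_analytic_boundary_point D x" for x using main[OF that] ..
  qed
qed

section \<open>Conformal maps onto the half plane that extend across the boundary\<close>

text \<open>
  This is the Schwarz-Pick inequality for the composition of \<open>h\<close> with the inverse of \<open>f\<close>. If \<open>h\<close> is conformal
  onto the half plane as well, exchanging \<open>f\<close> and \<open>h\<close> gives equality; if \<open>h\<close> is the identity, it compares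
  \<open>D\<close> with the upper half plane.
\<close>

lemma conformal_schwarz_pick:
  assumes D: "open D" and f: "conformal_map f D upper_half_plane"
    and h: "h holomorphic_on D" "\<And>z. z \<in> D \<Longrightarrow> Im (h z) > 0"
    and z: "z \<in> D" and w: "w \<in> D"
  shows "Im (f z) * Im (f w) * (norm (h z - cnj (h w)))\<^sup>2 \<le> Im (h z) * Im (h w) * (norm (f z - cnj (f w)))\<^sup>2"
proof -
  have hol: "f holomorphic_on D" and inj: "inj_on f D" and im: "f ` D = upper_half_plane"
    using f by (auto simp: conformal_map_def bij_betw_def)
  obtain g where g: "g holomorphic_on f ` D" "\<And>u. u \<in> D \<Longrightarrow> g (f u) = u"
    using holomorphic_has_inverse[OF hol D inj] by metis
  have gD: "g v \<in> D" if "Im v > 0" for v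
  proof -
    have "v \<in> f ` D" using that im by simp
    then show ?thesis using g(2) by force
  qed
  have pos: "Im (f u) > 0" if "u \<in> D" for u using that im by blast
  have "(\<lambda>v. h (g v)) holomorphic_on {v. Im v > 0}"
    using holomorphic_on_compose_gen[OF g(1) h(1)] gD unfolding im by (simp add: o_def image_subset_iff)
  from schwarz_pick_upper_half_plane[OF this h(2)[OF gD] pos[OF z] pos[OF w]]
  show ?thesis by (simp add: g(2)[OF z] g(2)[OF w])
qed

text \<open>
  The map is finite on the real interval of radius \<open>\<rho>\<close> around \<open>x\<close>; that it is real there is a consequence
  (boundary_chart_real).
\<close>

definition boundary_chart :: "complex set \<Rightarrow> (complex \<Rightarrow> complex) \<Rightarrow> real \<Rightarrow> real \<Rightarrow> bool" where
  "boundary_chart D f x \<rho> \<longleftrightarrow> 0 < \<rho> \<and> half_disc x \<rho> \<subseteq> D \<and>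
     conformal_map f D upper_half_plane \<and> f holomorphic_on ball (of_real x) \<rho>"

lemma boundary_chart_shift:
  assumes "boundary_chart D f x \<rho>" "0 < \<sigma>" "\<bar>t - x\<bar> + \<sigma> \<le> \<rho>"
  shows "boundary_chart D f t \<sigma>"
proof -
  have "ball (of_real t) \<sigma> \<subseteq> ball (complex_of_real x) \<rho>"
  proof
    fix z assume "z \<in> ball (complex_of_real t) \<sigma>"
    then have "dist (of_real t) z < \<sigma>" by simp
    moreover have "dist (complex_of_real x) (of_real t) = \<bar>t - x\<bar>"
      by (simp add: dist_norm abs_minus_commute flip: of_real_diff)
    ultimately have "dist (of_real x) z < \<rho>"
      using dist_triangle[of "of_real x" z "of_real t"] assms(3) by linarith
    then show "z \<in> ball (of_real x) \<rho>" by simp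
  qed
  then show ?thesis using assms holomorphic_on_subset unfolding boundary_chart_def by blast
qed

context
  fixes D :: "complex set"
  assumes openD: "open D" and DH: "D \<subseteq> upper_half_plane"
begin

text \<open>
  If \<open>f\<close> had a value in the half plane at a real point \<open>t\<close>, then the inverse of \<open>f\<close>, being continuous, would send
  this value to the limit of points of \<open>D\<close> that approach \<open>t\<close>. So \<open>t\<close> would lie in \<open>D\<close>.
\<close>

lemma boundary_chart_real:
  assumes ch: "boundary_chart D f x \<rho>" and t: "\<bar>t - x\<bar> < \<rho>"
  shows "f (of_real t) \<in> \<real>"
proof (rule ccontr)
  assume nr: "f (of_real t) \<notin> \<real>"
  have \<rho>: "\<rho> > 0" and sub: "half_disc x \<rho> \<subseteq> D" and hol: "f holomorphic_on ball (of_real x) \<rho>"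
    and hD: "f holomorphic_on D" and inj: "inj_on f D" and im: "f ` D = upper_half_plane"
    using ch by (auto simp: boundary_chart_def conformal_map_def bij_betw_def)
  have tb: "of_real t \<in> ball (complex_of_real x) \<rho>"
    using t by (simp add: dist_norm abs_minus_commute flip: of_real_diff)
  let ?F = "at (complex_of_real t) within half_disc x \<rho>"
  have nt: "?F \<noteq> bot" by (rule half_disc_closure_real[OF t])
  have "isCont f (of_real t)"
    using holomorphic_on_imp_continuous_on[OF hol] tb by (simp add: continuous_on_eq_continuous_at)
  then have "(f \<longlongrightarrow> f (of_real t)) (at (of_real t))" by (simp add: isCont_def)
  then have lim: "(f \<longlongrightarrow> f (of_real t)) ?F" by (rule tendsto_mono[OF at_le, rotated]) simp
  have evD: "\<forall>\<^sub>F z in ?F. z \<in> D"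
    unfolding eventually_at_filter by (rule always_eventually) (use sub in auto)
  have "0 \<le> Im (f (of_real t))"
  proof (rule tendsto_lowerbound[OF tendsto_Im[OF lim] _ nt])
    show "\<forall>\<^sub>F z in ?F. 0 \<le> Im (f z)"
      using evD by eventually_elim (use im in \<open>auto intro!: less_imp_le\<close>)
  qed
  then have p: "f (of_real t) \<in> f ` D" using nr im by (auto simp: complex_is_Real_iff)
  obtain g where g: "g holomorphic_on f ` D" "\<And>u. u \<in> D \<Longrightarrow> g (f u) = u"
    using holomorphic_has_inverse[OF hD openD inj] by metis
  have "open (f ` D)" unfolding im by (rule open_halfspace_Im_gt)
  then have "isCont g (f (of_real t))"
    using holomorphic_on_imp_continuous_on[OF g(1)] p by (auto simp: continuous_on_eq_continuous_at)
  then have "((\<lambda>z. g (f z)) \<longlongrightarrow> g (f (of_real t))) ?F"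
    using isCont_tendsto_compose lim by blast
  then have "((\<lambda>z. z) \<longlongrightarrow> g (f (of_real t))) ?F"
    by (rule Lim_transform_eventually) (use evD in eventually_elim, use g in auto)
  moreover have "((\<lambda>z. z) \<longlongrightarrow> of_real t) ?F" by (rule tendsto_ident_at)
  ultimately have "g (f (of_real t)) = of_real t" using tendsto_unique nt by blast
  moreover have "g (f (of_real t)) \<in> D" using p g(2) by force
  ultimately show False using of_real_notin_half_plane_domain[OF DH] by metis
qed

lemma boundary_chart_Im_pos:
  assumes "boundary_chart D f x \<rho>" "z \<in> ball (of_real x) \<rho>" "Im z > 0"
  shows "Im (f z) > 0"
  using assms unfolding boundary_chart_def conformal_map_def bij_betw_def by blast

lemma boundary_chart_deriv_pos:
  assumes "boundary_chart D f x \<rho>"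
  shows "Re (deriv f (of_real x)) > 0"
  using typically_real_deriv_pos[of f x \<rho>] boundary_chart_real[OF assms] boundary_chart_Im_pos[OF assms] assms
  by (auto simp: boundary_chart_def)

lemma boundary_chart_deriv_real:
  assumes ch: "boundary_chart D f x \<rho>"
  shows "(deriv ^^ n) f (of_real x) \<in> \<real>"
proof (rule higher_deriv_real_on_reals)
  show "f holomorphic_on ball (of_real x) \<rho>" "of_real x \<in> ball (complex_of_real x) \<rho>"
    using ch by (auto simp: boundary_chart_def)
  show "f (of_real t) \<in> \<real>" if "of_real t \<in> ball (complex_of_real x) \<rho>" for t
    using boundary_chart_real[OF ch, of t] that by (simp add: dist_norm abs_minus_commute flip: of_real_diff)
qed simp

lemma boundary_chart_Im_limit:
  assumes ch: "boundary_chart D f x \<rho>"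
  shows "((\<lambda>\<epsilon>. Im (f (of_real x + \<i> * of_real \<epsilon>)) / \<epsilon>) \<longlongrightarrow> Re (deriv f (of_real x))) (at_right 0)"
    and "((\<lambda>\<epsilon>. f (of_real x + \<i> * of_real \<epsilon>)) \<longlongrightarrow> f (of_real x)) (at_right (0::real))"
    and "\<forall>\<^sub>F \<epsilon> in at_right (0::real). of_real x + \<i> * of_real \<epsilon> \<in> D"
proof -
  have \<rho>: "\<rho> > 0" and sub: "half_disc x \<rho> \<subseteq> D" and hol: "f holomorphic_on ball (of_real x) \<rho>"
    using ch by (auto simp: boundary_chart_def)
  have D: "(f has_field_derivative deriv f (of_real x)) (at (of_real x))"
    by (rule holomorphic_derivI[OF hol open_ball]) (use \<rho> in simp)
  have l0: "filterlim (\<lambda>\<epsilon>::real. \<i> * complex_of_real \<epsilon>) (at 0) (at_right 0)"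
    by (auto simp: filterlim_at eventually_at_filter intro!: tendsto_eq_intros)
  have "((\<lambda>\<epsilon>::real. (f (of_real x + \<i> * of_real \<epsilon>) - f (of_real x)) / (\<i> * of_real \<epsilon>)) \<longlongrightarrow> deriv f (of_real x)) (at_right 0)"
    by (rule filterlim_compose[OF D[unfolded DERIV_def] l0])
  then have "((\<lambda>\<epsilon>::real. Re ((f (of_real x + \<i> * of_real \<epsilon>) - f (of_real x)) / (\<i> * of_real \<epsilon>))) \<longlongrightarrow> Re (deriv f (of_real x))) (at_right 0)"
    by (rule tendsto_Re)
  moreover have "Re ((f (of_real x + \<i> * of_real \<epsilon>) - f (of_real x)) / (\<i> * of_real \<epsilon>)) = Im (f (of_real x + \<i> * of_real \<epsilon>)) / \<epsilon>" for \<epsilon> :: real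
  proof -
    have "Im (f (of_real x)) = 0" using boundary_chart_real[OF ch, of x] \<rho> by (simp add: complex_is_Real_iff)
    then show ?thesis by (simp add: Re_divide power2_eq_square)
  qed
  ultimately show "((\<lambda>\<epsilon>. Im (f (of_real x + \<i> * of_real \<epsilon>)) / \<epsilon>) \<longlongrightarrow> Re (deriv f (of_real x))) (at_right 0)"
    by simp
  have l1: "((\<lambda>\<epsilon>::real. of_real x + \<i> * complex_of_real \<epsilon>) \<longlongrightarrow> of_real x) (at_right 0)"
    by (auto intro!: tendsto_eq_intros)
  show "((\<lambda>\<epsilon>. f (of_real x + \<i> * of_real \<epsilon>)) \<longlongrightarrow> f (of_real x)) (at_right (0::real))"
    by (rule isCont_tendsto_compose[OF DERIV_isCont[OF D] l1])
  have "\<forall>\<^sub>F \<epsilon> in at_right (0::real). of_real x + \<i> * of_real \<epsilon> \<in> ball (complex_of_real x) \<rho>"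
    using topological_tendstoD[OF l1 open_ball, of "of_real x" \<rho>] \<rho> by simp
  moreover have "\<forall>\<^sub>F \<epsilon> in at_right (0::real). \<epsilon> > 0" by (simp add: eventually_at_filter)
  ultimately show "\<forall>\<^sub>F \<epsilon> in at_right (0::real). of_real x + \<i> * of_real \<epsilon> \<in> D"
    by eventually_elim (use sub in auto)
qed

text \<open>
  This is the Schwarz-Pick inequality between \<open>f\<close> and \<open>h\<close> at \<open>x + i\<epsilon>\<close> and \<open>y + i\<epsilon>\<close>, divided by \<open>\<epsilon>\<^sup>2\<close>, in the
  limit. Applied in both directions it shows that the kernel does not depend on the chart.
\<close>

lemma boundary_chart_kernel_limit:
  assumes f: "boundary_chart D f x \<rho>" "boundary_chart D f y \<sigma>"
    and h: "boundary_chart D h x \<rho>'" "boundary_chart D h y \<sigma>'"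
  shows "Re (deriv f (of_real x)) * Re (deriv f (of_real y)) * (Re (h (of_real x)) - Re (h (of_real y)))\<^sup>2
    \<le> Re (deriv h (of_real x)) * Re (deriv h (of_real y)) * (Re (f (of_real x)) - Re (f (of_real y)))\<^sup>2"
proof -
  let ?z = "\<lambda>\<epsilon>::real. of_real x + \<i> * of_real \<epsilon>" and ?w = "\<lambda>\<epsilon>::real. of_real y + \<i> * of_real \<epsilon>"
  have real: "(norm (k (of_real x) - cnj (k (of_real y))))\<^sup>2 = (Re (k (of_real x)) - Re (k (of_real y)))\<^sup>2"
    if "boundary_chart D k x \<rho>1" "boundary_chart D k y \<rho>2" for k \<rho>1 \<rho>2
    using boundary_chart_real[OF that(1), of x] boundary_chart_real[OF that(2), of y] that
    by (simp add: cmod_power2 complex_is_Real_iff boundary_chart_def)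
  have lim: "((\<lambda>\<epsilon>. Im (f1 (?z \<epsilon>)) / \<epsilon> * (Im (f1 (?w \<epsilon>)) / \<epsilon>) * (norm (f2 (?z \<epsilon>) - cnj (f2 (?w \<epsilon>))))\<^sup>2)
     \<longlongrightarrow> Re (deriv f1 (of_real x)) * Re (deriv f1 (of_real y)) * (norm (f2 (of_real x) - cnj (f2 (of_real y))))\<^sup>2) (at_right 0)"
    if "boundary_chart D f1 x \<rho>1" "boundary_chart D f1 y \<rho>2" "boundary_chart D f2 x \<rho>3" "boundary_chart D f2 y \<rho>4"
    for f1 f2 \<rho>1 \<rho>2 \<rho>3 \<rho>4
    by (intro tendsto_intros boundary_chart_Im_limit[OF that(1)] boundary_chart_Im_limit[OF that(2)]
        boundary_chart_Im_limit[OF that(3)] boundary_chart_Im_limit[OF that(4)])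
  have pos: "\<forall>\<^sub>F \<epsilon> in at_right (0::real). \<epsilon> > 0" by (simp add: eventually_at_filter)
  have h': "h holomorphic_on D" "\<And>z. z \<in> D \<Longrightarrow> Im (h z) > 0"
    using h(1) unfolding boundary_chart_def conformal_map_def bij_betw_def by blast+
  have cf: "conformal_map f D upper_half_plane" using f by (simp add: boundary_chart_def)
  have "Re (deriv f (of_real x)) * Re (deriv f (of_real y)) * (norm (h (of_real x) - cnj (h (of_real y))))\<^sup>2
     \<le> Re (deriv h (of_real x)) * Re (deriv h (of_real y)) * (norm (f (of_real x) - cnj (f (of_real y))))\<^sup>2"
  proof (rule tendsto_le[OF _ lim[OF h f] lim[OF f h]])
    show "\<forall>\<^sub>F \<epsilon> in at_right 0. Im (f (?z \<epsilon>)) / \<epsilon> * (Im (f (?w \<epsilon>)) / \<epsilon>) * (norm (h (?z \<epsilon>) - cnj (h (?w \<epsilon>))))\<^sup>2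
       \<le> Im (h (?z \<epsilon>)) / \<epsilon> * (Im (h (?w \<epsilon>)) / \<epsilon>) * (norm (f (?z \<epsilon>) - cnj (f (?w \<epsilon>))))\<^sup>2"
      using pos boundary_chart_Im_limit(3)[OF f(1)] boundary_chart_Im_limit(3)[OF f(2)]
    proof eventually_elim
      case (elim \<epsilon>)
      have "Im (f (?z \<epsilon>)) * Im (f (?w \<epsilon>)) * (norm (h (?z \<epsilon>) - cnj (h (?w \<epsilon>))))\<^sup>2 / \<epsilon>\<^sup>2
         \<le> Im (h (?z \<epsilon>)) * Im (h (?w \<epsilon>)) * (norm (f (?z \<epsilon>) - cnj (f (?w \<epsilon>))))\<^sup>2 / \<epsilon>\<^sup>2"
        by (intro divide_right_mono conformal_schwarz_pick[OF openD cf h' elim(2,3)] zero_le_power2)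
      then show ?case by (simp add: power2_eq_square)
    qed
  qed simp
  then show ?thesis by (simp only: real[OF f] real[OF h])
qed

text \<open>
  The same limit with the inclusion of \<open>D\<close> in the half plane in place of \<open>h\<close>. This is the monotonicity of the
  kernel in the domain; without denominators it also implies that \<open>f\<close> separates boundary points.
\<close>

lemma boundary_chart_kernel_bound:
  assumes f: "boundary_chart D f x \<rho>" "boundary_chart D f y \<sigma>"
  shows "Re (deriv f (of_real x)) * Re (deriv f (of_real y)) * (x - y)\<^sup>2 \<le> (Re (f (of_real x)) - Re (f (of_real y)))\<^sup>2"
proof -
  let ?z = "\<lambda>\<epsilon>::real. of_real x + \<i> * of_real \<epsilon>" and ?w = "\<lambda>\<epsilon>::real. of_real y + \<i> * of_real \<epsilon>"
  have cf: "conformal_map f D upper_half_plane" using f by (simp add: boundary_chart_def)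
  have pos: "\<forall>\<^sub>F \<epsilon> in at_right (0::real). \<epsilon> > 0" by (simp add: eventually_at_filter)
  have zw: "((\<lambda>\<epsilon>. ?z \<epsilon> - cnj (?w \<epsilon>)) \<longlongrightarrow> of_real (x - y)) (at_right 0)"
    by (auto intro!: tendsto_eq_intros)
  have l1: "((\<lambda>\<epsilon>. Im (f (?z \<epsilon>)) / \<epsilon> * (Im (f (?w \<epsilon>)) / \<epsilon>) * (norm (?z \<epsilon> - cnj (?w \<epsilon>)))\<^sup>2)
     \<longlongrightarrow> Re (deriv f (of_real x)) * Re (deriv f (of_real y)) * (norm (complex_of_real (x - y)))\<^sup>2) (at_right 0)"
    by (intro tendsto_mult tendsto_power tendsto_norm zw boundary_chart_Im_limit[OF f(1)] boundary_chart_Im_limit[OF f(2)])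
  have l2: "((\<lambda>\<epsilon>. (norm (f (?z \<epsilon>) - cnj (f (?w \<epsilon>))))\<^sup>2)
     \<longlongrightarrow> (norm (f (of_real x) - cnj (f (of_real y))))\<^sup>2) (at_right 0)"
    by (intro tendsto_intros boundary_chart_Im_limit[OF f(1)] boundary_chart_Im_limit[OF f(2)])
  have "Re (deriv f (of_real x)) * Re (deriv f (of_real y)) * (norm (complex_of_real (x - y)))\<^sup>2 \<le> (norm (f (of_real x) - cnj (f (of_real y))))\<^sup>2"
  proof (rule tendsto_le[OF _ l2 l1])
    show "\<forall>\<^sub>F \<epsilon> in at_right 0. Im (f (?z \<epsilon>)) / \<epsilon> * (Im (f (?w \<epsilon>)) / \<epsilon>) * (norm (?z \<epsilon> - cnj (?w \<epsilon>)))\<^sup>2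
       \<le> (norm (f (?z \<epsilon>) - cnj (f (?w \<epsilon>))))\<^sup>2"
      using pos boundary_chart_Im_limit(3)[OF f(1)] boundary_chart_Im_limit(3)[OF f(2)]
    proof eventually_elim
      case (elim \<epsilon>)
      have id: "(\<lambda>z. z) holomorphic_on D" "\<And>z. z \<in> D \<Longrightarrow> Im z > 0" using DH by (auto intro: holomorphic_intros)
      have "Im (f (?z \<epsilon>)) * Im (f (?w \<epsilon>)) * (norm (?z \<epsilon> - cnj (?w \<epsilon>)))\<^sup>2 / \<epsilon>\<^sup>2
         \<le> Im (?z \<epsilon>) * Im (?w \<epsilon>) * (norm (f (?z \<epsilon>) - cnj (f (?w \<epsilon>))))\<^sup>2 / \<epsilon>\<^sup>2"
        by (intro divide_right_mono conformal_schwarz_pick[OF openD cf id elim(2,3)] zero_le_power2)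
      then show ?case using elim by (simp add: power2_eq_square)
    qed
  qed simp
  moreover have "(norm (f (of_real x) - cnj (f (of_real y))))\<^sup>2 = (Re (f (of_real x)) - Re (f (of_real y)))\<^sup>2"
    using boundary_chart_real[OF f(1), of x] boundary_chart_real[OF f(2), of y] f
    by (simp add: cmod_power2 complex_is_Real_iff boundary_chart_def)
  ultimately show ?thesis by (simp only: norm_of_real power2_abs)
qed

lemma boundary_chart_inj:
  assumes f: "boundary_chart D f x \<rho>" "boundary_chart D f y \<sigma>" and "x \<noteq> y"
  shows "Re (f (of_real x)) \<noteq> Re (f (of_real y))"
proof
  assume "Re (f (of_real x)) = Re (f (of_real y))"
  moreover have "Re (deriv f (of_real x)) * Re (deriv f (of_real y)) * (x - y)\<^sup>2 > 0"
    using boundary_chart_deriv_pos[OF f(1)] boundary_chart_deriv_pos[OF f(2)] \<open>x \<noteq> y\<close> by simp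
  ultimately show False using boundary_chart_kernel_bound[OF f] by simp
qed

lemma boundary_chart_imp_real_analytic:
  "boundary_chart D f x \<rho> \<Longrightarrow> real_analytic_boundary_point D x"
  by (auto simp: boundary_chart_def real_analytic_boundary_point_def)

text \<open>
  The map selected in the definition of the kernel is a chart at both points, hence it may be exchanged
  for \<open>f\<close>.
\<close>

lemma boundary_poisson_chart:
  assumes f: "boundary_chart D f x \<rho>" "boundary_chart D f y \<sigma>" and xy: "x \<noteq> y"
  shows "boundary_poisson D x y =
    Re (deriv f (of_real x)) * Re (deriv f (of_real y)) / (Re (f (of_real x)) - Re (f (of_real y)))\<^sup>2"
proof -
  define P where "P = (\<lambda>f. conformal_map f D upper_half_plane \<and> f analytic_on (D \<union> {complex_of_real x, complex_of_real y}))"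
  \<comment> \<open>\<open>P\<close> is the predicate in the definition of the kernel, so \<open>F\<close> is the map that occurs there.\<close>
  define F where "F = (SOME f. P f)"
  have "P f"
  proof -
    have "f analytic_on D" using f(1) openD
      by (simp add: boundary_chart_def conformal_map_def analytic_on_open)
    then show ?thesis
      using f unfolding P_def analytic_on_Un
      by (auto simp: boundary_chart_def analytic_on_def)
  qed
  then have PF: "P F" unfolding F_def by (rule someI[of P])
  have chart: "\<exists>r. boundary_chart D F t r" if t: "t \<in> {x, y}" for t
  proof -
    have "F analytic_on {of_real t}" using PF t by (auto simp: P_def analytic_on_def)
    then obtain e where e: "e > 0" "F holomorphic_on ball (of_real t) e" by (auto simp: analytic_at_ball)
    obtain R where R: "R > 0" "half_disc t R \<subseteq> D"
      using f t by (auto simp: boundary_chart_def)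
    have "boundary_chart D F t (min e R)"
      using e R PF by (auto simp: boundary_chart_def P_def intro: holomorphic_on_subset)
    then show ?thesis ..
  qed
  then obtain r s where F: "boundary_chart D F x r" "boundary_chart D F y s" by blast
  have re: "norm u = Re u" if "u \<in> \<real>" "Re u > 0" for u :: complex
    using that by (auto simp: complex_is_Real_iff norm_complex_def)
  have d: "deriv F (of_real t) \<in> \<real>" if "boundary_chart D F t r" for t r
    using boundary_chart_deriv_real[OF that, of 1] by simp
  have "F (of_real x) - F (of_real y) = of_real (Re (F (of_real x)) - Re (F (of_real y)))"
    using boundary_chart_real[OF F(1), of x] boundary_chart_real[OF F(2), of y] F
    by (simp add: complex_eq_iff complex_is_Real_iff boundary_chart_def)
  then have "norm (F (of_real y) - F (of_real x)) = \<bar>Re (F (of_real x)) - Re (F (of_real y))\<bar>"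
    by (metis norm_minus_commute norm_of_real)
  then have 1: "boundary_poisson D x y = Re (deriv F (of_real x)) * Re (deriv F (of_real y)) / (Re (F (of_real x)) - Re (F (of_real y)))\<^sup>2"
    using boundary_chart_imp_real_analytic[OF f(1)] boundary_chart_imp_real_analytic[OF f(2)]
    unfolding boundary_poisson_def P_def[symmetric] F_def[symmetric] Let_def
    by (simp add: re[OF d[OF F(1)] boundary_chart_deriv_pos[OF F(1)]] re[OF d[OF F(2)] boundary_chart_deriv_pos[OF F(2)]])
  have n1: "Re (F (of_real x)) - Re (F (of_real y)) \<noteq> 0" using boundary_chart_inj[OF F xy] by simp
  have n2: "Re (f (of_real x)) - Re (f (of_real y)) \<noteq> 0" using boundary_chart_inj[OF f xy] by simp
  show ?thesis
    unfolding 1 using antisym[OF boundary_chart_kernel_limit[OF F f] boundary_chart_kernel_limit[OF f F]] n1 n2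
    by (simp add: frac_eq_eq)
qed

end

text \<open>
  The unimodular point \<open>c\<close> goes to infinity and the rest of the unit circle to the real line.
\<close>

definition disc_to_half_plane :: "complex \<Rightarrow> complex \<Rightarrow> complex" where
  "disc_to_half_plane c u = \<i> * (c + u) / (c - u)"

lemma Im_disc_to_half_plane:
  assumes "norm c = 1" "u \<noteq> c"
  shows "Im (disc_to_half_plane c u) = (1 - (norm u)\<^sup>2) / (norm (c - u))\<^sup>2"
proof -
  have "disc_to_half_plane c u = (\<i> * (c + u) * cnj (c - u)) / of_real ((norm (c - u))\<^sup>2)"
    unfolding disc_to_half_plane_def by (subst complex_div_cnj) simp
  then have "Im (disc_to_half_plane c u) = Im (\<i> * (c + u) * cnj (c - u)) / (norm (c - u))\<^sup>2"
    by (simp only: Im_divide_of_real)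
  also have "Im (\<i> * (c + u) * cnj (c - u)) = (norm c)\<^sup>2 - (norm u)\<^sup>2"
    unfolding cmod_power2 by (simp add: power2_eq_square algebra_simps)
  finally show ?thesis using assms by simp
qed

lemma disc_to_half_plane_inverse:
  assumes c: "norm c = 1"
  shows "norm u < 1 \<Longrightarrow> c * ((disc_to_half_plane c u - \<i>) / (disc_to_half_plane c u + \<i>)) = u"
    and "Im v > 0 \<Longrightarrow> disc_to_half_plane c (c * ((v - \<i>) / (v + \<i>))) = v"
    and "Im v > 0 \<Longrightarrow> norm (c * ((v - \<i>) / (v + \<i>))) < 1"
proof -
  have c0: "c \<noteq> 0" using c by auto
  show "c * ((disc_to_half_plane c u - \<i>) / (disc_to_half_plane c u + \<i>)) = u" if "norm u < 1"
  proof -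
    have ne: "c - u \<noteq> 0" using that c by auto
    have "disc_to_half_plane c u - \<i> = 2 * \<i> * u / (c - u)" "disc_to_half_plane c u + \<i> = 2 * \<i> * c / (c - u)"
      using ne by (auto simp: disc_to_half_plane_def divide_simps) (auto simp: algebra_simps)
    then show ?thesis using ne c0 by simp
  qed
  show "disc_to_half_plane c (c * ((v - \<i>) / (v + \<i>))) = v" if "Im v > 0"
  proof -
    have ne: "v + \<i> \<noteq> 0" using that by (auto simp: complex_eq_iff)
    have 1: "c + c * ((v - \<i>) / (v + \<i>)) = 2 * c * v / (v + \<i>)" "c - c * ((v - \<i>) / (v + \<i>)) = 2 * c * \<i> / (v + \<i>)"
      using ne by (auto simp: divide_simps) (auto simp: algebra_simps)
    show ?thesis unfolding disc_to_half_plane_def 1 using ne c0 by simp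
  qed
  show "norm (c * ((v - \<i>) / (v + \<i>))) < 1" if "Im v > 0"
    using cayley_norm_less_1[OF that, of \<i>] c by (simp only: norm_mult) simp
qed

text \<open>
  The extended Riemann map followed by this Moebius map is real on the real points that are not sent to
  \<open>c\<close>, so Schwarz reflection continues it. A single \<open>f\<close> serves all intervals on which the value \<open>c\<close> is
  omitted.
\<close>

lemma half_plane_map_of_extension:
  assumes D: "open D" "D \<subseteq> upper_half_plane"
    and g: "\<And>w. w \<in> ball 0 1 \<Longrightarrow> g w \<in> D \<and> \<phi> (g w) = w"
    and gf: "\<And>z. z \<in> D \<Longrightarrow> \<phi> z \<in> ball (0::complex) 1 \<and> g (\<phi> z) = z"
    and holo: "\<phi> holomorphic_on D"
    and \<Phi>: "continuous_on (D \<union> of_real ` {x. real_analytic_boundary_point D x}) \<Phi>"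
      "\<And>z. z \<in> D \<Longrightarrow> \<Phi> z = \<phi> z" "\<And>x. real_analytic_boundary_point D x \<Longrightarrow> norm (\<Phi> (of_real x)) = 1"
    and c: "norm c = 1"
  obtains f where
    "\<And>x \<rho>. 0 < \<rho> \<Longrightarrow> half_disc x \<rho> \<subseteq> D \<Longrightarrow> (\<And>t. \<bar>t - x\<bar> < \<rho> \<Longrightarrow> \<Phi> (of_real t) \<noteq> c) \<Longrightarrow> boundary_chart D f x \<rho>"
    "\<And>x. f (of_real x) = disc_to_half_plane c (\<Phi> (of_real x))"
proof -
  define T where "T = (\<lambda>z. disc_to_half_plane c (\<Phi> z))"
  define f where "f = (\<lambda>z. if 0 \<le> Im z then T z else cnj (T (cnj z)))"
  have fD: "f z = disc_to_half_plane c (\<phi> z)" if "z \<in> D" for z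
    using that D \<Phi>(2) by (auto simp: f_def T_def less_imp_le)
  have ne: "\<phi> z \<noteq> c" if "z \<in> D" for z using gf[OF that] c by auto
  have n1: "norm (\<phi> z) < 1" if "z \<in> D" for z using gf[OF that] by simp
  have hD: "f holomorphic_on D"
  proof (rule holomorphic_transform)
    show "(\<lambda>z. disc_to_half_plane c (\<phi> z)) holomorphic_on D"
      unfolding disc_to_half_plane_def using ne by (intro holomorphic_intros holo) force
  qed (simp add: fD)
  have conf: "conformal_map f D upper_half_plane"
    unfolding conformal_map_def
  proof (intro conjI hD)
    show "bij_betw f D upper_half_plane"
    proof (rule bij_betw_byWitness[where f' = "\<lambda>v. g (c * ((v - \<i>) / (v + \<i>)))"])
      show "\<forall>z\<in>D. g (c * ((f z - \<i>) / (f z + \<i>))) = z"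
      proof
        fix z assume z: "z \<in> D"
        show "g (c * ((f z - \<i>) / (f z + \<i>))) = z"
          unfolding fD[OF z] disc_to_half_plane_inverse(1)[OF c n1[OF z]] using gf[OF z] by simp
      qed
      show "\<forall>v\<in>upper_half_plane. f (g (c * ((v - \<i>) / (v + \<i>)))) = v"
      proof
        fix v assume "v \<in> upper_half_plane"
        then have v: "Im v > 0" by simp
        have "c * ((v - \<i>) / (v + \<i>)) \<in> ball 0 1" using disc_to_half_plane_inverse(3)[OF c v] by (simp only: mem_ball_0)
        from g[OF this] show "f (g (c * ((v - \<i>) / (v + \<i>)))) = v"
          using disc_to_half_plane_inverse(2)[OF c v] fD by metis
      qed
      show "f ` D \<subseteq> upper_half_plane"
      proof (rule image_subsetI)
        fix z assume z: "z \<in> D"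
        have "(norm (\<phi> z))\<^sup>2 < 1" using n1[OF z] by (simp add: power_less_one_iff)
        moreover have "norm (c - \<phi> z) > 0" using ne[OF z] by auto
        ultimately show "f z \<in> upper_half_plane"
          by (simp add: fD[OF z] Im_disc_to_half_plane[OF c ne[OF z]])
      qed
      show "(\<lambda>v. g (c * ((v - \<i>) / (v + \<i>)))) ` upper_half_plane \<subseteq> D"
      proof (rule image_subsetI)
        fix v assume "v \<in> upper_half_plane"
        then have v: "Im v > 0" by simp
        have "c * ((v - \<i>) / (v + \<i>)) \<in> ball 0 1" using disc_to_half_plane_inverse(3)[OF c v] by (simp only: mem_ball_0)
        from g[OF this] show "g (c * ((v - \<i>) / (v + \<i>))) \<in> D" by blast
      qed
    qed
  qed
  show ?thesis
  proof (rule that)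
    show "f (of_real x) = disc_to_half_plane c (\<Phi> (of_real x))" for x by (simp add: f_def T_def)
    fix x \<rho> :: real
    assume \<rho>: "0 < \<rho>" and sub: "half_disc x \<rho> \<subseteq> D" and nc: "\<And>t. \<bar>t - x\<bar> < \<rho> \<Longrightarrow> \<Phi> (of_real t) \<noteq> c"
    let ?B = "ball (complex_of_real x) \<rho>"
    have real_in: "\<exists>t. z = of_real t \<and> \<bar>t - x\<bar> < \<rho>" if "z \<in> ?B" "Im z = 0" for z
    proof (intro exI[of _ "Re z"] conjI)
      show z: "z = of_real (Re z)" using that by (simp add: complex_eq_iff)
      have "dist (complex_of_real x) (of_real (Re z)) < \<rho>" using that z by (metis mem_ball)
      then show "\<bar>Re z - x\<bar> < \<rho>" by (simp add: dist_norm abs_minus_commute flip: of_real_diff)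
    qed
    have cases: "z \<in> D \<or> (\<exists>t. z = of_real t \<and> \<bar>t - x\<bar> < \<rho>)" if "z \<in> ?B" "0 \<le> Im z" for z
      using real_in[OF that(1)] that sub by (cases "Im z = 0") auto
    have "f holomorphic_on ?B"
      unfolding f_def
    proof (rule Schwarz_reflection)
      show "cnj ` ?B \<subseteq> ?B"
      proof (rule image_subsetI)
        fix z assume "z \<in> ?B"
        then show "cnj z \<in> ?B" using complex_mod_cnj[of "of_real x - z"] by (simp add: dist_norm)
      qed
      have sub': "?B \<inter> {z. 0 < Im z} \<subseteq> D" using sub by auto
      show "T holomorphic_on ?B \<inter> {z. 0 < Im z}"
        by (rule holomorphic_transform[OF holomorphic_on_subset[OF hD sub']]) (simp add: f_def)
      show "continuous_on (?B \<inter> {z. 0 \<le> Im z}) T"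
        unfolding T_def disc_to_half_plane_def
      proof (intro continuous_intros)
        show "continuous_on (?B \<inter> {z. 0 \<le> Im z}) \<Phi>"
        proof (rule continuous_on_subset[OF \<Phi>(1)])
          show "?B \<inter> {z. 0 \<le> Im z} \<subseteq> D \<union> of_real ` {x. real_analytic_boundary_point D x}"
            using cases real_analytic_boundary_point_nhd(1)[OF sub] by blast
        qed
        then show "continuous_on (?B \<inter> {z. 0 \<le> Im z}) \<Phi>" .
        show "\<forall>z\<in>?B \<inter> {z. 0 \<le> Im z}. c - \<Phi> z \<noteq> 0"
          using cases nc ne \<Phi>(2) by force
      qed
      show "T z \<in> \<real>" if z: "z \<in> ?B" "z \<in> \<real>" for z
      proof -
        obtain t where t: "z = of_real t" "\<bar>t - x\<bar> < \<rho>" using real_in[OF z(1)] z(2) by (auto simp: complex_is_Real_iff)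
        have "norm (\<Phi> z) = 1" unfolding t(1) by (rule \<Phi>(3)[OF real_analytic_boundary_point_nhd(1)[OF sub t(2)]])
        then show ?thesis
          using Im_disc_to_half_plane[OF c nc[OF t(2)]] by (simp add: T_def t(1) complex_is_Real_iff)
      qed
    qed simp
    then show "boundary_chart D f x \<rho>"
      using \<rho> sub conf by (simp add: boundary_chart_def)
  qed
qed

text \<open>
  The extension \<open>\<Phi>\<close> is fixed together with \<open>D\<close>, while the point \<open>c\<close> that goes to infinity may still be chosen
  according to the boundary points under consideration.
\<close>

lemma disc_to_half_plane_extension_exists:
  assumes D: "simply_connected_domain D" "D \<subseteq> upper_half_plane"
  obtains \<Phi> where "continuous_on (D \<union> of_real ` {x. real_analytic_boundary_point D x}) \<Phi>"
    "\<And>x. real_analytic_boundary_point D x \<Longrightarrow> norm (\<Phi> (of_real x)) = 1"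
    "\<And>c. norm c = 1 \<Longrightarrow> \<exists>f. (\<forall>x \<rho>. 0 < \<rho> \<longrightarrow> half_disc x \<rho> \<subseteq> D \<longrightarrow> (\<forall>t. \<bar>t - x\<bar> < \<rho> \<longrightarrow> \<Phi> (of_real t) \<noteq> c) \<longrightarrow> boundary_chart D f x \<rho>)
      \<and> (\<forall>x. f (of_real x) = disc_to_half_plane c (\<Phi> (of_real x)))"
proof -
  have oD: "open D" and sc: "simply_connected D" and ne: "D \<noteq> {}"
    using D(1) by (auto simp: simply_connected_domain_def)
  have "D \<noteq> UNIV" using D(2) by (metis UNIV_I of_real_notin_half_plane_domain)
  then obtain \<phi> g where h: "\<phi> holomorphic_on D" "g holomorphic_on ball 0 1"
    and gf: "\<And>z. z \<in> D \<Longrightarrow> \<phi> z \<in> ball 0 1 \<and> g (\<phi> z) = z"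
    and g: "\<And>w. w \<in> ball 0 1 \<Longrightarrow> g w \<in> D \<and> \<phi> (g w) = w"
    using Riemann_mapping_theorem[of D] oD sc ne by blast
  obtain \<Phi> where \<Phi>: "continuous_on (D \<union> of_real ` {x. real_analytic_boundary_point D x}) \<Phi>"
    "\<And>z. z \<in> D \<Longrightarrow> \<Phi> z = \<phi> z" "\<And>x. real_analytic_boundary_point D x \<Longrightarrow> norm (\<Phi> (of_real x)) = 1"
    using riemann_map_continuous_extension[OF D(2) oD holomorphic_on_imp_continuous_on[OF h(2)] conjunct1[OF g] gf h(1)] by auto
  show ?thesis
  proof (rule that[OF \<Phi>(1,3)])
    fix c :: complex assume c: "norm c = 1"
    obtain f where
      f: "\<And>x \<rho>. 0 < \<rho> \<Longrightarrow> half_disc x \<rho> \<subseteq> D \<Longrightarrow> (\<And>t. \<bar>t - x\<bar> < \<rho> \<Longrightarrow> \<Phi> (of_real t) \<noteq> c) \<Longrightarrow> boundary_chart D f x \<rho>"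
         "\<And>x. f (of_real x) = disc_to_half_plane c (\<Phi> (of_real x))"
      using half_plane_map_of_extension[OF oD D(2) g gf h(1) \<Phi> c] by auto
    then show "\<exists>f. (\<forall>x \<rho>. 0 < \<rho> \<longrightarrow> half_disc x \<rho> \<subseteq> D \<longrightarrow> (\<forall>t. \<bar>t - x\<bar> < \<rho> \<longrightarrow> \<Phi> (of_real t) \<noteq> c) \<longrightarrow> boundary_chart D f x \<rho>)
      \<and> (\<forall>x. f (of_real x) = disc_to_half_plane c (\<Phi> (of_real x)))" by blast
  qed
qed


text \<open>
  The extension \<open>\<Phi>\<close> is injective on the real points: if \<open>\<Phi> s = \<Phi> t\<close>, the map with pole at the antipode of
  \<open>\<Phi> s\<close> is a chart at \<open>s\<close> and at \<open>t\<close> with equal values, contrary to boundary_chart_inj. Hence \<open>\<Phi> y\<close> is not on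
  the compact arc covered by the interval of radius \<open>r\<close> around \<open>x\<close>, and a pole \<open>c\<close> can be placed on the unit
  circle off this arc, close to \<open>\<Phi> y\<close> but different from it.
\<close>

lemma boundary_charts_exist:
  assumes D: "simply_connected_domain D" "D \<subseteq> upper_half_plane"
    and x: "half_disc x R \<subseteq> D" "0 < r" "r < R"
    and y: "real_analytic_boundary_point D y" "R \<le> \<bar>x - y\<bar>"
  obtains f e where "boundary_chart D f x r" "boundary_chart D f y e"
proof -
  have oD: "open D" using D(1) by (simp add: simply_connected_domain_def)
  define U where "U = {x. real_analytic_boundary_point D x}"
  obtain \<Phi> where cont: "continuous_on (D \<union> of_real ` U) \<Phi>"
    and n\<Phi>: "\<And>x. real_analytic_boundary_point D x \<Longrightarrow> norm (\<Phi> (of_real x)) = 1"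
    and ex: "\<And>c. norm c = 1 \<Longrightarrow> \<exists>f. (\<forall>x \<rho>. 0 < \<rho> \<longrightarrow> half_disc x \<rho> \<subseteq> D \<longrightarrow> (\<forall>t. \<bar>t - x\<bar> < \<rho> \<longrightarrow> \<Phi> (of_real t) \<noteq> c) \<longrightarrow> boundary_chart D f x \<rho>)
      \<and> (\<forall>x. f (of_real x) = disc_to_half_plane c (\<Phi> (of_real x)))"
    using disc_to_half_plane_extension_exists[OF D] unfolding U_def by metis
  define p where "p = (\<lambda>t. \<Phi> (complex_of_real t))"
  have contp: "continuous_on U p"
    unfolding p_def by (rule continuous_on_compose2[OF cont]) (auto intro!: continuous_intros)
  have near: "\<exists>\<rho>>0. half_disc s \<rho> \<subseteq> D \<and> (\<forall>t. \<bar>t - s\<bar> < \<rho> \<longrightarrow> p t \<noteq> c)"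
    if s: "real_analytic_boundary_point D s" and c: "p s \<noteq> c" for s c
  proof -
    obtain R' where R': "R' > 0" "half_disc s R' \<subseteq> D" using s unfolding real_analytic_boundary_point_def by blast
    have sU: "s \<in> U" using s by (simp add: U_def)
    obtain d where d: "d > 0" "\<And>t. t \<in> U \<Longrightarrow> dist t s < d \<Longrightarrow> dist (p t) (p s) < dist c (p s)"
      using contp sU c unfolding continuous_on_iff by (metis zero_less_dist_iff)
    show ?thesis
    proof (intro exI[of _ "min d R'"] conjI allI impI)
      show "half_disc s (min d R') \<subseteq> D" using R' by auto
      fix t assume t: "\<bar>t - s\<bar> < min d R'"
      then have "t \<in> U" using real_analytic_boundary_point_nhd(1)[OF R'(2), of t] by (simp add: U_def)
      with d(2)[of t] t show "p t \<noteq> c" by (auto simp: dist_norm)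
    qed (use d R' in auto)
  qed
  have inj: "p s \<noteq> p t" if st: "real_analytic_boundary_point D s" "real_analytic_boundary_point D t" "s \<noteq> t" for s t
  proof
    assume eq: "p s = p t"
    have "norm (- p s) = 1" using n\<Phi>[OF st(1)] by (simp add: p_def)
    then obtain f where f: "\<And>x \<rho>. 0 < \<rho> \<Longrightarrow> half_disc x \<rho> \<subseteq> D \<Longrightarrow> (\<And>u. \<bar>u - x\<bar> < \<rho> \<Longrightarrow> p u \<noteq> - p s) \<Longrightarrow> boundary_chart D f x \<rho>"
       "\<And>x. f (of_real x) = disc_to_half_plane (- p s) (p x)"
      using ex[of "- p s"] unfolding p_def by blast
    have "p s \<noteq> 0" using n\<Phi>[OF st(1)] by (auto simp: p_def)
    then have ne: "p s \<noteq> - p s" by (simp add: complex_eq_iff)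
    obtain \<rho> \<sigma> where "boundary_chart D f s \<rho>" "boundary_chart D f t \<sigma>"
      using near[OF st(1), of "- p s"] near[OF st(2), of "- p s"] ne eq f(1) by metis
    from boundary_chart_inj[OF oD D(2) this st(3)] show False by (simp add: f(2) eq)
  qed
  define K where "K = p ` {x - r..x + r}"
  have xr: "{x - r..x + r} \<subseteq> U"
    unfolding U_def using real_analytic_boundary_point_nhd(1)[OF x(1)] x(3) by (auto simp: abs_less_iff)
  have "compact K" unfolding K_def by (intro compact_continuous_image continuous_on_subset[OF contp xr]) simp
  moreover have "p y \<notin> K"
  proof
    assume "p y \<in> K"
    then obtain t where t: "t \<in> {x - r..x + r}" "p y = p t" by (auto simp: K_def)
    then have "t \<noteq> y" using x y by auto
    with inj[OF y(1), of t] t xr show False by (auto simp: U_def)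
  qed
  ultimately have "open (- K)" "p y \<in> - K" by (auto intro: compact_imp_closed)
  \<comment> \<open>The pole is \<open>\<Phi> y\<close> rotated by a small positive angle.\<close>
  then have "\<forall>\<^sub>F \<theta> in at_right 0. p y * cis \<theta> \<in> - K"
    by (intro topological_tendstoD[where l = "p y"]) (auto intro!: tendsto_eq_intros)
  moreover have "\<forall>\<^sub>F \<theta> in at_right (0::real). \<theta> \<in> {0<..<1}" by (rule eventually_at_right_real) simp
  ultimately have "\<forall>\<^sub>F \<theta> in at_right (0::real). p y * cis \<theta> \<in> - K \<and> \<theta> \<in> {0<..<1}" by (rule eventually_conj)
  then obtain \<theta> where \<theta>: "p y * cis \<theta> \<in> - K" "0 < \<theta>" "\<theta> < 1"
    using eventually_happens[of _ "at_right (0::real)"] by (auto simp: trivial_limit_at_right_real)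
  define c where "c = p y * cis \<theta>"
  have npy: "norm (p y) = 1" using n\<Phi>[OF y(1)] by (simp add: p_def)
  then have nc: "norm c = 1" by (simp add: c_def norm_mult)
  have "sin \<theta> > 0" using \<theta> pi_gt3 by (intro sin_gt_zero) auto
  then have "cis \<theta> \<noteq> 1" by (auto simp: complex_eq_iff)
  then have cy: "p y \<noteq> c" using npy by (auto simp: c_def)
  obtain f where f: "\<And>x \<rho>. 0 < \<rho> \<Longrightarrow> half_disc x \<rho> \<subseteq> D \<Longrightarrow> (\<And>u. \<bar>u - x\<bar> < \<rho> \<Longrightarrow> p u \<noteq> c) \<Longrightarrow> boundary_chart D f x \<rho>"
    using ex[OF nc] unfolding p_def by blast
  have cx: "boundary_chart D f x r"
  proof (rule f)
    show "half_disc x r \<subseteq> D" using x by auto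
    show "p u \<noteq> c" if "\<bar>u - x\<bar> < r" for u
    proof
      assume "p u = c"
      moreover have "u \<in> {x - r..x + r}" using that by (auto simp: abs_less_iff)
      ultimately have "c \<in> K" unfolding K_def by blast
      with \<theta>(1) show False by (simp add: c_def)
    qed
  qed fact
  obtain e where "e > 0" "half_disc y e \<subseteq> D" "\<And>u. \<bar>u - y\<bar> < e \<Longrightarrow> p u \<noteq> c"
    using near[OF y(1) cy] by blast
  from f[OF this] cx that show ?thesis by blast
qed

section \<open>Derivatives of the boundary Poisson kernel\<close>

lemma boundary_poisson_commute: "boundary_poisson D x y = boundary_poisson D y x"
  unfolding boundary_poisson_def
  by (simp add: insert_commute norm_minus_commute mult.commute conj_commute Let_def)

lemma has_real_derivative_Re_of_real:
  assumes "(f has_field_derivative f') (at (complex_of_real t))"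
  shows "((\<lambda>t. Re (f (of_real t))) has_real_derivative Re f') (at t)"
  using bounded_linear.has_vector_derivative[OF bounded_linear_Re has_vector_derivative_real_field[OF assms]]
  by (simp add: has_real_derivative_iff_has_vector_derivative)

lemma DERIV_eventually_eq:
  assumes "(f has_real_derivative d) (at x)" "\<forall>\<^sub>F u in nhds x. g u = f u"
  shows "(g has_real_derivative d) (at x)"
  using assms(1) DERIV_cong_ev[OF refl assms(2) refl] by simp

lemma of_real_in_ball: "\<bar>t - x\<bar> < r \<Longrightarrow> of_real t \<in> ball (complex_of_real x) r"
  by (simp add: dist_norm abs_minus_commute flip: of_real_diff)

lemma eventually_nhds_abs_less:
  assumes "\<bar>t - x\<bar> < (r :: real)"
  shows "\<forall>\<^sub>F u in nhds t. \<bar>u - x\<bar> < r"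
proof -
  have "t \<in> {x - r<..<x + r}" using assms by (simp only: greaterThanLessThan_iff abs_less_iff) linarith
  then have "\<forall>\<^sub>F u in nhds t. u \<in> {x - r<..<x + r}" by (intro eventually_nhds_in_open) simp
  then show ?thesis by eventually_elim (simp add: abs_less_iff)
qed

locale half_plane_domain =
  fixes D :: "complex set"
  assumes scd: "simply_connected_domain D" and DH: "D \<subseteq> upper_half_plane"
begin

abbreviation H :: "real \<Rightarrow> real \<Rightarrow> real" where "H \<equiv> boundary_poisson D"

lemma openD: "open D"
  using scd by (simp add: simply_connected_domain_def)

lemma chart_Re_deriv:
  assumes ch: "boundary_chart D f x \<rho>" and t: "\<bar>t - x\<bar> < \<rho>"
  shows "((\<lambda>t. Re ((deriv ^^ n) f (of_real t))) has_real_derivative Re ((deriv ^^ Suc n) f (of_real t))) (at t)"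
proof (rule has_real_derivative_Re_of_real)
  have "f holomorphic_on ball (of_real x) \<rho>" using ch by (simp add: boundary_chart_def)
  then have "(deriv ^^ n) f holomorphic_on ball (of_real x) \<rho>" by (rule holomorphic_higher_deriv) simp
  then show "((deriv ^^ n) f has_field_derivative (deriv ^^ Suc n) f (of_real t)) (at (of_real t))"
    using holomorphic_derivI[OF _ open_ball of_real_in_ball[OF t]] by simp
qed

lemma H_eq_chart:
  assumes "boundary_chart D f x r" "boundary_chart D f y e" "\<bar>s - x\<bar> < r" "\<bar>t - y\<bar> < e" "s \<noteq> t"
  shows "H s t = Re (deriv f (of_real s)) * Re (deriv f (of_real t)) / (Re (f (of_real s)) - Re (f (of_real t)))\<^sup>2"
  using boundary_chart_shift[OF assms(1), of "r - \<bar>s - x\<bar>" s] boundary_chart_shift[OF assms(2), of "e - \<bar>t - y\<bar>" t] assms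
  by (intro boundary_poisson_chart[OF openD DH]) auto

lemma H_pos:
  assumes "real_analytic_boundary_point D x" "real_analytic_boundary_point D y" "x \<noteq> y"
  shows "0 < H x y" "H x y \<le> 1 / (x - y)\<^sup>2"
proof -
  obtain R0 where R0: "R0 > 0" "half_disc x R0 \<subseteq> D" using assms(1) unfolding real_analytic_boundary_point_def by blast
  define R where "R = min R0 \<bar>x - y\<bar>"
  have R: "R > 0" "half_disc x R \<subseteq> D" "R \<le> \<bar>x - y\<bar>" using R0 assms(3) by (auto simp: R_def)
  obtain f e where f: "boundary_chart D f x (R / 2)" "boundary_chart D f y e"
    using boundary_charts_exist[OF scd DH R(2), of "R / 2" y] R assms(2) by auto
  have eq: "H x y = Re (deriv f (of_real x)) * Re (deriv f (of_real y)) / (Re (f (of_real x)) - Re (f (of_real y)))\<^sup>2"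
    by (rule boundary_poisson_chart[OF openD DH f assms(3)])
  have ne: "(Re (f (of_real x)) - Re (f (of_real y)))\<^sup>2 > 0"
    using boundary_chart_inj[OF openD DH f assms(3)] by simp
  show "0 < H x y" unfolding eq
    using ne boundary_chart_deriv_pos[OF openD DH f(1)] boundary_chart_deriv_pos[OF openD DH f(2)] by simp
  show "H x y \<le> 1 / (x - y)\<^sup>2" unfolding eq
    using boundary_chart_kernel_bound[OF openD DH f] ne assms(3) by (simp add: divide_simps)
qed

lemma H_eq_0:
  assumes "\<not> (real_analytic_boundary_point D x \<and> real_analytic_boundary_point D y)"
  shows "H x y = 0"
  using assms by (auto simp: boundary_poisson_def)

lemma H_nonneg: "0 \<le> H x y"
  unfolding boundary_poisson_def by (simp add: Let_def)

lemma H_le: "x \<noteq> y \<Longrightarrow> H x y \<le> 1 / (x - y)\<^sup>2"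
  using H_pos(2)[of x y] H_eq_0[of x y] by fastforce

text \<open>
  With \<open>y\<close> moved to infinity the kernel becomes the derivative of a single function, up to a positive
  constant, and this function is typically real.
\<close>

lemma pole_map:
  assumes fx: "boundary_chart D f x r" and fy: "boundary_chart D f y e" and xy: "r \<le> \<bar>x - y\<bar>"
    and F_def: "F = (\<lambda>z. - 1 / (f z - f (of_real y)))"
  shows "F holomorphic_on ball (of_real x) r"
    and "\<And>t. \<bar>t - x\<bar> < r \<Longrightarrow> F (of_real t) \<in> \<real>"
    and "\<And>z. z \<in> ball (of_real x) r \<Longrightarrow> Im z > 0 \<Longrightarrow> Im (F z) > 0"
    and "\<And>t. \<bar>t - x\<bar> < r \<Longrightarrow> H t y = Re (deriv f (of_real y)) * Re (deriv F (of_real t))"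
proof -
  have hol: "f holomorphic_on ball (of_real x) r" using fx by (simp add: boundary_chart_def)
  have yr: "f (of_real y) \<in> \<real>" using boundary_chart_real[OF openD DH fy, of y] fy by (simp add: boundary_chart_def)
  have ch: "boundary_chart D f t (r - \<bar>t - x\<bar>)" if "\<bar>t - x\<bar> < r" for t
    using boundary_chart_shift[OF fx, of "r - \<bar>t - x\<bar>" t] that by simp
  have ty: "t \<noteq> y" if "\<bar>t - x\<bar> < r" for t using that xy by auto
  have real: "f (of_real t) \<in> \<real>" if "\<bar>t - x\<bar> < r" for t by (rule boundary_chart_real[OF openD DH fx that])
  have ne: "f z - f (of_real y) \<noteq> 0" if z: "z \<in> ball (of_real x) r" for z
  proof (cases "Im z" "0::real" rule: linorder_cases)
    case greater
    then have "Im (f z) > 0" by (rule boundary_chart_Im_pos[OF openD DH fx z])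
    then show ?thesis using yr by (auto simp: complex_is_Real_iff)
  next
    case equal
    then have z': "z = of_real (Re z)" by (simp add: complex_eq_iff)
    have "dist (complex_of_real x) (of_real (Re z)) < r" using z z' by (metis mem_ball)
    then have "\<bar>Re z - x\<bar> < r" by (simp add: dist_norm abs_minus_commute flip: of_real_diff)
    with boundary_chart_inj[OF openD DH ch fy ty] show ?thesis using z' by (metis right_minus_eq)
  next
    case less
    have cz: "cnj z \<in> ball (of_real x) r"
      using z complex_mod_cnj[of "of_real x - z"] by (simp add: dist_norm)
    have "Im (f (cnj z)) > 0" by (rule boundary_chart_Im_pos[OF openD DH fx cz]) (use less in simp)
    then have "Im (f z) < 0" using cnj_symmetric_of_real_on_reals[OF hol real z] by simp
    then show ?thesis using yr by (auto simp: complex_is_Real_iff)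
  qed
  show "F holomorphic_on ball (of_real x) r"
    unfolding F_def using ne by (intro holomorphic_intros hol) auto
  show "F (of_real t) \<in> \<real>" if "\<bar>t - x\<bar> < r" for t
    unfolding F_def using real[OF that] yr by simp
  show "Im (F z) > 0" if z: "z \<in> ball (of_real x) r" "Im z > 0" for z
  proof -
    have p: "Im (f z) > 0" by (rule boundary_chart_Im_pos[OF openD DH fx z])
    have "Im (F z) = Im (f z) / (norm (f z - f (of_real y)))\<^sup>2"
      using yr unfolding F_def cmod_power2 by (simp add: Im_divide complex_is_Real_iff)
    then show ?thesis using p ne[OF z(1)] by simp
  qed
  show "H t y = Re (deriv f (of_real y)) * Re (deriv F (of_real t))" if t: "\<bar>t - x\<bar> < r" for t
  proof -
    note tb = of_real_in_ball[OF t]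
    have D: "(f has_field_derivative deriv f (of_real t)) (at (of_real t))"
      by (rule holomorphic_derivI[OF hol open_ball tb])
    have "(F has_field_derivative deriv f (of_real t) / (f (of_real t) - f (of_real y))\<^sup>2) (at (of_real t))"
      unfolding F_def using ne[OF tb] by (auto intro!: derivative_eq_intros D simp: power2_eq_square)
    then have dF: "deriv F (of_real t) = deriv f (of_real t) / (f (of_real t) - f (of_real y))\<^sup>2"
      by (rule DERIV_imp_deriv)
    have "(f (of_real t) - f (of_real y))\<^sup>2 = of_real ((Re (f (of_real t)) - Re (f (of_real y)))\<^sup>2)"
      using real[OF t] yr by (simp add: complex_is_Real_iff complex_eq_iff power2_eq_square)
    then have "Re (deriv F (of_real t)) = Re (deriv f (of_real t)) / (Re (f (of_real t)) - Re (f (of_real y)))\<^sup>2"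
      unfolding dF by (simp only: Re_divide_of_real)
    then show ?thesis
      using boundary_poisson_chart[OF openD DH ch[OF t] fy ty[OF t]] by simp
  qed
qed

text \<open>
  The derivatives of the kernel are higher derivatives of the typically real function of pole_map. The
  constants are \<open>2 * 2! / (R/2) = 8/R\<close> and \<open>3 * 3! / (R/2)\<^sup>2 = 72/R\<^sup>2\<close>.
\<close>

lemma H_derivs:
  assumes x: "half_disc x R \<subseteq> D" "0 < R" and y: "real_analytic_boundary_point D y" "R \<le> \<bar>x - y\<bar>"
  obtains h1 h2 where "\<And>t. \<bar>t - x\<bar> < R / 2 \<Longrightarrow> ((\<lambda>t. H t y) has_real_derivative h1 t) (at t)"
    "(h1 has_real_derivative h2) (at x)" "\<bar>h1 x\<bar> \<le> 8 / R * H x y" "\<bar>h2\<bar> \<le> 72 / R\<^sup>2 * H x y"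
proof -
  obtain f e where f: "boundary_chart D f x (R / 2)" "boundary_chart D f y e"
    using boundary_charts_exist[OF scd DH x(1), of "R / 2" y] x(2) y by auto
  define k where "k = Re (deriv f (of_real y))"
  have k: "k > 0" unfolding k_def by (rule boundary_chart_deriv_pos[OF openD DH f(2)])
  define F where "F = (\<lambda>z. - 1 / (f z - f (of_real y)))"
  have xy: "R / 2 \<le> \<bar>x - y\<bar>" using x y by simp
  note F = pole_map[OF f xy F_def, folded k_def]
  define G where "G = (\<lambda>n t. Re ((deriv ^^ n) F (of_real t)))"
  have HG: "H t y = k * G 1 t" if "\<bar>t - x\<bar> < R / 2" for t using F(4)[OF that] by (simp add: G_def)
  have dG: "(G n has_real_derivative G (Suc n) t) (at t)" if t: "\<bar>t - x\<bar> < R / 2" for n t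
    unfolding G_def
  proof (rule has_real_derivative_Re_of_real)
    have "(deriv ^^ n) F holomorphic_on ball (of_real x) (R / 2)" using F(1) by (rule holomorphic_higher_deriv) simp
    then show "((deriv ^^ n) F has_field_derivative (deriv ^^ Suc n) F (of_real t)) (at (of_real t))"
      using holomorphic_derivI[OF _ open_ball of_real_in_ball[OF t]] by simp
  qed
  have cb: "\<bar>G n x\<bar> * (R / 2) ^ (n - 1) \<le> real n * fact n * G 1 x" if "0 < n" for n
    using typically_real_coefficient_bound[OF F(1) _ F(2,3) that] x(2) by (simp add: G_def)
  have Hx: "H x y = k * G 1 x" using HG[of x] x(2) by simp
  show ?thesis
  proof (rule that)
    show "((\<lambda>t. H t y) has_real_derivative k * G 2 t) (at t)" if t: "\<bar>t - x\<bar> < R / 2" for t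
    proof -
      have "((\<lambda>t. k * G 1 t) has_real_derivative k * G 2 t) (at t)"
        using DERIV_cmult[OF dG[OF t, of 1], of k] by (simp add: numeral_2_eq_2)
      moreover have "\<forall>\<^sub>F u in nhds t. H u y = k * G 1 u"
        using eventually_nhds_abs_less[OF t] by eventually_elim (rule HG)
      ultimately show ?thesis by (rule DERIV_eventually_eq)
    qed
    show "((\<lambda>t. k * G 2 t) has_real_derivative k * G 3 x) (at x)"
      using DERIV_cmult[OF dG[of x 2], of k] x(2) by (simp add: numeral_3_eq_3)
    have "\<bar>G 2 x\<bar> * (R / 2) \<le> 4 * G 1 x" using cb[of 2] by (simp add: numeral_2_eq_2)
    then have "\<bar>G 2 x\<bar> \<le> 8 / R * G 1 x" using x(2) by (simp add: field_simps)
    then have "k * \<bar>G 2 x\<bar> \<le> k * (8 / R * G 1 x)" using k by (rule mult_left_mono[OF _ less_imp_le])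
    moreover have "\<bar>k * G 2 x\<bar> = k * \<bar>G 2 x\<bar>" using k by (simp only: abs_mult abs_of_pos)
    ultimately show "\<bar>k * G 2 x\<bar> \<le> 8 / R * H x y" unfolding Hx by (simp only: mult.left_commute)
    have fact3: "fact 3 = (6 :: real)" by (simp add: fact_numeral)
    have "\<bar>G 3 x\<bar> * (R / 2) ^ 2 \<le> 18 * G 1 x" using cb[of 3] fact3 by simp
    then have "\<bar>G 3 x\<bar> \<le> 72 / R\<^sup>2 * G 1 x" using x(2) by (simp add: power_divide pos_le_divide_eq)
    then have "k * \<bar>G 3 x\<bar> \<le> k * (72 / R\<^sup>2 * G 1 x)" using k by (rule mult_left_mono[OF _ less_imp_le])
    moreover have "\<bar>k * G 3 x\<bar> = k * \<bar>G 3 x\<bar>" using k by (simp only: abs_mult abs_of_pos)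
    ultimately show "\<bar>k * G 3 x\<bar> \<le> 72 / R\<^sup>2 * H x y" unfolding Hx by (simp only: mult.left_commute)
  qed
qed

text \<open>
  For a chart \<open>f\<close> the logarithmic derivative of the kernel in \<open>y\<close> is
  \<open>l(x) = f''(y)/f'(y) + 2 f'(y)/(f(x) - f(y))\<close>, and its derivative in \<open>x\<close> is \<open>-2H\<close>. So the mixed derivative
  is \<open>l \<partial>\<^sub>x H - 2 H\<^sup>2\<close>, where \<open>|l| \<le> 8/R\<close> by H_derivs with exchanged roles and \<open>H \<le> 1/R\<^sup>2\<close>; this
  accounts for \<open>66 = 64 + 2\<close>.
\<close>

lemma H_mixed_deriv:
  assumes x: "half_disc x R \<subseteq> D" "0 < R" and y: "half_disc y R \<subseteq> D" "R \<le> \<bar>x - y\<bar>"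
  obtains \<psi> m where "\<forall>\<^sub>F s in nhds x. ((\<lambda>t. H s t) has_real_derivative \<psi> s) (at y)"
    "(\<psi> has_real_derivative m) (at x)" "\<bar>m\<bar> \<le> 66 / R\<^sup>2 * H x y"
proof -
  have yb: "real_analytic_boundary_point D y" and xb: "real_analytic_boundary_point D x"
    using x y unfolding real_analytic_boundary_point_def by blast+
  have xy: "x \<noteq> y" using x y by auto
  obtain f e0 where f0: "boundary_chart D f x (R / 2)" "boundary_chart D f y e0"
    using boundary_charts_exist[OF scd DH x(1), of "R / 2" y] x(2) yb y by auto
  define e where "e = min e0 (R / 2)"
  have e: "e > 0" "e \<le> R / 2" using f0 x(2) by (auto simp: e_def boundary_chart_def)
  have f: "boundary_chart D f x (R / 2)" "boundary_chart D f y e"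
    using f0(1) boundary_chart_shift[OF f0(2) e(1), of y] by (auto simp: e_def)
  define g where "g = (\<lambda>n t. Re ((deriv ^^ n) f (of_real t)))"
  have dgx: "(g n has_real_derivative g (Suc n) s) (at s)" if "\<bar>s - x\<bar> < R / 2" for s n
    unfolding g_def by (rule chart_Re_deriv[OF f(1) that])
  have dgy: "(g n has_real_derivative g (Suc n) y) (at y)" for n
    unfolding g_def by (rule chart_Re_deriv[OF f(2)]) (use e in simp)
  have Hg: "H s t = g 1 s * g 1 t / (g 0 s - g 0 t)\<^sup>2" if "\<bar>s - x\<bar> < R / 2" "\<bar>t - y\<bar> < e" for s t
  proof -
    have "s \<noteq> t" using that e(2) y(2) by linarith
    from H_eq_chart[OF f that this] show ?thesis by (simp add: g_def)
  qed
  have ne: "g 0 s - g 0 y \<noteq> 0" if "\<bar>s - x\<bar> < R / 2" for s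
  proof -
    have "boundary_chart D f s (R / 2 - \<bar>s - x\<bar>)" using boundary_chart_shift[OF f(1)] that by simp
    moreover have "s \<noteq> y" using that y(2) x(2) by linarith
    ultimately show ?thesis using boundary_chart_inj[OF openD DH _ f(2)] by (simp add: g_def)
  qed
  have g1y: "g 1 y > 0" using boundary_chart_deriv_pos[OF openD DH f(2)] by (simp add: g_def)
  define l where "l = (\<lambda>s. g 2 y / g 1 y + 2 * g 1 y / (g 0 s - g 0 y))"
  have nx: "\<forall>\<^sub>F s in nhds x. \<bar>s - x\<bar> < R / 2" by (rule eventually_nhds_abs_less) (use x in simp)
  have ny: "\<forall>\<^sub>F t in nhds y. \<bar>t - y\<bar> < e" by (rule eventually_nhds_abs_less) (use e in simp)
  have d1: "((\<lambda>t. H s t) has_real_derivative H s y * l s) (at y)" if s: "\<bar>s - x\<bar> < R / 2" for s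
  proof -
    have "((\<lambda>t. g 1 s * g 1 t / (g 0 s - g 0 t)\<^sup>2) has_real_derivative H s y * l s) (at y)"
      using ne[OF s] g1y Hg[OF s, of y] e dgy[of 0] dgy[of 1]
      by (auto intro!: derivative_eq_intros simp: l_def numeral_2_eq_2)
         (simp add: divide_simps, simp add: algebra_simps)
    moreover have "\<forall>\<^sub>F t in nhds y. H s t = g 1 s * g 1 t / (g 0 s - g 0 t)\<^sup>2"
      using ny by eventually_elim (rule Hg[OF s])
    ultimately show ?thesis by (rule DERIV_eventually_eq)
  qed
  have xx: "\<bar>x - x\<bar> < R / 2" using x by simp
  have dl: "(l has_real_derivative - (2 * H x y)) (at x)"
    unfolding l_def using ne[OF xx] Hg[OF xx, of y] e dgx[OF xx, of 0]
    by (auto intro!: derivative_eq_intros simp: power2_eq_square)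
  obtain h1 h2 where h: "\<And>t. \<bar>t - x\<bar> < R / 2 \<Longrightarrow> ((\<lambda>t. H t y) has_real_derivative h1 t) (at t)" "\<bar>h1 x\<bar> \<le> 8 / R * H x y"
    by (rule H_derivs[OF x yb y(2)]) (rule that)
  have "R \<le> \<bar>y - x\<bar>" using y(2) by simp
  then obtain k1 k2 where k: "\<And>t. \<bar>t - y\<bar> < R / 2 \<Longrightarrow> ((\<lambda>t. H t x) has_real_derivative k1 t) (at t)" "\<bar>k1 y\<bar> \<le> 8 / R * H y x"
    by (rule H_derivs[OF y(1) x(2) xb]) (rule that)
  have "((\<lambda>t. H x t) has_real_derivative k1 y) (at y)"
    using k(1)[of y] x(2) by (simp add: boundary_poisson_commute[of D x])
  then have "k1 y = H x y * l x" using d1[OF xx] DERIV_unique by blast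
  then have "H x y * \<bar>l x\<bar> \<le> H x y * (8 / R)"
    using k(2) H_nonneg[of x y] by (simp add: boundary_poisson_commute[of D y x] abs_mult mult.commute)
  then have lx: "\<bar>l x\<bar> \<le> 8 / R" using mult_le_cancel_left_pos[OF H_pos(1)[OF xb yb xy]] by (rule iffD1[rotated])
  have Hxy: "H x y \<le> 1 / R\<^sup>2"
  proof -
    have "R\<^sup>2 \<le> (x - y)\<^sup>2" using y(2) x(2) by (simp add: abs_le_square_iff[symmetric])
    then have "1 / (x - y)\<^sup>2 \<le> 1 / R\<^sup>2" using x(2) by (intro divide_left_mono) (auto simp: xy)
    then show ?thesis using H_pos(2)[OF xb yb xy] by linarith
  qed
  show ?thesis
  proof (rule that)
    show "\<forall>\<^sub>F s in nhds x. ((\<lambda>t. H s t) has_real_derivative H s y * l s) (at y)"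
      using nx by eventually_elim (rule d1)
    show "((\<lambda>s. H s y * l s) has_real_derivative h1 x * l x + - (2 * H x y) * H x y) (at x)"
      by (rule DERIV_mult[OF h(1)[OF xx] dl])
    have "\<bar>h1 x * l x + - (2 * H x y) * H x y\<bar> \<le> \<bar>h1 x\<bar> * \<bar>l x\<bar> + 2 * H x y * H x y"
      using abs_triangle_ineq[of "h1 x * l x" "- (2 * H x y) * H x y"] H_nonneg[of x y] by (simp add: abs_mult)
    also have "\<dots> \<le> (8 / R * H x y) * (8 / R) + 2 * (1 / R\<^sup>2) * H x y"
      using h(2) lx Hxy H_nonneg[of x y] x(2) by (intro add_mono mult_mono) auto
    also have "\<dots> = 66 / R\<^sup>2 * H x y" by (simp add: power2_eq_square)
    finally show "\<bar>h1 x * l x + - (2 * H x y) * H x y\<bar> \<le> 66 / R\<^sup>2 * H x y" .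
  qed
qed

end

section \<open>Iterated partial derivatives and the bounds for the kernel\<close>

lemma partialI:
  assumes "((\<lambda>t. F (v[i := t])) has_real_derivative g) (at (v ! i))"
  shows "has_partial i F v" "partial i F v = g"
  using assms by (auto simp: has_partial_def partial_def field_differentiable_def DERIV_imp_deriv)

lemma partial2I:
  assumes ev: "\<forall>\<^sub>F t in nhds (v ! i). ((\<lambda>u. F (v[i := t, j := u])) has_real_derivative g t) (at (v[i := t] ! j))"
    and g: "(g has_real_derivative m) (at (v ! i))"
  shows "has_partial2 i j F v" "partial2 i j F v = m"
proof -
  have 1: "\<forall>\<^sub>F t in nhds (v ! i). has_partial j F (v[i := t])"
    using ev by eventually_elim (rule partialI)
  have "\<forall>\<^sub>F t in nhds (v ! i). partial j F (v[i := t]) = g t"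
    using ev by eventually_elim (rule partialI)
  then have "((\<lambda>t. partial j F (v[i := t])) has_real_derivative m) (at (v ! i))"
    by (rule DERIV_eventually_eq[OF g])
  note 2 = partialI[OF this]
  show "has_partial2 i j F v" "partial2 i j F v = m"
    using 1 2 by (simp_all add: has_partial2_def partial2_def)
qed

context half_plane_domain
begin

text \<open>
  The radius \<open>R\<close> may be half of \<open>\<delta>\<close>, so that the bounds in terms of \<open>\<delta>\<close> persist when \<open>x\<close> and \<open>y\<close> move a little.
  This turns \<open>72/R\<^sup>2\<close> into \<open>288/\<delta>\<^sup>2\<close>.
\<close>

lemma kernel_bounds_of_half_discs:
  assumes x: "half_disc x R \<subseteq> D" "0 < R" and y: "half_disc y R \<subseteq> D" "R \<le> \<bar>x - y\<bar>"
    and \<delta>: "0 < \<delta>" "\<delta> \<le> 2 * R" and c: "288 \<le> c"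
  shows "kernel_bounds c \<delta> D x y"
proof -
  have yb: "real_analytic_boundary_point D y" and xb: "real_analytic_boundary_point D x"
    using x y unfolding real_analytic_boundary_point_def by blast+
  have yx: "R \<le> \<bar>y - x\<bar>" using y(2) by simp
  obtain h1 h2 where h: "\<And>t. \<bar>t - x\<bar> < R / 2 \<Longrightarrow> ((\<lambda>t. H t y) has_real_derivative h1 t) (at t)"
    "(h1 has_real_derivative h2) (at x)" "\<bar>h1 x\<bar> \<le> 8 / R * H x y" "\<bar>h2\<bar> \<le> 72 / R\<^sup>2 * H x y"
    by (rule H_derivs[OF x yb y(2)]) (rule that)
  obtain k1 k2 where k: "\<And>t. \<bar>t - y\<bar> < R / 2 \<Longrightarrow> ((\<lambda>t. H t x) has_real_derivative k1 t) (at t)"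
    "(k1 has_real_derivative k2) (at y)" "\<bar>k1 y\<bar> \<le> 8 / R * H y x" "\<bar>k2\<bar> \<le> 72 / R\<^sup>2 * H y x"
    by (rule H_derivs[OF y(1) x(2) xb yx]) (rule that)
  obtain \<psi> m where m: "\<forall>\<^sub>F s in nhds x. ((\<lambda>t. H s t) has_real_derivative \<psi> s) (at y)"
    "(\<psi> has_real_derivative m) (at x)" "\<bar>m\<bar> \<le> 66 / R\<^sup>2 * H x y"
    by (rule H_mixed_deriv[OF x y]) (rule that)
  obtain \<psi>' m' where m': "\<forall>\<^sub>F s in nhds y. ((\<lambda>t. H s t) has_real_derivative \<psi>' s) (at x)"
    "(\<psi>' has_real_derivative m') (at y)" "\<bar>m'\<bar> \<le> 66 / R\<^sup>2 * H y x"
    by (rule H_mixed_deriv[OF y(1) x(2) x(1) yx]) (rule that)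
  have comm: "H y x = H x y" by (rule boundary_poisson_commute)
  have xx: "\<bar>x - x\<bar> < R / 2" "\<bar>y - y\<bar> < R / 2" using x by auto
  define F where "F = (\<lambda>v :: real list. H (v ! 0) (v ! 1))"
  have nx: "\<forall>\<^sub>F t in nhds x. \<bar>t - x\<bar> < R / 2" by (rule eventually_nhds_abs_less) (rule xx)
  have ny: "\<forall>\<^sub>F t in nhds y. \<bar>t - y\<bar> < R / 2" by (rule eventually_nhds_abs_less) (rule xx)
  have c1: "8 / R \<le> c / \<delta>"
  proof -
    have "8 * \<delta> \<le> c * R" using \<delta> c mult_right_mono[OF c, of R] x(2) by linarith
    then show ?thesis using \<delta> x(2) by (simp add: divide_simps mult.commute)
  qed
  have c2: "72 / R\<^sup>2 \<le> c / \<delta>\<^sup>2"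
  proof -
    have "\<delta>\<^sup>2 \<le> (2 * R)\<^sup>2" using \<delta> by (intro power_mono) auto
    then have "72 * \<delta>\<^sup>2 \<le> 288 * R\<^sup>2" by (simp add: power2_eq_square)
    also have "\<dots> \<le> c * R\<^sup>2" by (intro mult_right_mono c) auto
    finally show ?thesis using \<delta> x(2) by (simp add: divide_simps mult.commute)
  qed
  have c3: "66 / R\<^sup>2 \<le> c / \<delta>\<^sup>2"
  proof -
    have "66 / R\<^sup>2 \<le> 72 / R\<^sup>2" using x(2) by (intro divide_right_mono) auto
    then show ?thesis using c2 by linarith
  qed
  have le: "\<bar>a\<bar> \<le> d * H x y" if "\<bar>a\<bar> \<le> b * H x y" "b \<le> d" for a b d
    using that mult_right_mono[OF that(2) H_nonneg[of x y]] by linarith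
  have nth: "[x, y] ! 0 = x" "[x, y] ! 1 = y" "[x, y][0 := t] ! 0 = t" "[x, y][1 := t] ! 1 = t"
    "[x, y][0 := t] ! 1 = y" "[x, y][1 := t] ! 0 = x" for t by simp_all
  have F: "F ([x, y][0 := t]) = H t y" "F ([x, y][1 := t]) = H t x"
    "F ([x, y][0 := t, 0 := u]) = H u y" "F ([x, y][1 := t, 1 := u]) = H u x"
    "F ([x, y][0 := t, 1 := u]) = H t u" "F ([x, y][1 := t, 0 := u]) = H t u" for t u
    using boundary_poisson_commute[of D x t] boundary_poisson_commute[of D x u] boundary_poisson_commute[of D u t]
    by (simp_all add: F_def)
  have 0: "has_partial 0 F [x, y]" "partial 0 F [x, y] = h1 x"
    using partialI[of F "[x, y]" 0 "h1 x", unfolded F nth, OF h(1)[OF xx(1)]] .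
  have 1: "has_partial 1 F [x, y]" "partial 1 F [x, y] = k1 y"
    using partialI[of F "[x, y]" 1 "k1 y", unfolded F nth, OF k(1)[OF xx(2)]] .
  have ev0: "\<forall>\<^sub>F t in nhds x. ((\<lambda>u. H u y) has_real_derivative h1 t) (at t)"
    using nx by eventually_elim (rule h(1))
  have ev1: "\<forall>\<^sub>F t in nhds y. ((\<lambda>u. H u x) has_real_derivative k1 t) (at t)"
    using ny by eventually_elim (rule k(1))
  have 00: "has_partial2 0 0 F [x, y]" "partial2 0 0 F [x, y] = h2"
    using partial2I[where v = "[x, y]" and i = 0 and j = 0 and F = F and g = h1, unfolded F nth, OF ev0 h(2)] .
  have 11: "has_partial2 1 1 F [x, y]" "partial2 1 1 F [x, y] = k2"
    using partial2I[where v = "[x, y]" and i = 1 and j = 1 and F = F and g = k1, unfolded F nth, OF ev1 k(2)] .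
  have 01: "has_partial2 0 1 F [x, y]" "partial2 0 1 F [x, y] = m"
    using partial2I[where v = "[x, y]" and i = 0 and j = 1 and F = F and g = \<psi>, unfolded F nth, OF m(1,2)] .
  have 10: "has_partial2 1 0 F [x, y]" "partial2 1 0 F [x, y] = m'"
    using partial2I[where v = "[x, y]" and i = 1 and j = 0 and F = F and g = "\<psi>'", unfolded F nth, OF m'(1,2)] .
  have F_nth: "F [x, y] = H x y" by (simp add: F_def)
  show ?thesis
    unfolding kernel_bounds_def F_def[symmetric] Let_def
    unfolding F_nth
    using 0 1 00 11 01 10 le[OF h(3) c1] le[OF h(4) c2] le[OF m(3) c3]
      le[OF k(3)[unfolded comm] c1] le[OF k(4)[unfolded comm] c2] le[OF m'(3)[unfolded comm] c3]
    by (simp only: ball_simps simp_thms)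
qed

end

section \<open>The hypergeometric factor of the partition function\<close>

definition hyp_coeff :: "real \<Rightarrow> nat \<Rightarrow> real" where
  "hyp_coeff a n = fps_nth (fps_hypergeo [2 * a, 1 - 2 * a] [4 * a] 1) n"

lemma hyp_coeff_eq:
  "hyp_coeff a n = pochhammer (2 * a) n * pochhammer (1 - 2 * a) n / (pochhammer (4 * a) n * fact n)"
  by (simp add: hyp_coeff_def)

text \<open>
  By the product formula for the reciprocal Gamma function, \<open>(z)\<^sub>n\<^sub>+\<^sub>1\<close> is \<open>n! n\<^sup>z\<close> times a convergent sequence,
  for every \<open>z\<close>, including the case that \<open>1 - 2a\<close> is a nonpositive integer and the series terminates.
\<close>

lemma hyp_coeff_bound:
  assumes a: "1 / 2 \<le> a"
  obtains B where "0 \<le> B" "\<And>n. 0 < n \<Longrightarrow> \<bar>hyp_coeff a (Suc n)\<bar> \<le> B * real n powr (1 - 4 * a) / real (Suc n)"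
proof -
  define s where "s = (\<lambda>n. rGamma_series (2 * a) n * rGamma_series (1 - 2 * a) n / rGamma_series (4 * a) n)"
  have "rGamma (4 * a) \<noteq> 0" using a by (simp add: rGamma_eq_zero_iff nonpos_Ints_def)
  then have "s \<longlonglongrightarrow> rGamma (2 * a) * rGamma (1 - 2 * a) / rGamma (4 * a)"
    unfolding s_def by (intro tendsto_intros)
  then have "Bseq s" by (rule convergentI[THEN convergent_imp_Bseq])
  then obtain B where B: "0 < B" "\<And>n. norm (s n) \<le> B" by (rule BseqE) blast
  have eq: "hyp_coeff a (Suc n) = s n * real n powr (1 - 4 * a) / real (Suc n)" if n: "0 < n" for n
  proof -
    have p: "pochhammer (4 * a) (Suc n) > 0" using a by (intro pochhammer_pos) simp
    have r: "rGamma_series z n = pochhammer z (Suc n) / (fact n * real n powr z)" for z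
      using n by (simp add: rGamma_series_def powr_def)
    have np: "real n powr z > 0" for z using n by simp
    have "s n = pochhammer (2 * a) (Suc n) * pochhammer (1 - 2 * a) (Suc n) / pochhammer (4 * a) (Suc n)
        * (real n powr (4 * a) / (real n powr (2 * a) * real n powr (1 - 2 * a))) / fact n"
      unfolding s_def r by (simp add: divide_simps)
    moreover have "real n powr (2 * a) * real n powr (1 - 2 * a) = real n powr 1"
      by (simp flip: powr_add)
    moreover have "real n powr (4 * a) / real n powr 1 * real n powr (1 - 4 * a) = 1"
      using n by (simp flip: powr_add powr_diff)
    moreover have "s' * t = p / d" if "s' = p * (u / v) / d" "v = w" "u / w * t = 1" for s' p u v w d t :: real
    proof -
      have "s' * t = p * (u / w * t) / d" unfolding that(1,2) by simp
      then show ?thesis unfolding that(3) by simp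
    qed
    ultimately have "s n * real n powr (1 - 4 * a) = pochhammer (2 * a) (Suc n) * pochhammer (1 - 2 * a) (Suc n) / pochhammer (4 * a) (Suc n) / fact n"
      by blast
    then show ?thesis unfolding hyp_coeff_eq fact_Suc by (simp add: divide_simps)
  qed
  show ?thesis
  proof (rule that[of B])
    show "\<bar>hyp_coeff a (Suc n)\<bar> \<le> B * real n powr (1 - 4 * a) / real (Suc n)" if "0 < n" for n
      unfolding eq[OF that] using B(2)[of n] by (simp add: abs_mult divide_right_mono mult_right_mono)
  qed (use B in simp)
qed

text \<open>
  For \<open>a = 1/2\<close> the general bound is not summable, but then the series consists of its constant term only.
\<close>

lemma hyp_coeff_summable:
  assumes a: "1 / 2 \<le> a"
  shows "summable (\<lambda>n. \<bar>real (Suc n) * hyp_coeff a (Suc n)\<bar>)"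
proof (cases "a = 1 / 2")
  case True
  then have "1 - 2 * a = 0" by simp
  then have "hyp_coeff a (Suc n) = 0" for n unfolding hyp_coeff_eq by (simp add: pochhammer_0_left)
  then show ?thesis by simp
next
  case False
  obtain B where B: "0 \<le> B" "\<And>n. 0 < n \<Longrightarrow> \<bar>hyp_coeff a (Suc n)\<bar> \<le> B * real n powr (1 - 4 * a) / real (Suc n)"
    by (rule hyp_coeff_bound[OF a]) (rule that)
  have "summable (\<lambda>n. B * real n powr (1 - 4 * a))"
    using False a by (intro summable_mult) (simp add: summable_real_powr_iff)
  then show ?thesis
  proof (rule summable_comparison_test_ev[rotated])
    show "\<forall>\<^sub>F n in sequentially. norm \<bar>real (Suc n) * hyp_coeff a (Suc n)\<bar> \<le> B * real n powr (1 - 4 * a)"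
      using eventually_gt_at_top[of 0]
    proof eventually_elim
      case (elim n)
      have "real (Suc n) * \<bar>hyp_coeff a (Suc n)\<bar> \<le> real (Suc n) * (B * real n powr (1 - 4 * a) / real (Suc n))"
        by (intro mult_left_mono B(2) elim) simp
      also have "\<dots> = B * real n powr (1 - 4 * a)" by simp
      finally show ?case by (simp only: real_norm_def abs_abs abs_mult abs_of_nat)
    qed
  qed
qed

lemma hyp_coeff_square_bounded:
  assumes a: "1 / 2 \<le> a"
  obtains C where "0 \<le> C" "\<And>n. \<bar>real (Suc n) * real (Suc (Suc n)) * hyp_coeff a (Suc (Suc n))\<bar> \<le> C"
proof -
  obtain B where B: "0 \<le> B" "\<And>n. 0 < n \<Longrightarrow> \<bar>hyp_coeff a (Suc n)\<bar> \<le> B * real n powr (1 - 4 * a) / real (Suc n)"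
    by (rule hyp_coeff_bound[OF a]) (rule that)
  show ?thesis
  proof (rule that[of B])
    fix n
    have "\<bar>hyp_coeff a (Suc (Suc n))\<bar> \<le> B * real (Suc n) powr (1 - 4 * a) / real (Suc (Suc n))"
      by (rule B(2)) simp
    also have "\<dots> \<le> B * real (Suc n) powr (- 1) / real (Suc (Suc n))"
      using a B(1) by (intro divide_right_mono mult_left_mono powr_mono) auto
    also have "\<dots> = B / (real (Suc n) * real (Suc (Suc n)))" by (simp add: powr_minus_divide)
    finally have "real (Suc n) * real (Suc (Suc n)) * \<bar>hyp_coeff a (Suc (Suc n))\<bar> \<le> real (Suc n) * real (Suc (Suc n)) * (B / (real (Suc n) * real (Suc (Suc n))))"
      by (intro mult_left_mono) auto
    also have "\<dots> = B" by simp
    finally show "\<bar>real (Suc n) * real (Suc (Suc n)) * hyp_coeff a (Suc (Suc n))\<bar> \<le> B"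
      by (simp only: abs_mult abs_of_nat)
  qed (rule B)
qed

abbreviation hyp_fps :: "real \<Rightarrow> real fps" where
  "hyp_fps a \<equiv> fps_hypergeo [2 * a, 1 - 2 * a] [4 * a] 1"

lemma hyp_coeff_nth: "fps_nth (hyp_fps a) n = hyp_coeff a n"
  by (simp only: hyp_coeff_def)

lemma hyp_conv_radius:
  assumes a: "1 / 2 \<le> a"
  shows "1 \<le> fps_conv_radius (hyp_fps a)"
proof -
  have "summable (\<lambda>n. \<bar>hyp_coeff a (Suc n)\<bar>)"
  proof (rule summable_comparison_test'[OF hyp_coeff_summable[OF a]])
    fix n
    have "1 * \<bar>hyp_coeff a (Suc n)\<bar> \<le> real (Suc n) * \<bar>hyp_coeff a (Suc n)\<bar>"
      by (intro mult_right_mono) auto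
    then show "norm \<bar>hyp_coeff a (Suc n)\<bar> \<le> \<bar>real (Suc n) * hyp_coeff a (Suc n)\<bar>"
      by (simp only: real_norm_def abs_abs abs_mult abs_of_nat mult_1)
  qed
  then have "summable (\<lambda>n. \<bar>hyp_coeff a n\<bar>)" by (subst (asm) summable_Suc_iff)
  then have "summable (\<lambda>n. hyp_coeff a n)" by (rule summable_rabs_cancel)
  then have "summable (\<lambda>n. fps_nth (hyp_fps a) n * 1 ^ n)" by (simp only: hyp_coeff_nth power_one mult_1_right)
  then have "norm (1::real) \<le> conv_radius (fps_nth (hyp_fps a))" by (rule conv_radius_geI)
  then show ?thesis by (simp add: fps_conv_radius_def one_ereal_def)
qed

text \<open>
  The first derivative is bounded because \<open>n f\<^sub>n\<close> is absolutely summable. The numbers \<open>n\<^sup>2 f\<^sub>n\<close> are bounded,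
  which leaves a geometric series for the second derivative. For \<open>1/2 < a < 3/4\<close> it is indeed unbounded
  near 1.
\<close>

lemma hyp_derivs:
  assumes a: "1 / 2 \<le> a"
  obtains F1 F2 C where "0 \<le> C"
    "\<And>x. \<bar>x\<bar> < 1 \<Longrightarrow> (eval_fps (hyp_fps a) has_real_derivative F1 x) (at x)"
    "\<And>x. \<bar>x\<bar> < 1 \<Longrightarrow> (F1 has_real_derivative F2 x) (at x)"
    "\<And>x. 0 \<le> x \<Longrightarrow> x < 1 \<Longrightarrow> \<bar>F1 x\<bar> \<le> C"
    "\<And>x. 0 \<le> x \<Longrightarrow> x < 1 \<Longrightarrow> \<bar>F2 x\<bar> \<le> C / (1 - x)"
proof -
  let ?F = "hyp_fps a"
  define C1 where "C1 = (\<Sum>n. \<bar>real (Suc n) * hyp_coeff a (Suc n)\<bar>)"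
  have C10: "0 \<le> C1" unfolding C1_def by (intro suminf_nonneg hyp_coeff_summable[OF a]) simp
  obtain C2 where C2: "0 \<le> C2" "\<And>n. \<bar>real (Suc n) * real (Suc (Suc n)) * hyp_coeff a (Suc (Suc n))\<bar> \<le> C2"
    by (rule hyp_coeff_square_bounded[OF a]) (rule that)
  have R0: "ereal \<bar>x\<bar> < fps_conv_radius ?F" if "\<bar>x\<bar> < 1" for x
    using that hyp_conv_radius[OF a] less_le_trans[of "ereal \<bar>x\<bar>" 1] by simp
  have R1: "ereal \<bar>x\<bar> < fps_conv_radius (fps_deriv ?F)" if "\<bar>x\<bar> < 1" for x
    using R0[OF that] fps_conv_radius_deriv[of ?F] by (rule less_le_trans)
  have R2: "ereal \<bar>x\<bar> < fps_conv_radius (fps_deriv (fps_deriv ?F))" if "\<bar>x\<bar> < 1" for x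
    using R1[OF that] fps_conv_radius_deriv[of "fps_deriv ?F"] by (rule less_le_trans)
  have n1: "fps_nth (fps_deriv ?F) n = real (Suc n) * hyp_coeff a (Suc n)" for n
    by (simp only: fps_deriv_nth hyp_coeff_nth Suc_eq_plus1)
  have n2: "fps_nth (fps_deriv (fps_deriv ?F)) n = real (Suc n) * (real (Suc (Suc n)) * hyp_coeff a (Suc (Suc n)))" for n
    by (simp only: fps_deriv_nth hyp_coeff_nth Suc_eq_plus1[symmetric])
  show ?thesis
  proof (rule that[of "max C1 C2" "eval_fps (fps_deriv ?F)" "eval_fps (fps_deriv (fps_deriv ?F))"])
    show "0 \<le> max C1 C2" using C10 by simp
    show "(eval_fps ?F has_real_derivative eval_fps (fps_deriv ?F) x) (at x)" if "\<bar>x\<bar> < 1" for x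
      by (rule has_field_derivative_eval_fps) (use R0[OF that] in simp)
    show "(eval_fps (fps_deriv ?F) has_real_derivative eval_fps (fps_deriv (fps_deriv ?F)) x) (at x)" if "\<bar>x\<bar> < 1" for x
      by (rule has_field_derivative_eval_fps) (use R1[OF that] in simp)
    fix x :: real assume x: "0 \<le> x" "x < 1"
    have x1: "\<bar>x\<bar> < 1" using x by simp
    have xn: "0 \<le> x ^ n" "x ^ n \<le> 1" for n using x by (auto intro: power_le_one)
    have nx: "norm (u * x ^ n) = \<bar>u\<bar> * x ^ n" for u :: real and n
      unfolding real_norm_def abs_mult abs_of_nonneg[OF xn(1)] ..
    have s1: "(\<lambda>n. real (Suc n) * hyp_coeff a (Suc n) * x ^ n) sums eval_fps (fps_deriv ?F) x"
      using sums_eval_fps[of x "fps_deriv ?F"] R1[OF x1] by (simp only: n1 real_norm_def)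
    have s2: "(\<lambda>n. real (Suc n) * (real (Suc (Suc n)) * hyp_coeff a (Suc (Suc n))) * x ^ n) sums eval_fps (fps_deriv (fps_deriv ?F)) x"
      using sums_eval_fps[of x "fps_deriv (fps_deriv ?F)"] R2[OF x1] by (simp only: n2 real_norm_def)
    have "\<bar>eval_fps (fps_deriv ?F) x\<bar> \<le> C1"
    proof -
      have "norm (\<Sum>n. real (Suc n) * hyp_coeff a (Suc n) * x ^ n) \<le> C1"
        unfolding C1_def
      proof (rule norm_suminf_le[OF _ hyp_coeff_summable[OF a]])
        show "norm (real (Suc n) * hyp_coeff a (Suc n) * x ^ n) \<le> \<bar>real (Suc n) * hyp_coeff a (Suc n)\<bar>" for n
          unfolding nx by (rule mult_left_le[OF xn(2) abs_ge_zero])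
      qed
      then show ?thesis using sums_unique[OF s1] by simp
    qed
    then show "\<bar>eval_fps (fps_deriv ?F) x\<bar> \<le> max C1 C2" by simp
    have "\<bar>eval_fps (fps_deriv (fps_deriv ?F)) x\<bar> \<le> C2 / (1 - x)"
    proof -
      have g: "(\<lambda>n. C2 * x ^ n) sums (C2 * (1 / (1 - x)))"
        by (rule sums_mult[OF geometric_sums]) (use x1 in simp)
      have "norm (\<Sum>n. real (Suc n) * (real (Suc (Suc n)) * hyp_coeff a (Suc (Suc n))) * x ^ n) \<le> (\<Sum>n. C2 * x ^ n)"
      proof (rule norm_suminf_le[OF _ sums_summable[OF g]])
        show "norm (real (Suc n) * (real (Suc (Suc n)) * hyp_coeff a (Suc (Suc n))) * x ^ n) \<le> C2 * x ^ n" for n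
          unfolding nx by (rule mult_right_mono[OF C2(2)[unfolded mult.assoc] xn(1)])
      qed
      then show ?thesis using sums_unique[OF s2] sums_unique[OF g] by simp
    qed
    also have "\<dots> \<le> max C1 C2 / (1 - x)" using x by (intro divide_right_mono) auto
    finally show "\<bar>eval_fps (fps_deriv (fps_deriv ?F)) x\<bar> \<le> max C1 C2 / (1 - x)" .
  qed
qed

lemma Beta_pochhammer:
  assumes "0 < (b::real)" "0 < c"
  shows "Beta (b + real n) c * pochhammer (b + c) n = pochhammer b n * Beta b c"
proof (induction n)
  case (Suc n)
  have ni: "b + real n \<notin> \<int>\<^sub>\<le>\<^sub>0" using assms by (auto simp: nonpos_Ints_def)
  have "(b + real n + c) * Beta (b + real n + 1) c = (b + real n) * Beta (b + real n) c"
    by (rule Beta_plus1_left[OF ni])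
  moreover have "Beta (b + real (Suc n)) c * pochhammer (b + c) (Suc n) = pochhammer (b + c) n * ((b + real n + c) * Beta (b + real n + 1) c)"
    by (simp add: pochhammer_Suc algebra_simps)
  ultimately have "Beta (b + real (Suc n)) c * pochhammer (b + c) (Suc n) = (b + real n) * (Beta (b + real n) c * pochhammer (b + c) n)"
    by (simp only: mult_ac)
  then show ?case unfolding Suc.IH by (simp add: pochhammer_Suc algebra_simps)
qed simp

lemma Beta_pos: "0 < (b::real) \<Longrightarrow> 0 < c \<Longrightarrow> 0 < Beta b c"
  by (simp add: Beta_def)

text \<open>
  Euler's integral: the coefficients are \<open>c\<^sub>n Beta (2a + n) (2a) / Beta (2a) (2a)\<close>, where \<open>c\<^sub>n\<close> are the
  coefficients of \<open>(1 - u)\<close> to the power \<open>2a - 1\<close>. So the series is the mean of the \<open>(2a - 1)\<close>-th power of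
  \<open>1 - xt\<close> with respect to the weight \<open>w\<close>. As \<open>2a - 1\<close> is nonnegative, the mean is at least the one for
  \<open>x = 1\<close>, which is again a Beta integral.
\<close>

lemma hyp_lower_bound:
  assumes a: "1 / 2 \<le> a" and x: "0 \<le> x" "x < 1"
  shows "Beta (2 * a) (4 * a - 1) / Beta (2 * a) (2 * a) \<le> eval_fps (hyp_fps a) x"
proof -
  define B where "B = Beta (2 * a) (2 * a)"
  have B: "B > 0" unfolding B_def using a by (intro Beta_pos) auto
  define c where "c = (\<lambda>n. pochhammer (1 - 2 * a) n / fact n)"
  define w where "w = (\<lambda>t::real. t powr (2 * a - 1) * (1 - t) powr (2 * a - 1))"
  have binom: "(\<lambda>n. c n * u ^ n) sums ((1 - u) powr (2 * a - 1))" if "\<bar>u\<bar> < 1" for u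
  proof -
    have "(\<lambda>n. ((2 * a - 1) gchoose n) * (- u) ^ n) sums ((1 + - u) powr (2 * a - 1))"
      by (rule gen_binomial_real) (use that in simp)
    moreover have "((2 * a - 1) gchoose n) * (- u) ^ n = c n * u ^ n" for n
    proof -
      have "((2 * a - 1) gchoose n) * (- u) ^ n = ((- 1) ^ n * (- 1) ^ n) * (pochhammer (1 - 2 * a) n / fact n) * u ^ n"
        by (subst power_minus) (simp add: gbinomial_pochhammer)
      also have "(- 1) ^ n * (- 1) ^ n = (1::real)" by (simp flip: power_mult_distrib)
      finally show ?thesis by (simp add: c_def)
    qed
    ultimately show ?thesis by simp
  qed
  have M: "((\<lambda>t. t ^ n * w t) has_integral (Beta (2 * a + real n) (2 * a))) {0..1}" for n
  proof -
    have "((\<lambda>t. t powr (2 * a + real n - 1) * (1 - t) powr (2 * a - 1)) has_integral (Beta (2 * a + real n) (2 * a))) {0..1}"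
      by (rule has_integral_Beta_real) (use a in auto)
    then show ?thesis
    proof (rule has_integral_spike_finite[where S = "{0}", rotated 2])
      fix t :: real assume "t \<in> {0..1} - {0}"
      then have "t > 0" by auto
      then have "t powr (2 * a + real n - 1) = t ^ n * t powr (2 * a - 1)"
        by (simp add: powr_realpow[symmetric] powr_add[symmetric] algebra_simps)
      then show "t ^ n * w t = t powr (2 * a + real n - 1) * (1 - t) powr (2 * a - 1)"
        by (simp add: w_def)
    qed simp
  qed
  have coeff: "hyp_coeff a n * B = c n * Beta (2 * a + real n) (2 * a)" for n
  proof -
    have "pochhammer (4 * a) n > 0" using a by (intro pochhammer_pos) simp
    moreover have "Beta (2 * a + real n) (2 * a) * pochhammer (4 * a) n = pochhammer (2 * a) n * B"
      using Beta_pochhammer[of "2 * a" "2 * a" n] a by (simp add: B_def)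
    ultimately show ?thesis
      unfolding hyp_coeff_eq c_def by (simp add: divide_simps)
  qed
  have xr: "ereal (norm x) < fps_conv_radius (hyp_fps a)"
    using x hyp_conv_radius[OF a] less_le_trans[of "ereal \<bar>x\<bar>" 1] by simp
  have S: "(\<lambda>n. B * (hyp_coeff a n * x ^ n)) sums (B * eval_fps (hyp_fps a) x)"
    using sums_eval_fps[OF xr] unfolding hyp_coeff_nth by (rule sums_mult)
  define y where "y = (x + 1) / 2"
  have y: "\<bar>x\<bar> < \<bar>y\<bar>" "\<bar>y\<bar> < 1" using x by (auto simp: y_def)
  have abs: "summable (\<lambda>n. \<bar>c n * x ^ n\<bar>)"
    using powser_insidea[of c y x] sums_summable[OF binom[OF y(2)]] y(1) by simp
  have low: "((\<lambda>t. t powr (2 * a - 1) * (1 - t) powr (4 * a - 2)) has_integral Beta (2 * a) (4 * a - 1)) {0..1}"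
    using has_integral_Beta_real[of "2 * a" "4 * a - 1"] a by (simp add: algebra_simps)
  \<comment> \<open>A lower bound of the integrals of the partial sums suffices; the tail of the binomial series at \<open>x t\<close> is
    uniformly at most \<open>e\<close>, since it is dominated by the tail at \<open>x\<close>.\<close>
  have main: "Beta (2 * a) (4 * a - 1) - e * B \<le> B * eval_fps (hyp_fps a) x" if e: "e > 0" for e
  proof -
    obtain N where N: "\<And>n. n \<ge> N \<Longrightarrow> norm (\<Sum>i. \<bar>c (i + n) * x ^ (i + n)\<bar>) < e"
      using suminf_exist_split[OF e abs] by auto
    have "Beta (2 * a) (4 * a - 1) - e * B \<le> (\<Sum>i<n. B * (hyp_coeff a i * x ^ i))" if n: "n \<ge> N" for n
    proof (rule has_integral_le)
      show "((\<lambda>t. t powr (2 * a - 1) * (1 - t) powr (4 * a - 2) - e * (t ^ 0 * w t)) has_integral (Beta (2 * a) (4 * a - 1) - e * B)) {0..1}"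
        using M[of 0] by (intro has_integral_diff low has_integral_mult_right) (simp add: B_def)
      have "((\<lambda>t. \<Sum>i<n. c i * x ^ i * (t ^ i * w t)) has_integral (\<Sum>i<n. c i * x ^ i * Beta (2 * a + real i) (2 * a))) {0..1}"
        by (intro has_integral_sum has_integral_mult_right M) simp
      moreover have "c i * x ^ i * Beta (2 * a + real i) (2 * a) = B * (hyp_coeff a i * x ^ i)" for i
        using coeff[of i] by (simp add: mult_ac)
      ultimately show "((\<lambda>t. \<Sum>i<n. c i * x ^ i * (t ^ i * w t)) has_integral (\<Sum>i<n. B * (hyp_coeff a i * x ^ i))) {0..1}"
        by simp
      fix t :: real assume t: "t \<in> {0..1}"
      have xt: "0 \<le> x * t" "x * t \<le> t" "x * t \<le> x" using x t by (auto intro: mult_left_le mult_left_le_one_le)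
      then have xt1: "\<bar>x * t\<bar> < 1" using x by simp
      have w0: "0 \<le> w t" by (simp add: w_def)
      have sx: "summable (\<lambda>i. c i * (x * t) ^ i)" by (rule sums_summable[OF binom[OF xt1]])
      have "(1 - x * t) powr (2 * a - 1) = (\<Sum>i. c i * (x * t) ^ i)"
        by (rule sums_unique[OF binom[OF xt1]])
      also have "\<dots> = (\<Sum>i. c (i + n) * (x * t) ^ (i + n)) + (\<Sum>i<n. c i * (x * t) ^ i)"
        by (rule suminf_split_initial_segment[OF sx])
      also have "(\<Sum>i. c (i + n) * (x * t) ^ (i + n)) \<le> e"
      proof -
        have "norm (\<Sum>i. c (i + n) * (x * t) ^ (i + n)) \<le> (\<Sum>i. \<bar>c (i + n) * x ^ (i + n)\<bar>)"
        proof (rule norm_suminf_le)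
          show "summable (\<lambda>i. \<bar>c (i + n) * x ^ (i + n)\<bar>)"
            using abs by (rule summable_ignore_initial_segment)
          show "norm (c (i + n) * (x * t) ^ (i + n)) \<le> \<bar>c (i + n) * x ^ (i + n)\<bar>" for i
            unfolding real_norm_def abs_mult power_abs[symmetric] using xt x
            by (intro mult_left_mono power_mono) (auto simp: power_abs[symmetric] abs_mult intro!: power_mono)
        qed
        moreover have "(\<Sum>i. \<bar>c (i + n) * x ^ (i + n)\<bar>) \<le> e" using N[OF n] by simp
        ultimately show ?thesis by simp
      qed
      finally have ge: "(1 - x * t) powr (2 * a - 1) - e \<le> (\<Sum>i<n. c i * (x * t) ^ i)" by simp
      have "(1 - t) powr (2 * a - 1) \<le> (1 - x * t) powr (2 * a - 1)"
        using a t xt by (intro powr_mono2) auto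
      with ge have "(1 - t) powr (2 * a - 1) - e \<le> (\<Sum>i<n. c i * (x * t) ^ i)" by linarith
      then have "((1 - t) powr (2 * a - 1) - e) * w t \<le> (\<Sum>i<n. c i * (x * t) ^ i) * w t"
        using w0 by (rule mult_right_mono)
      also have "\<dots> = (\<Sum>i<n. c i * x ^ i * (t ^ i * w t))"
        by (simp add: sum_distrib_right sum_distrib_left power_mult_distrib mult_ac)
      also have "((1 - t) powr (2 * a - 1) - e) * w t = t powr (2 * a - 1) * (1 - t) powr (4 * a - 2) - e * (t ^ 0 * w t)"
      proof -
        have "(1 - t) powr (4 * a - 2) = (1 - t) powr (2 * a - 1) * (1 - t) powr (2 * a - 1)"
          by (simp flip: powr_add)
        then show ?thesis by (simp add: w_def algebra_simps)
      qed
      finally show "t powr (2 * a - 1) * (1 - t) powr (4 * a - 2) - e * (t ^ 0 * w t) \<le> (\<Sum>i<n. c i * x ^ i * (t ^ i * w t))" .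
    qed
    then show ?thesis
      using S unfolding sums_def by (intro LIMSEQ_le_const[of _ _ "Beta (2 * a) (4 * a - 1) - e * B"]) blast+
  qed
  have "Beta (2 * a) (4 * a - 1) \<le> B * eval_fps (hyp_fps a) x"
  proof (rule field_le_epsilon)
    fix e :: real assume "e > 0"
    then show "Beta (2 * a) (4 * a - 1) \<le> B * eval_fps (hyp_fps a) x + e"
      using main[of "e / B"] B by simp
  qed
  then show ?thesis using B unfolding B_def[symmetric] by (simp add: pos_divide_le_eq mult.commute)
qed

lemma one_minus_exp_lower:
  assumes "0 < (I::real)"
  shows "min 1 I / 2 \<le> 1 - exp (- I)"
proof -
  have "exp (- I) \<le> 1 / (1 + I)"
    using exp_ge_add_one_self[of I] assms by (simp add: exp_minus inverse_eq_divide divide_left_mono)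
  moreover have "min 1 I / 2 \<le> 1 - 1 / (1 + I)"
  proof -
    have "min 1 I * (1 + I) \<le> 2 * I"
      using assms by (cases "I \<le> 1") (auto simp: min_def algebra_simps)
    then show ?thesis using assms by (simp add: field_simps)
  qed
  ultimately show ?thesis by linarith
qed

text \<open>
  For \<open>x = exp (-I)\<close> the derivative in \<open>I\<close> is \<open>-x d/dx\<close>, so the two derivatives of \<open>\<phi>\<close> are \<open>\<phi>\<close> times
  combinations of \<open>F'/F\<close> and \<open>F''/F\<close>. The lower bound of \<open>F\<close> controls the denominators, and the factor
  \<open>min 1 I\<close>, at most \<open>2 (1 - x)\<close>, compensates the growth of \<open>F''\<close> at 1.
\<close>

lemma phi_exp_bounds:
  assumes \<kappa>: "0 < \<kappa>" "\<kappa> \<le> 4"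
  obtains G1 G2 C where "0 \<le> C" "\<And>I. 0 < I \<Longrightarrow> 0 < phi \<kappa> (exp (- I))"
    "\<And>I. 0 < I \<Longrightarrow> ((\<lambda>I. phi \<kappa> (exp (- I))) has_real_derivative G1 I) (at I)"
    "\<And>I. 0 < I \<Longrightarrow> (G1 has_real_derivative G2 I) (at I)"
    "\<And>I. 0 < I \<Longrightarrow> \<bar>G1 I\<bar> \<le> C * phi \<kappa> (exp (- I))"
    "\<And>I. 0 < I \<Longrightarrow> \<bar>G2 I\<bar> * min 1 I \<le> C * phi \<kappa> (exp (- I))"
proof -
  define a where "a = 2 / \<kappa>"
  have a: "1 / 2 \<le> a" using \<kappa> by (simp add: a_def divide_simps)
  define k where "k = Gamma (2 * a) * Gamma (6 * a - 1) / (Gamma (4 * a) * Gamma (4 * a - 1))"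
  have k: "k > 0" unfolding k_def using a by (intro divide_pos_pos mult_pos_pos Gamma_real_pos) auto
  define F where "F = eval_fps (hyp_fps a)"
  have phi: "phi \<kappa> x = k * x powr a * F x" for x
    by (simp only: phi_def Let_def a_def k_def F_def)
  obtain F1 F2 C0 where C0: "0 \<le> C0"
    and F1: "\<And>x. \<bar>x\<bar> < 1 \<Longrightarrow> (F has_real_derivative F1 x) (at x)"
    and F2: "\<And>x. \<bar>x\<bar> < 1 \<Longrightarrow> (F1 has_real_derivative F2 x) (at x)"
    and b1: "\<And>x. 0 \<le> x \<Longrightarrow> x < 1 \<Longrightarrow> \<bar>F1 x\<bar> \<le> C0"
    and b2: "\<And>x. 0 \<le> x \<Longrightarrow> x < 1 \<Longrightarrow> \<bar>F2 x\<bar> \<le> C0 / (1 - x)"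
    by (rule hyp_derivs[OF a, folded F_def]) (rule that)
  define m where "m = Beta (2 * a) (4 * a - 1) / Beta (2 * a) (2 * a)"
  have m: "m > 0" unfolding m_def using a by (intro divide_pos_pos Beta_pos) auto
  have lb: "m \<le> F x" if "0 \<le> x" "x < 1" for x
    unfolding m_def F_def by (rule hyp_lower_bound[OF a that])
  define G where "G = (\<lambda>I. k * exp (- (a * I)) * F (exp (- I)))"
  define G1 where "G1 = (\<lambda>I. k * exp (- (a * I)) * (- a * F (exp (- I)) - exp (- I) * F1 (exp (- I))))"
  define G2 where "G2 = (\<lambda>I. k * exp (- (a * I)) * (a\<^sup>2 * F (exp (- I)) + (2 * a + 1) * (exp (- I) * F1 (exp (- I))) + exp (- I) * exp (- I) * F2 (exp (- I))))"
  have G: "phi \<kappa> (exp (- I)) = G I" for I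
    by (simp add: phi G_def exp_powr_real mult.commute)
  define q where "q = C0 / m"
  have q: "0 \<le> q" "q * m = C0" using C0 m by (simp_all add: q_def)
  define C where "C = (a\<^sup>2 * 1 + a + (2 * a + 1) * q + 2 * q)"
  show ?thesis
  proof (rule that[of C G1 G2])
    show "0 \<le> C" using a q(1) by (auto simp: C_def)
    fix I :: real assume I: "0 < I"
    let ?x = "exp (- I)"
    have x: "0 \<le> ?x" "?x < 1" "\<bar>?x\<bar> < 1" using I by auto
    note Fm = lb[OF x(1,2)]
    have Gp: "0 < G I" using k m Fm by (simp add: G_def)
    then show "0 < phi \<kappa> (exp (- I))" by (simp add: G)
    have dx: "((\<lambda>I. exp (- I)) has_real_derivative - ?x) (at I)"
      by (auto intro!: derivative_eq_intros)
    have dE: "((\<lambda>I. k * exp (- (a * I))) has_real_derivative - a * (k * exp (- (a * I)))) (at I)"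
      by (auto intro!: derivative_eq_intros)
    have dF: "((\<lambda>I. F (exp (- I))) has_real_derivative F1 ?x * - ?x) (at I)"
      by (rule DERIV_chain2[OF F1[OF x(3)] dx])
    have dF1: "((\<lambda>I. F1 (exp (- I))) has_real_derivative F2 ?x * - ?x) (at I)"
      by (rule DERIV_chain2[OF F2[OF x(3)] dx])
    show "((\<lambda>I. phi \<kappa> (exp (- I))) has_real_derivative G1 I) (at I)"
      unfolding G unfolding G_def
      by (rule DERIV_cong[OF DERIV_mult[OF dE dF]]) (simp add: G1_def algebra_simps)
    have dq: "((\<lambda>I. - a * F (exp (- I)) - exp (- I) * F1 (exp (- I))) has_real_derivative
        - a * (F1 ?x * - ?x) - (- ?x * F1 ?x + F2 ?x * - ?x * ?x)) (at I)"
      by (rule DERIV_diff[OF DERIV_cmult[OF dF] DERIV_mult[OF dx dF1]])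
    show "(G1 has_real_derivative G2 I) (at I)"
      unfolding G1_def
      by (rule DERIV_cong[OF DERIV_mult[OF dE dq]]) (simp add: G2_def algebra_simps power2_eq_square)
    let ?E = "k * exp (- (a * I))"
    have E: "?E > 0" using k by simp
    have CF: "C0 \<le> q * F ?x" using mult_left_mono[OF Fm q(1)] unfolding q(2) .
    have F1b: "\<bar>?x * F1 ?x\<bar> \<le> q * F ?x"
    proof -
      have "\<bar>?x * F1 ?x\<bar> \<le> 1 * C0" unfolding abs_mult using x b1[OF x(1,2)] by (intro mult_mono) auto
      then show ?thesis using CF by linarith
    qed
    have F2b: "\<bar>?x * ?x * F2 ?x\<bar> * min 1 I \<le> 2 * q * F ?x"
    proof -
      have "\<bar>?x * ?x * F2 ?x\<bar> \<le> 1 * \<bar>F2 ?x\<bar>"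
        unfolding abs_mult using x by (intro mult_right_mono) (auto intro: mult_le_one)
      also have "\<dots> \<le> C0 / (1 - ?x)" using b2[OF x(1,2)] by simp
      finally have "\<bar>?x * ?x * F2 ?x\<bar> * min 1 I \<le> C0 / (1 - ?x) * (2 * (1 - ?x))"
        using one_minus_exp_lower[OF I] C0 x I by (intro mult_mono) auto
      also have "\<dots> = 2 * C0"
      proof -
        have "c / d * (2 * d) = 2 * c" if "d \<noteq> 0" for c d :: real using that by simp
        moreover have "1 - ?x \<noteq> 0" using x(2) by linarith
        ultimately show ?thesis by blast
      qed
      also have "\<dots> \<le> 2 * (q * F ?x)" using CF by linarith
      finally show ?thesis by (simp only: mult.assoc)
    qed
    have Fp: "0 < F ?x" using m Fm by linarith
    have "\<bar>- a * F ?x - ?x * F1 ?x\<bar> \<le> a * F ?x + q * F ?x"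
      using F1b a Fp abs_triangle_ineq4[of "- a * F ?x" "?x * F1 ?x"] by (simp add: abs_mult)
    also have "\<dots> = (a + q) * F ?x" by (simp add: algebra_simps)
    also have "\<dots> \<le> C * F ?x"
    proof (rule mult_right_mono)
      have "0 \<le> a * q" using a q(1) by (intro mult_nonneg_nonneg) linarith+
      then show "a + q \<le> C" using q(1) zero_le_power2[of a] unfolding C_def distrib_right mult_1 mult.assoc by linarith
    qed (use Fp in simp)
    finally have "?E * \<bar>- a * F ?x - ?x * F1 ?x\<bar> \<le> ?E * (C * F ?x)" using E by (intro mult_left_mono) auto
    moreover have "\<bar>G1 I\<bar> = ?E * \<bar>- a * F ?x - ?x * F1 ?x\<bar>"
      using E unfolding G1_def abs_mult[of ?E] by (simp only: abs_of_pos)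
    moreover have "?E * (C * F ?x) = C * G I" by (simp add: G_def)
    ultimately show "\<bar>G1 I\<bar> \<le> C * phi \<kappa> (exp (- I))" by (simp only: G)
    let ?q = "a\<^sup>2 * F ?x + (2 * a + 1) * (?x * F1 ?x)" and ?r = "?x * ?x * F2 ?x"
    have mi: "0 \<le> min 1 I" "min 1 I \<le> 1" using I by auto
    have "\<bar>?q\<bar> \<le> a\<^sup>2 * F ?x + (2 * a + 1) * (q * F ?x)"
    proof -
      have "\<bar>?q\<bar> \<le> \<bar>a\<^sup>2 * F ?x\<bar> + \<bar>(2 * a + 1) * (?x * F1 ?x)\<bar>" by (rule abs_triangle_ineq)
      also have "\<bar>a\<^sup>2 * F ?x\<bar> = a\<^sup>2 * F ?x" using Fp by simp
      also have "\<bar>(2 * a + 1) * (?x * F1 ?x)\<bar> \<le> (2 * a + 1) * (q * F ?x)"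
        unfolding abs_mult[of "2 * a + 1"] using a F1b by (intro mult_mono) auto
      finally show ?thesis by simp
    qed
    moreover have "\<bar>?q\<bar> * min 1 I \<le> \<bar>?q\<bar> * 1" using mi by (intro mult_left_mono) auto
    moreover have "\<bar>?q + ?r\<bar> * min 1 I \<le> (\<bar>?q\<bar> + \<bar>?r\<bar>) * min 1 I"
      using mi by (intro mult_right_mono abs_triangle_ineq) auto
    ultimately have "\<bar>?q + ?r\<bar> * min 1 I \<le> a\<^sup>2 * F ?x + (2 * a + 1) * (q * F ?x) + 2 * q * F ?x"
      using F2b distrib_right[of "\<bar>?q\<bar>" "\<bar>?r\<bar>" "min 1 I"] by linarith
    also have "\<dots> \<le> C * F ?x"
    proof -
      have "0 \<le> a * F ?x" using a Fp by (intro mult_nonneg_nonneg) linarith+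
      then show ?thesis unfolding C_def by (simp add: algebra_simps)
    qed
    finally have "?E * (\<bar>?q + ?r\<bar> * min 1 I) \<le> ?E * (C * F ?x)" using E by (intro mult_left_mono) auto
    moreover have "\<bar>G2 I\<bar> = ?E * \<bar>?q + ?r\<bar>"
      using E unfolding G2_def abs_mult[of ?E] by (simp only: abs_of_pos)
    moreover have "?E * (C * F ?x) = C * G I" by (simp add: G_def)
    ultimately show "\<bar>G2 I\<bar> * min 1 I \<le> C * phi \<kappa> (exp (- I))" by (simp only: G mult.assoc)
  qed
qed

section \<open>Integrals with a moving end point\<close>

text \<open>
  The boundary points where \<open>D\<close> is locally a half plane form an open set, possibly with infinitely many
  components inside one interval. The kernel is continuous on this set and 0 off it.
\<close>

lemma integrable_continuous_on_open_zero_off: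
  fixes f :: "real \<Rightarrow> real"
  assumes O: "open U" and cont: "continuous_on (U \<inter> {a..b}) f"
    and off: "\<And>x. x \<in> {a..b} \<Longrightarrow> x \<notin> U \<Longrightarrow> f x = 0"
    and bd: "\<And>x. x \<in> {a..b} \<Longrightarrow> \<bar>f x\<bar> \<le> M"
  shows "f integrable_on {a..b}"
proof (rule measurable_bounded_by_integrable_imp_integrable_real)
  have "(\<lambda>x. indicator (U \<inter> {a..b}) x *\<^sub>R f x) \<in> borel_measurable borel"
    by (rule borel_measurable_continuous_on_indicator[OF _ cont]) (use O in auto)
  then have "(\<lambda>x. indicator (U \<inter> {a..b}) x *\<^sub>R f x) \<in> borel_measurable (lebesgue_on {a..b})"
    by (intro measurable_restrict_space1 borel_measurable_if_D measurable_completion) simp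
  then show "f \<in> borel_measurable (lebesgue_on {a..b})"
    by (rule measurable_cong[THEN iffD1, rotated]) (use off in \<open>auto simp: indicator_def\<close>)
  show "(\<lambda>x. M) integrable_on {a..b}" by (rule integrable_const_ivl)
qed (use bd in auto)

text \<open>
  The flag says which end moves: the left one if it is true, the right one otherwise. It allows treating the
  four choices of end points in one argument.
\<close>

definition end_interval :: "bool \<Rightarrow> real \<Rightarrow> real \<Rightarrow> real \<Rightarrow> real set" where
  "end_interval i x y t = (if i then {t..y} else {x..t})"

definition end_point :: "bool \<Rightarrow> real \<Rightarrow> real \<Rightarrow> real" where
  "end_point i x y = (if i then x else y)"

definition end_sign :: "bool \<Rightarrow> real" where
  "end_sign i = (if i then - 1 else 1)"

lemma end_interval_end_point: "end_interval i x y (end_point i x y) = {x..y}"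
  by (simp add: end_interval_def end_point_def)

lemma abs_end_sign [simp]: "\<bar>end_sign i\<bar> = 1"
  by (simp add: end_sign_def)

lemma integral_end_interval_deriv:
  assumes f: "f integrable_on {a..b}" and ab: "a \<le> x" "y \<le> b" "a < c" "c < b"
    and c: "if i then c < y else x < c" and cont: "isCont f c"
  shows "((\<lambda>t. integral (end_interval i x y t) f) has_real_derivative end_sign i * f c) (at c)"
proof -
  define P where "P = (\<lambda>t. integral {a..t} f)"
  have "(P has_vector_derivative f c) (at c within {a..b} - {})"
    unfolding P_def
    by (rule integral_has_vector_derivative_continuous_at[OF f])
       (use ab cont in \<open>auto intro: continuous_at_imp_continuous_at_within\<close>)
  moreover have "at c within {a..b} - {} = at c"
    by (rule at_within_interior) (use ab in simp)
  ultimately have P: "(P has_real_derivative f c) (at c)"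
    by (simp add: has_real_derivative_iff_has_vector_derivative)
  have comb: "integral {u..v} f = P v - P u" if "a \<le> u" "u \<le> v" "v \<le> b" for u v
  proof -
    have "f integrable_on {a..v}" by (rule integrable_subinterval_real[OF f]) (use that in auto)
    then have "integral {a..u} f + integral {u..v} f = integral {a..v} f"
      by (rule Henstock_Kurzweil_Integration.integral_combine[OF that(1,2)])
    then show ?thesis unfolding P_def by linarith
  qed
  show ?thesis
  proof (cases i)
    case True
    have ev: "\<forall>\<^sub>F t in nhds c. t \<in> {a<..<y}"
      by (rule eventually_nhds_in_open) (use ab c True in auto)
    have "((\<lambda>t. integral (end_interval i x y t) f) has_real_derivative 0 - f c) (at c)"
    proof (rule DERIV_eventually_eq[OF DERIV_diff[OF DERIV_const P]])
      show "\<forall>\<^sub>F t in nhds c. integral (end_interval i x y t) f = P y - P t"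
        using ev by eventually_elim (use comb ab True in \<open>auto simp: end_interval_def\<close>)
    qed
    then show ?thesis using True by (simp add: end_sign_def)
  next
    case False
    have ev: "\<forall>\<^sub>F t in nhds c. t \<in> {x<..<b}"
      by (rule eventually_nhds_in_open) (use ab c False in auto)
    have "((\<lambda>t. integral (end_interval i x y t) f) has_real_derivative f c - 0) (at c)"
    proof (rule DERIV_eventually_eq[OF DERIV_diff[OF P DERIV_const]])
      show "\<forall>\<^sub>F t in nhds c. integral (end_interval i x y t) f = P t - P x"
        using ev by eventually_elim (use comb ab False in \<open>auto simp: end_interval_def\<close>)
    qed
    then show ?thesis using False by (simp add: end_sign_def)
  qed
qed

text \<open>
  A quadratic error can be integrated over a parameter, and so gives differentiation under the integral.
\<close>

lemma DERIV_of_quadratic_error: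
  fixes T :: "real \<Rightarrow> real"
  assumes \<eta>: "0 < \<eta>" and bd: "\<And>u. \<bar>u - z\<bar> < \<eta> \<Longrightarrow> \<bar>T u - T z - (u - z) * d\<bar> \<le> M * \<bar>u - z\<bar>\<^sup>2"
  shows "(T has_real_derivative d) (at z)"
  unfolding DERIV_def
proof (rule LIM_I)
  fix r :: real assume r: "r > 0"
  show "\<exists>s>0. \<forall>h. h \<noteq> 0 \<and> norm (h - 0) < s \<longrightarrow> norm ((T (z + h) - T z) / h - d) < r"
  proof (intro exI[of _ "min \<eta> (r / (\<bar>M\<bar> + 1))"] conjI allI impI)
    show "0 < min \<eta> (r / (\<bar>M\<bar> + 1))" using \<eta> r by simp
    fix h :: real assume h: "h \<noteq> 0 \<and> norm (h - 0) < min \<eta> (r / (\<bar>M\<bar> + 1))"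
    have "\<bar>T (z + h) - T z - h * d\<bar> \<le> M * \<bar>h\<bar>\<^sup>2" using bd[of "z + h"] h by simp
    also have "\<dots> \<le> (\<bar>M\<bar> + 1) * \<bar>h\<bar>\<^sup>2" by (intro mult_right_mono) auto
    finally have 1: "\<bar>T (z + h) - T z - h * d\<bar> / \<bar>h\<bar> \<le> (\<bar>M\<bar> + 1) * \<bar>h\<bar>"
      using h by (simp add: pos_divide_le_eq power2_eq_square mult.assoc)
    have "\<bar>h\<bar> < r / (\<bar>M\<bar> + 1)" using h by simp
    then have 2: "(\<bar>M\<bar> + 1) * \<bar>h\<bar> < r" by (simp add: pos_less_divide_eq mult.commute)
    have "(T (z + h) - T z) / h - d = (T (z + h) - T z - h * d) / h" using h by (simp add: diff_divide_distrib)
    then show "norm ((T (z + h) - T z) / h - d) < r" using 1 2 by (simp add: abs_divide)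
  qed
qed

lemma integral_ge_near_end:
  fixes f :: "real \<Rightarrow> real"
  assumes f: "f integrable_on {x..y}" and pos: "\<And>t. t \<in> {x..y} \<Longrightarrow> 0 \<le> f t"
    and w: "0 \<le> w" "w \<le> y - x"
    and m: "\<And>t. \<bar>t - end_point i x y\<bar> \<le> w \<Longrightarrow> m \<le> f t"
  shows "w * m \<le> integral {x..y} f"
proof -
  define l where "l = (if i then x else y - w)"
  have sub: "{l..l + w} \<subseteq> {x..y}" using w by (auto simp: l_def)
  have fl: "f integrable_on {l..l + w}" by (rule integrable_subinterval_real[OF f sub])
  have "integral {l..l + w} (\<lambda>t. m) \<le> integral {l..l + w} f"
  proof (rule integral_le[OF integrable_const_ivl fl])
    show "m \<le> f t" if "t \<in> {l..l + w}" for t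
      by (rule m) (use that in \<open>auto simp: l_def end_point_def split: if_splits\<close>)
  qed
  moreover have "integral {l..l + w} (\<lambda>t. m) = w * m" using w by simp
  moreover have "integral {l..l + w} f \<le> integral {x..y} f"
    by (rule integral_subset_le[OF sub fl f]) (use pos in blast)
  ultimately show ?thesis by linarith
qed

lemma integral_inverse_square_bound:
  fixes a b c R :: real and f :: "real \<Rightarrow> real"
  assumes ab: "a \<le> b" and R: "0 < R" and c: "c + R \<le> a \<or> b + R \<le> c"
    and f: "f integrable_on {a..b}" and bd: "\<And>s. s \<in> {a..b} \<Longrightarrow> f s \<le> 1 / (s - c)\<^sup>2"
  shows "integral {a..b} f \<le> 1 / R"
proof -
  have ne: "s \<noteq> c" if "s \<in> {a..b}" for s
  proof
    assume "s = c"
    then have "a \<le> c" "c \<le> b" using that by auto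
    then have "\<not> c + R \<le> a" "\<not> b + R \<le> c" using R by linarith+
    with c show False by blast
  qed
  have "((\<lambda>s. 1 / (s - c)\<^sup>2) has_integral (- 1 / (b - c) - (- 1 / (a - c)))) {a..b}"
  proof (rule fundamental_theorem_of_calculus[OF ab])
    fix s assume "s \<in> {a..b}"
    then have "s - c \<noteq> 0" using ne by simp
    then have "((\<lambda>s. - 1 / (s - c)) has_real_derivative 1 / (s - c)\<^sup>2) (at s within {a..b})"
      by (auto intro!: derivative_eq_intros simp: power2_eq_square)
    then show "((\<lambda>s. - 1 / (s - c)) has_vector_derivative 1 / (s - c)\<^sup>2) (at s within {a..b})"
      by (simp add: has_real_derivative_iff_has_vector_derivative)
  qed
  then have "integral {a..b} f \<le> - 1 / (b - c) - (- 1 / (a - c))"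
    by (rule has_integral_le[OF integrable_integral[OF f] _ bd])
  also have "\<dots> \<le> 1 / R"
    using c
  proof
    assume h: "c + R \<le> a"
    have "1 / (a - c) \<le> 1 / R" using h R by (intro divide_left_mono) auto
    moreover have "0 \<le> 1 / (b - c)" using h R ab by simp
    ultimately show ?thesis unfolding minus_divide_left[symmetric] by linarith
  next
    assume h: "b + R \<le> c"
    have "1 / (c - b) \<le> 1 / R" using h R by (intro divide_left_mono) auto
    moreover have "0 \<le> 1 / (c - a)" using h R ab by simp
    moreover have "- 1 / (b - c) = 1 / (c - b)" "- 1 / (a - c) = 1 / (c - a)"
      by (simp_all add: minus_divide_right)
    ultimately show ?thesis by linarith
  qed
  finally show ?thesis .
qed

section \<open>Integrals of the kernel\<close>

context half_plane_domain
begin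

text \<open>
  The bounds hold for all \<open>y\<close> at distance at least \<open>R\<close> with the same constants, also where the kernel
  vanishes identically. This uniformity is what the integrals over \<open>y\<close> use.
\<close>

lemma H_log_lipschitz:
  assumes x: "half_disc x R \<subseteq> D" "0 < R" and y: "R \<le> \<bar>x - y\<bar>" and t: "\<bar>t - x\<bar> < R / 2"
  obtains d where "((\<lambda>t. H t y) has_real_derivative d) (at t)" "\<bar>d\<bar> \<le> 16 / R * H t y" "\<bar>d\<bar> \<le> 64 / R ^ 3"
proof -
  have Hle: "H t y \<le> 4 / R\<^sup>2"
  proof -
    have ty: "R / 2 \<le> \<bar>t - y\<bar>" using y t by linarith
    then have ne: "t \<noteq> y" using x(2) by auto
    have "(R / 2)\<^sup>2 \<le> \<bar>t - y\<bar>\<^sup>2" using ty x(2) by (intro power_mono) auto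
    then have sq: "(R / 2)\<^sup>2 \<le> (t - y)\<^sup>2" by simp
    have "1 / (t - y)\<^sup>2 \<le> 1 / (R / 2)\<^sup>2" by (rule divide_left_mono[OF sq]) (use x(2) ne in auto)
    also have "\<dots> = 4 / R\<^sup>2" by (simp add: power_divide)
    finally show ?thesis using H_le[OF ne] by linarith
  qed
  have le3: "\<bar>d\<bar> \<le> 64 / R ^ 3" if "\<bar>d\<bar> \<le> 16 / R * H t y" for d
  proof -
    have "16 / R * H t y \<le> 16 / R * (4 / R\<^sup>2)" using Hle x(2) by (intro mult_left_mono) auto
    also have "\<dots> = 64 / R ^ 3" by (simp add: power2_eq_square power3_eq_cube)
    finally show ?thesis using that by linarith
  qed
  show ?thesis
  proof (cases "real_analytic_boundary_point D y")
    case True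
    have "half_disc t (R / 2) \<subseteq> half_disc t (R - \<bar>t - x\<bar>)" using t by auto
    then have sub: "half_disc t (R / 2) \<subseteq> D"
      using real_analytic_boundary_point_nhd(2)[OF x(1), of t] t x(2) by auto
    have r: "0 < R / 2" using x(2) by simp
    have r2: "R / 2 \<le> \<bar>t - y\<bar>" using t y by linarith
    obtain h1 h2 where h: "\<And>u. \<bar>u - t\<bar> < R / 2 / 2 \<Longrightarrow> ((\<lambda>t. H t y) has_real_derivative h1 u) (at u)"
      "(h1 has_real_derivative h2) (at t)" "\<bar>h1 t\<bar> \<le> 8 / (R / 2) * H t y" "\<bar>h2\<bar> \<le> 72 / (R / 2)\<^sup>2 * H t y"
      by (rule H_derivs[OF sub r True r2]) (rule that)
    have b: "\<bar>h1 t\<bar> \<le> 16 / R * H t y" using h(3) by simp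
    show ?thesis by (rule that[OF h(1) b le3[OF b]]) (use r in simp)
  next
    case False
    have "H u y = 0" for u by (rule H_eq_0) (use False in simp)
    then have z: "(\<lambda>t. H t y) = (\<lambda>t. 0)" by (rule ext)
    show ?thesis
      by (rule that[of 0]) (use z x(2) H_nonneg[of t y] in auto)
  qed
qed

lemma H_lipschitz:
  assumes x: "half_disc x R \<subseteq> D" "0 < R" and y: "R \<le> \<bar>x - y\<bar>"
    and t: "\<bar>t - x\<bar> < R / 2" and u: "\<bar>u - x\<bar> < R / 2"
  shows "\<bar>H t y - H u y\<bar> \<le> 64 / R ^ 3 * \<bar>t - u\<bar>"
proof -
  let ?S = "{x - R / 2<..<x + R / 2}"
  have S: "s \<in> ?S \<longleftrightarrow> \<bar>s - x\<bar> < R / 2" for s by (simp only: greaterThanLessThan_iff abs_less_iff) linarith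
  have "\<exists>d. ((\<lambda>t. H t y) has_real_derivative d) (at s) \<and> \<bar>d\<bar> \<le> 64 / R ^ 3" if "s \<in> ?S" for s
  proof -
    have s: "\<bar>s - x\<bar> < R / 2" using that S by blast
    show ?thesis by (rule H_log_lipschitz[OF x y s]) blast
  qed
  then obtain f' where f': "\<And>s. s \<in> ?S \<Longrightarrow> ((\<lambda>t. H t y) has_real_derivative f' s) (at s) \<and> \<bar>f' s\<bar> \<le> 64 / R ^ 3"
    by metis
  have "norm (H t y - H u y) \<le> 64 / R ^ 3 * norm (t - u)"
  proof (rule field_differentiable_bound[where S = ?S and f' = f'])
    show "((\<lambda>t. H t y) has_real_derivative f' s) (at s within ?S)" if "s \<in> ?S" for s
      using f'[OF that] by (rule has_field_derivative_at_within[OF conjunct1])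
    show "norm (f' s) \<le> 64 / R ^ 3" if "s \<in> ?S" for s using f'[OF that] by simp
  qed (use t u S in auto)
  then show ?thesis by simp
qed

text \<open>
  Since the logarithmic derivative is at most \<open>16/R\<close>, the products of the kernel with \<open>exp (16 s / R)\<close> and
  \<open>exp (- 16 s / R)\<close> are monotone in \<open>s\<close>; over the distance \<open>R/4\<close> the exponential changes by at most \<open>exp 4\<close>.
\<close>

lemma H_harnack:
  assumes x: "half_disc x R \<subseteq> D" "0 < R" and y: "R \<le> \<bar>x - y\<bar>" and t: "\<bar>t - x\<bar> \<le> R / 4"
  shows "exp (- 4) * H x y \<le> H t y"
proof -
  have deriv: "\<exists>d. ((\<lambda>s. H s y * exp (k * s)) has_real_derivative d * exp (k * s) + k * exp (k * s) * H s y) (at s) \<and> \<bar>d\<bar> \<le> 16 / R * H s y"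
    if s: "\<bar>s - x\<bar> \<le> R / 4" for s k
  proof -
    have s2: "\<bar>s - x\<bar> < R / 2" using s x(2) by linarith
    obtain d where d: "((\<lambda>t. H t y) has_real_derivative d) (at s)" "\<bar>d\<bar> \<le> 16 / R * H s y" "\<bar>d\<bar> \<le> 64 / R ^ 3"
      by (rule H_log_lipschitz[OF x y s2]) (rule that)
    have "((\<lambda>s. exp (k * s)) has_real_derivative k * exp (k * s)) (at s)"
      by (auto intro!: derivative_eq_intros)
    from DERIV_mult[OF d(1) this] d(2) show ?thesis by blast
  qed
  have e: "exp (- 4) * H x y \<le> H t y" if "H x y \<le> H t y * exp (16 / R * \<bar>t - x\<bar>)"
  proof -
    have "16 / R * \<bar>t - x\<bar> \<le> 16 / R * (R / 4)" using t x(2) by (intro mult_left_mono) auto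
    then have "exp (16 / R * \<bar>t - x\<bar>) \<le> exp 4" using x(2) by simp
    then have "H t y * exp (16 / R * \<bar>t - x\<bar>) \<le> H t y * exp 4" by (intro mult_left_mono H_nonneg)
    then have "exp (- 4) * H x y \<le> exp (- 4) * (H t y * exp 4)" using that by (intro mult_left_mono) auto
    also have "\<dots> = H t y" by (simp add: mult_exp_exp mult.left_commute)
    finally show ?thesis .
  qed
  show ?thesis
  proof (cases "x \<le> t")
    case True
    have "H x y * exp (16 / R * x) \<le> H t y * exp (16 / R * t)"
    proof (rule DERIV_nonneg_imp_nondecreasing[OF True])
      fix s assume s: "x \<le> s" "s \<le> t"
      then have "\<bar>s - x\<bar> \<le> R / 4" using t by linarith
      from deriv[OF this, of "16 / R"] obtain d where
        d: "((\<lambda>s. H s y * exp (16 / R * s)) has_real_derivative d * exp (16 / R * s) + 16 / R * exp (16 / R * s) * H s y) (at s)" "\<bar>d\<bar> \<le> 16 / R * H s y"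
        by blast
      have "0 \<le> (d + 16 / R * H s y) * exp (16 / R * s)" using d(2) by (intro mult_nonneg_nonneg) auto
      then show "\<exists>D. ((\<lambda>s. H s y * exp (16 / R * s)) has_real_derivative D) (at s) \<and> 0 \<le> D"
        using d(1) by (intro exI[of _ "d * exp (16 / R * s) + 16 / R * exp (16 / R * s) * H s y"]) (simp add: algebra_simps)
    qed
    then have "H x y * exp (16 / R * x) * exp (- (16 / R * x)) \<le> H t y * exp (16 / R * t) * exp (- (16 / R * x))"
      by (rule mult_right_mono) simp
    moreover have "exp (16 / R * x) * exp (- (16 / R * x)) = 1" by (simp add: mult_exp_exp)
    moreover have "exp (16 / R * t) * exp (- (16 / R * x)) = exp (16 / R * \<bar>t - x\<bar>)"
      using True by (simp add: mult_exp_exp right_diff_distrib diff_divide_distrib)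
    ultimately show ?thesis by (intro e) (simp only: mult.assoc mult_1_right)
  next
    case False
    then have tx: "t \<le> x" by simp
    have "H t y * exp (- (16 / R) * t) \<ge> H x y * exp (- (16 / R) * x)"
    proof (rule DERIV_nonpos_imp_nonincreasing[OF tx])
      fix s assume s: "t \<le> s" "s \<le> x"
      then have "\<bar>s - x\<bar> \<le> R / 4" using t by linarith
      from deriv[OF this, of "- (16 / R)"] obtain d where
        d: "((\<lambda>s. H s y * exp (- (16 / R) * s)) has_real_derivative d * exp (- (16 / R) * s) + - (16 / R) * exp (- (16 / R) * s) * H s y) (at s)" "\<bar>d\<bar> \<le> 16 / R * H s y"
        by blast
      have "(d - 16 / R * H s y) * exp (- (16 / R) * s) \<le> 0" using d(2) by (intro mult_nonpos_nonneg) auto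
      then show "\<exists>D. ((\<lambda>s. H s y * exp (- (16 / R) * s)) has_real_derivative D) (at s) \<and> D \<le> 0"
        using d(1) by (intro exI[of _ "d * exp (- (16 / R) * s) + - (16 / R) * exp (- (16 / R) * s) * H s y"]) (simp add: algebra_simps)
    qed
    then have "H x y * exp (- (16 / R) * x) * exp (16 / R * x) \<le> H t y * exp (- (16 / R) * t) * exp (16 / R * x)"
      by (rule mult_right_mono) simp
    moreover have "exp (- (16 / R) * x) * exp (16 / R * x) = 1" by (simp add: mult_exp_exp)
    moreover have "exp (- (16 / R) * t) * exp (16 / R * x) = exp (16 / R * \<bar>t - x\<bar>)"
      using tx by (simp add: mult_exp_exp right_diff_distrib diff_divide_distrib)
    ultimately show ?thesis by (intro e) (simp only: mult.assoc mult_1_right)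
  qed
qed

lemma open_real_analytic_boundary_points: "open {s. real_analytic_boundary_point D s}"
  unfolding open_dist
proof (rule ballI)
  fix s assume "s \<in> {s. real_analytic_boundary_point D s}"
  then obtain R where "R > 0" "half_disc s R \<subseteq> D" unfolding real_analytic_boundary_point_def by blast
  then show "\<exists>e>0. \<forall>t. dist t s < e \<longrightarrow> t \<in> {s. real_analytic_boundary_point D s}"
    using real_analytic_boundary_point_nhd(1)[of s R] by (auto simp: dist_real_def)
qed

lemma H_bound_gap:
  assumes "0 < g" "g \<le> \<bar>r - s\<bar>"
  shows "H r s \<le> 1 / g\<^sup>2"
proof -
  have ne: "r \<noteq> s" using assms by auto
  have "g\<^sup>2 \<le> \<bar>r - s\<bar>\<^sup>2" using assms by (intro power_mono) auto
  then have sq: "g\<^sup>2 \<le> (r - s)\<^sup>2" by simp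
  have "1 / (r - s)\<^sup>2 \<le> 1 / g\<^sup>2" by (rule divide_left_mono[OF sq]) (use assms ne in auto)
  then show ?thesis using H_le[OF ne] by linarith
qed

lemma H_isCont:
  assumes s: "real_analytic_boundary_point D s" and rs: "s \<noteq> r"
  shows "isCont (\<lambda>s. H s r) s"
proof -
  obtain R0 where R0: "R0 > 0" "half_disc s R0 \<subseteq> D" using s unfolding real_analytic_boundary_point_def by blast
  define R where "R = min R0 \<bar>s - r\<bar>"
  have R: "half_disc s R \<subseteq> D" "R > 0" "R \<le> \<bar>s - r\<bar>" "\<bar>s - s\<bar> < R / 2" using R0 rs by (auto simp: R_def)
  obtain d where d: "((\<lambda>t. H t r) has_real_derivative d) (at s)"
    by (rule H_log_lipschitz[OF R])
  then show ?thesis by (rule DERIV_isCont)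
qed

lemma H_integrable:
  assumes g: "0 < g" "\<And>s. s \<in> {c..d} \<Longrightarrow> g \<le> \<bar>r - s\<bar>"
  shows "(\<lambda>s. H r s) integrable_on {c..d}"
proof (rule integrable_continuous_on_open_zero_off[OF open_real_analytic_boundary_points])
  show "continuous_on ({s. real_analytic_boundary_point D s} \<inter> {c..d}) (\<lambda>s. H r s)"
  proof (rule continuous_at_imp_continuous_on, rule ballI)
    fix s assume s: "s \<in> {s. real_analytic_boundary_point D s} \<inter> {c..d}"
    then have "s \<noteq> r" using g(2)[of s] g(1) by auto
    then show "isCont (\<lambda>s. H r s) s"
      using H_isCont[of s r] s by (simp add: boundary_poisson_commute[of D r])
  qed
  show "H r s = 0" if "s \<notin> {s. real_analytic_boundary_point D s}" for s
    by (rule H_eq_0) (use that in simp)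
  show "\<bar>H r s\<bar> \<le> 1 / g\<^sup>2" if "s \<in> {c..d}" for s
    using H_bound_gap[OF g(1) g(2)[OF that]] H_nonneg[of r s] by simp
qed

lemma H_integral_isCont:
  assumes x: "half_disc x R \<subseteq> D" "0 < R" and gap: "\<And>s. s \<in> {c..d} \<Longrightarrow> R \<le> \<bar>x - s\<bar>" and cd: "c \<le> d"
  shows "isCont (\<lambda>r. integral {c..d} (\<lambda>s. H r s)) x"
proof -
  let ?q = "\<lambda>r. integral {c..d} (\<lambda>s. H r s)"
  have int: "(\<lambda>s. H t s) integrable_on {c..d}" if "\<bar>t - x\<bar> < R / 2" for t
  proof (rule H_integrable[of "R / 2"])
    show "R / 2 \<le> \<bar>t - s\<bar>" if "s \<in> {c..d}" for s using gap[OF that] \<open>\<bar>t - x\<bar> < R / 2\<close> by linarith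
  qed (use x in simp)
  have lip: "\<bar>?q t - ?q x\<bar> \<le> 64 / R ^ 3 * \<bar>t - x\<bar> * (d - c)" if t: "\<bar>t - x\<bar> < R / 2" for t
  proof -
    have xx: "\<bar>x - x\<bar> < R / 2" using x by simp
    have "?q t - ?q x = integral {c..d} (\<lambda>s. H t s - H x s)"
      by (rule integral_diff[OF int[OF t] int[OF xx], symmetric])
    also have "norm \<dots> \<le> integral {c..d} (\<lambda>s. 64 / R ^ 3 * \<bar>t - x\<bar>)"
      by (rule integral_norm_bound_integral[OF integrable_diff[OF int[OF t] int[OF xx]] integrable_const_ivl])
         (use H_lipschitz[OF x gap t xx] in simp)
    finally show ?thesis using cd by (simp add: algebra_simps)
  qed
  have "(?q \<longlongrightarrow> ?q x) (at x)"
  proof (rule Lim_null[THEN iffD2], rule Lim_null_comparison)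
    show "\<forall>\<^sub>F t in at x. norm (?q t - ?q x) \<le> 64 / R ^ 3 * \<bar>t - x\<bar> * (d - c)"
      unfolding eventually_at
    proof (intro exI[of _ "R / 2"] conjI ballI impI)
      fix t assume "t \<noteq> x \<and> dist t x < R / 2"
      then show "norm (?q t - ?q x) \<le> 64 / R ^ 3 * \<bar>t - x\<bar> * (d - c)"
        using lip[of t] by (simp add: dist_real_def)
    qed (use x in simp)
    show "((\<lambda>t. 64 / R ^ 3 * \<bar>t - x\<bar> * (d - c)) \<longlongrightarrow> 0) (at x)"
      using x(2) by (auto intro!: tendsto_eq_intros)
  qed
  then show ?thesis by (simp add: isCont_def)
qed

lemma H_integral_integrable:
  assumes g: "0 < g" "\<And>r s. r \<in> {a..b} \<Longrightarrow> s \<in> {c..d} \<Longrightarrow> g \<le> \<bar>r - s\<bar>" and cd: "c \<le> d"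
  shows "(\<lambda>r. integral {c..d} (\<lambda>s. H r s)) integrable_on {a..b}"
proof (rule integrable_continuous_on_open_zero_off[OF open_real_analytic_boundary_points])
  show "continuous_on ({s. real_analytic_boundary_point D s} \<inter> {a..b}) (\<lambda>r. integral {c..d} (\<lambda>s. H r s))"
  proof (rule continuous_at_imp_continuous_on, rule ballI)
    fix r assume r: "r \<in> {s. real_analytic_boundary_point D s} \<inter> {a..b}"
    then obtain R0 where R0: "R0 > 0" "half_disc r R0 \<subseteq> D" unfolding real_analytic_boundary_point_def by blast
    have R: "half_disc r (min R0 g) \<subseteq> D" "0 < min R0 g" using R0 g by auto
    have "min R0 g \<le> \<bar>r - s\<bar>" if "s \<in> {c..d}" for s
      using g(2)[OF _ that, of r] r by (simp add: min.coboundedI2)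
    then show "isCont (\<lambda>r. integral {c..d} (\<lambda>s. H r s)) r"
      by (rule H_integral_isCont[OF R _ cd])
  qed
  show "integral {c..d} (\<lambda>s. H r s) = 0" if "r \<notin> {s. real_analytic_boundary_point D s}" for r
  proof -
    have "H r s = 0" for s by (rule H_eq_0) (use that in simp)
    then show ?thesis by simp
  qed
  show "\<bar>integral {c..d} (\<lambda>s. H r s)\<bar> \<le> (d - c) * (1 / g\<^sup>2)" if r: "r \<in> {a..b}" for r
  proof -
    have "norm (integral {c..d} (\<lambda>s. H r s)) \<le> integral {c..d} (\<lambda>s. 1 / g\<^sup>2)"
    proof (rule integral_norm_bound_integral[OF _ integrable_const_ivl])
      show "(\<lambda>s. H r s) integrable_on {c..d}" by (rule H_integrable[OF g(1) g(2)[OF r]])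
      show "norm (H r s) \<le> 1 / g\<^sup>2" if "s \<in> {c..d}" for s
        using H_bound_gap[OF g(1) g(2)[OF r that]] H_nonneg[of r s] by simp
    qed
    then show ?thesis using cd by simp
  qed
qed

end

section \<open>The double integral of the kernel and the partition function\<close>

locale two_intervals = half_plane_domain +
  fixes x1 y1 x2 y2 R :: real
  assumes R: "0 < R"
    and discs: "half_disc x1 R \<subseteq> D" "half_disc y1 R \<subseteq> D" "half_disc x2 R \<subseteq> D" "half_disc y2 R \<subseteq> D"
    and gaps: "R \<le> y1 - x1" "R \<le> x2 - y1" "R \<le> y2 - x2"
begin

definition z1 :: "bool \<Rightarrow> real" where "z1 i = end_point i x1 y1"
definition z2 :: "bool \<Rightarrow> real" where "z2 j = end_point j x2 y2"

definition double_integral :: "bool \<Rightarrow> bool \<Rightarrow> real \<Rightarrow> real \<Rightarrow> real" where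
  "double_integral i j t u = integral (end_interval i x1 y1 t) (\<lambda>r. integral (end_interval j x2 y2 u) (\<lambda>s. H r s))"

definition inner_integral :: "real \<Rightarrow> real" where "inner_integral r = integral {x2..y2} (\<lambda>s. H r s)"

text \<open>
  The derivative of the double integral in the end point of the second interval (double_integral_deriv2).
\<close>

definition inner_derivative :: "bool \<Rightarrow> bool \<Rightarrow> real \<Rightarrow> real" where
  "inner_derivative i j t = end_sign j * integral (end_interval i x1 y1 t) (\<lambda>r. H r (z2 j))"

lemma z1_disc: "half_disc (z1 i) R \<subseteq> D" and z2_disc: "half_disc (z2 j) R \<subseteq> D"
  using discs by (auto simp: z1_def z2_def end_point_def)

lemma z1_in: "z1 i \<in> {x1..y1}" and z2_in: "z2 j \<in> {x2..y2}"
  using gaps R by (auto simp: z1_def z2_def end_point_def)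

lemma gap12: "r \<in> {x1..y1} \<Longrightarrow> s \<in> {x2..y2} \<Longrightarrow> R \<le> \<bar>r - s\<bar>"
  using gaps unfolding atLeastAtMost_iff by linarith

lemma gap12': "r \<in> {x1 - R / 4..y1 + R / 4} \<Longrightarrow> s \<in> {x2 - R / 4..y2 + R / 4} \<Longrightarrow> R / 2 \<le> \<bar>r - s\<bar>"
  using gaps R unfolding atLeastAtMost_iff by linarith

lemma half_R: "0 < R / 2" and half_disc_half: "half_disc x (R / 2) \<subseteq> half_disc x R"
  using R by auto

lemma end_interval1:
  assumes "\<bar>t - z1 i\<bar> < R / 4"
  obtains k l where "end_interval i x1 y1 t = {k..l}" "k \<le> l" "{k..l} \<subseteq> {x1 - R / 4..y1 + R / 4}"
proof (cases i)
  case True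
  have "z1 i = x1" using True by (simp add: z1_def end_point_def)
  then have "t \<le> y1" "x1 - R / 4 \<le> t" using assms[unfolded abs_less_iff] gaps R by linarith+
  then show ?thesis using that[of t y1] True R by (auto simp: end_interval_def)
next
  case False
  have "z1 i = y1" using False by (simp add: z1_def end_point_def)
  then have "x1 \<le> t" "t \<le> y1 + R / 4" using assms[unfolded abs_less_iff] gaps R by linarith+
  then show ?thesis using that[of x1 t] False R by (auto simp: end_interval_def)
qed

lemma end_interval2:
  assumes "\<bar>u - z2 j\<bar> < R / 4"
  obtains k l where "end_interval j x2 y2 u = {k..l}" "k \<le> l" "{k..l} \<subseteq> {x2 - R / 4..y2 + R / 4}"
proof (cases j)
  case True
  have "z2 j = x2" using True by (simp add: z2_def end_point_def)
  then have "u \<le> y2" "x2 - R / 4 \<le> u" using assms[unfolded abs_less_iff] gaps R by linarith+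
  then show ?thesis using that[of u y2] True R by (auto simp: end_interval_def)
next
  case False
  have "z2 j = y2" using False by (simp add: z2_def end_point_def)
  then have "x2 \<le> u" "u \<le> y2 + R / 4" using assms[unfolded abs_less_iff] gaps R by linarith+
  then show ?thesis using that[of x2 u] False R by (auto simp: end_interval_def)
qed

lemma inner_integral_isCont: "isCont inner_integral (z1 i)"
  unfolding inner_integral_def
  by (rule H_integral_isCont[OF z1_disc R gap12[OF z1_in]]) (use gaps R in auto)

lemma inner_integral_integrable: "inner_integral integrable_on {x1 - R / 4..y1 + R / 4}"
  unfolding inner_integral_def
proof (rule H_integral_integrable[OF half_R])
  show "R / 2 \<le> \<bar>r - s\<bar>" if "r \<in> {x1 - R / 4..y1 + R / 4}" "s \<in> {x2..y2}" for r s
    by (rule gap12'[OF that(1)]) (use that(2) R in auto)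
qed (use gaps R in auto)

lemma double_integral_deriv1:
  "((\<lambda>t. double_integral i j t (z2 j)) has_real_derivative end_sign i * inner_integral (z1 i)) (at (z1 i))"
proof -
  have "(\<lambda>t. double_integral i j t (z2 j)) = (\<lambda>t. integral (end_interval i x1 y1 t) inner_integral)"
    unfolding double_integral_def z2_def end_interval_end_point inner_integral_def ..
  moreover have "((\<lambda>t. integral (end_interval i x1 y1 t) inner_integral) has_real_derivative end_sign i * inner_integral (z1 i)) (at (z1 i))"
    by (rule integral_end_interval_deriv[OF inner_integral_integrable _ _ _ _ _ inner_integral_isCont])
       (use gaps R in \<open>auto simp: z1_def end_point_def\<close>)
  ultimately show ?thesis by simp
qed

lemma H_z2_integrable: "(\<lambda>r. H r (z2 j)) integrable_on {x1 - R / 4..y1 + R / 4}"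
proof -
  have "(\<lambda>r. H (z2 j) r) integrable_on {x1 - R / 4..y1 + R / 4}"
  proof (rule H_integrable[OF half_R])
    show "R / 2 \<le> \<bar>z2 j - r\<bar>" if "r \<in> {x1 - R / 4..y1 + R / 4}" for r
      using gap12'[OF that, of "z2 j"] z2_in[of j] R by (auto simp: abs_minus_commute)
  qed
  then show ?thesis by (simp only: boundary_poisson_commute[of D "z2 j"])
qed

lemma inner_derivative_deriv: "(inner_derivative i j has_real_derivative end_sign j * (end_sign i * H (z1 i) (z2 j))) (at (z1 i))"
proof -
  have c: "isCont (\<lambda>r. H r (z2 j)) (z1 i)"
  proof (rule H_isCont)
    show "real_analytic_boundary_point D (z1 i)"
      unfolding real_analytic_boundary_point_def using z1_disc[of i] R by blast
    show "z1 i \<noteq> z2 j" using gap12[OF z1_in[of i] z2_in[of j]] R by auto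
  qed
  have "((\<lambda>t. integral (end_interval i x1 y1 t) (\<lambda>r. H r (z2 j))) has_real_derivative end_sign i * H (z1 i) (z2 j)) (at (z1 i))"
    by (rule integral_end_interval_deriv[OF H_z2_integrable _ _ _ _ _ c])
       (use gaps R in \<open>auto simp: z1_def end_point_def\<close>)
  from DERIV_cmult[OF this] show ?thesis unfolding inner_derivative_def .
qed

text \<open>
  By the Lipschitz bound for the kernel near the end point, uniform in the outer variable \<open>r\<close>, the inner
  integral differs from its linear approximation by a quadratic error. Integrating this error over \<open>r\<close>
  gives the derivative of the double integral.
\<close>

lemma double_integral_deriv2:
  assumes t: "\<bar>t - z1 i\<bar> < R / 4"
  shows "(double_integral i j t has_real_derivative inner_derivative i j t) (at (z2 j))"
proof -
  let ?z = "z2 j" and ?s = "end_sign j"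
  define L where "L = 64 / (R / 2) ^ 3"
  have L: "L \<ge> 0" using R by (simp add: L_def)
  obtain k l where K: "end_interval i x1 y1 t = {k..l}" "k \<le> l" "{k..l} \<subseteq> {x1 - R / 4..y1 + R / 4}"
    by (rule end_interval1[OF t]) (rule that)
  define S where "S = (\<lambda>u r. integral (end_interval j x2 y2 u) (\<lambda>s. H r s))"
  have zd: "half_disc ?z (R / 2) \<subseteq> D" using half_disc_half z2_disc[of j] by blast
  have zA: "?z \<in> {x2 - R / 4..y2 + R / 4}" using z2_in[of j] R by auto
  have zz: "\<bar>?z - ?z\<bar> < R / 4" using R by simp
  have near: "\<bar>H r u - H r w\<bar> \<le> L * \<bar>u - w\<bar>"
    if r: "r \<in> {k..l}" and "\<bar>u - ?z\<bar> < R / 4" "\<bar>w - ?z\<bar> < R / 4" for r u w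
  proof -
    have g: "R / 2 \<le> \<bar>?z - r\<bar>" using gap12'[OF _ zA, of r] r K(3) by (auto simp: abs_minus_commute)
    have "\<bar>H u r - H w r\<bar> \<le> 64 / (R / 2) ^ 3 * \<bar>u - w\<bar>"
      by (rule H_lipschitz[OF zd half_R g]) (use that in auto)
    then show ?thesis by (simp only: L_def boundary_poisson_commute[of D r])
  qed
  have Sint: "S u integrable_on {k..l}" if u: "\<bar>u - ?z\<bar> < R / 4" for u
  proof -
    obtain c d where c: "end_interval j x2 y2 u = {c..d}" "c \<le> d" "{c..d} \<subseteq> {x2 - R / 4..y2 + R / 4}"
      by (rule end_interval2[OF u]) (rule that)
    show ?thesis unfolding S_def c(1)
      by (rule H_integral_integrable[OF half_R gap12' c(2)]) (use K(3) c(3) in blast)+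
  qed
  have Hint: "(\<lambda>r. H r ?z) integrable_on {k..l}" by (rule integrable_subinterval_real[OF H_z2_integrable K(3)])
  have pt: "\<bar>S u r - S ?z r - (u - ?z) * (?s * H r ?z)\<bar> \<le> L * \<bar>u - ?z\<bar>\<^sup>2"
    if r: "r \<in> {k..l}" and u: "\<bar>u - ?z\<bar> < R / 4" for u r
  proof -
    let ?f = "\<lambda>w. S w r - w * (?s * H r ?z)" and ?f' = "\<lambda>w. ?s * H r w - ?s * H r ?z"
    have seg: "\<bar>w - ?z\<bar> \<le> \<bar>u - ?z\<bar>" if "w \<in> closed_segment ?z u" for w
      using that by (auto simp: closed_segment_eq_real_ivl split: if_splits)
    have "norm (?f u - ?f ?z) \<le> L * \<bar>u - ?z\<bar> * norm (u - ?z)"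
    proof (rule field_differentiable_bound[where S = "closed_segment ?z u" and f' = ?f'])
      fix w assume w: "w \<in> closed_segment ?z u"
      have wz: "\<bar>w - ?z\<bar> < R / 4" using seg[OF w] u by linarith
      have Hi: "(\<lambda>s. H r s) integrable_on {x2 - R / 4..y2 + R / 4}"
        by (rule H_integrable[OF half_R gap12']) (use r K(3) in blast)+
      have cont: "isCont (\<lambda>s. H r s) w"
      proof -
        have g: "R / 2 \<le> \<bar>?z - r\<bar>" using gap12'[OF _ zA, of r] r K(3) by (auto simp: abs_minus_commute)
        have w2: "\<bar>w - ?z\<bar> < R / 2 / 2" using wz by simp
        obtain d where "((\<lambda>s. H s r) has_real_derivative d) (at w)"
          by (rule H_log_lipschitz[OF zd half_R g w2])
        then have "isCont (\<lambda>s. H s r) w" by (rule DERIV_isCont)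
        then show ?thesis by (simp only: boundary_poisson_commute[of D r])
      qed
      have b: "x2 - R / 4 \<le> x2" "y2 \<le> y2 + R / 4" "x2 - R / 4 < w" "w < y2 + R / 4" "if j then w < y2 else x2 < w"
      proof -
        have z: "if j then ?z = x2 else ?z = y2" by (simp add: z2_def end_point_def)
        show "x2 - R / 4 < w" "w < y2 + R / 4" using z2_in[of j] wz[unfolded abs_less_iff] unfolding atLeastAtMost_iff by linarith+
        show "if j then w < y2 else x2 < w" using z wz[unfolded abs_less_iff] gaps R by (cases j) simp_all
      qed (use R in simp_all)
      have "((\<lambda>w. S w r) has_real_derivative ?s * H r w) (at w)"
        unfolding S_def by (rule integral_end_interval_deriv[OF Hi b cont])
      then have "(?f has_real_derivative ?s * H r w - 1 * (?s * H r ?z)) (at w)"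
        by (intro DERIV_diff DERIV_cmult_right DERIV_ident)
      then show "(?f has_real_derivative ?f' w) (at w within closed_segment ?z u)"
        unfolding mult_1 by (rule has_field_derivative_at_within)
      have "\<bar>?f' w\<bar> = \<bar>?s\<bar> * \<bar>H r w - H r ?z\<bar>" by (simp only: abs_mult[symmetric] right_diff_distrib)
      also have "\<dots> \<le> L * \<bar>w - ?z\<bar>" using near[OF r wz zz] by simp
      also have "\<dots> \<le> L * \<bar>u - ?z\<bar>" by (rule mult_left_mono[OF seg[OF w] L])
      finally show "norm (?f' w) \<le> L * \<bar>u - ?z\<bar>" by simp
    qed auto
    moreover have "?f u - ?f ?z = S u r - S ?z r - (u - ?z) * (?s * H r ?z)" by (simp add: left_diff_distrib)
    ultimately show ?thesis by (simp add: power2_eq_square mult.assoc)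
  qed
  show ?thesis
  proof (rule DERIV_of_quadratic_error[of "R / 4"])
    fix u assume u: "\<bar>u - ?z\<bar> < R / 4"
    note i1 = integrable_diff[OF Sint[OF u] Sint[OF zz]]
    have i2: "(\<lambda>r. (u - ?z) * (?s * H r ?z)) integrable_on {k..l}"
      by (intro integrable_on_mult_right Hint)
    have "double_integral i j t u - double_integral i j t ?z - (u - ?z) * inner_derivative i j t
        = integral {k..l} (\<lambda>r. S u r - S ?z r - (u - ?z) * (?s * H r ?z))"
      unfolding integral_diff[OF i1 i2] integral_diff[OF Sint[OF u] Sint[OF zz]]
      by (simp add: double_integral_def S_def K(1) inner_derivative_def)
    also have "norm \<dots> \<le> integral {k..l} (\<lambda>r. L * \<bar>u - ?z\<bar>\<^sup>2)"
      by (rule integral_norm_bound_integral[OF integrable_diff[OF i1 i2] integrable_const_ivl])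
         (use pt[OF _ u] in simp)
    also have "\<dots> = (l - k) * L * \<bar>u - ?z\<bar>\<^sup>2" using K(2) by simp
    finally show "\<bar>double_integral i j t u - double_integral i j t ?z - (u - ?z) * inner_derivative i j t\<bar> \<le> (l - k) * L * \<bar>u - ?z\<bar>\<^sup>2" by simp
  qed (use R in simp)
qed

lemma H_z1_integrable: "(\<lambda>s. H (z1 i) s) integrable_on {x2..y2}"
  by (rule H_integrable[OF R gap12[OF z1_in]])

lemma inner_integral_bounds: "0 < inner_integral (z1 i)" "inner_integral (z1 i) \<le> 1 / R"
proof -
  have g: "R \<le> \<bar>x2 - z1 i\<bar>" using gap12[OF z1_in[of i], of x2] gaps R by (auto simp: abs_minus_commute)
  have pos: "0 < H (z1 i) x2"
  proof (rule H_pos)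
    show "real_analytic_boundary_point D (z1 i)" "real_analytic_boundary_point D x2"
      unfolding real_analytic_boundary_point_def using z1_disc[of i] discs(3) R by blast+
    show "z1 i \<noteq> x2" using g R by auto
  qed
  have "R / 4 * (exp (- 4) * H (z1 i) x2) \<le> integral {x2..y2} (\<lambda>s. H (z1 i) s)"
  proof (rule integral_ge_near_end[OF H_z1_integrable, where i = True])
    fix t assume "\<bar>t - end_point True x2 y2\<bar> \<le> R / 4"
    then have "\<bar>t - x2\<bar> \<le> R / 4" by (simp add: end_point_def)
    from H_harnack[OF discs(3) R g this] show "exp (- 4) * H (z1 i) x2 \<le> H (z1 i) t"
      by (simp only: boundary_poisson_commute[of D "z1 i"])
  qed (use R gaps H_nonneg in auto)
  moreover have "0 < R / 4 * (exp (- 4) * H (z1 i) x2)" using R pos by simp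
  ultimately show "0 < inner_integral (z1 i)" unfolding inner_integral_def by linarith
  show "inner_integral (z1 i) \<le> 1 / R"
    unfolding inner_integral_def
  proof (rule integral_inverse_square_bound[where c = "z1 i", OF _ R _ H_z1_integrable])
    show "x2 \<le> y2" using gaps R by linarith
    show "z1 i + R \<le> x2 \<or> y2 + R \<le> z1 i" using z1_in[of i] gaps by auto
    fix s assume s: "s \<in> {x2..y2}"
    have "z1 i \<noteq> s" using gap12[OF z1_in[of i] s] R by auto
    from H_le[OF this] show "H (z1 i) s \<le> 1 / (s - z1 i)\<^sup>2" by (simp only: power2_commute)
  qed
qed

lemma inner_derivative_bound: "\<bar>inner_derivative i j (z1 i)\<bar> \<le> 1 / R"
proof -
  have int: "(\<lambda>r. H r (z2 j)) integrable_on {x1..y1}"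
    by (rule integrable_subinterval_real[OF H_z2_integrable]) (use R in auto)
  have "integral {x1..y1} (\<lambda>r. H r (z2 j)) \<le> 1 / R"
  proof (rule integral_inverse_square_bound[where c = "z2 j", OF _ R _ int])
    show "x1 \<le> y1" using gaps R by linarith
    show "z2 j + R \<le> x1 \<or> y1 + R \<le> z2 j" using z2_in[of j] gaps by auto
    fix s assume s: "s \<in> {x1..y1}"
    have "s \<noteq> z2 j" using gap12[OF s z2_in[of j]] R by auto
    from H_le[OF this] show "H s (z2 j) \<le> 1 / (s - z2 j)\<^sup>2" .
  qed
  moreover have "0 \<le> integral {x1..y1} (\<lambda>r. H r (z2 j))"
    by (rule integral_nonneg[OF int]) (rule H_nonneg)
  moreover have "inner_derivative i j (z1 i) = end_sign j * integral {x1..y1} (\<lambda>r. H r (z2 j))"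
    by (simp only: inner_derivative_def z1_def end_interval_end_point)
  ultimately show ?thesis by (simp add: abs_mult)
qed

text \<open>
  On an interval of length \<open>R/4\<close> next to the end point the inner integral is at least \<open>exp (-4)\<close> times its
  value at the end point, by the Harnack inequality for the kernel.
\<close>

lemma double_integral_lower: "R / 4 * (exp (- 4) * inner_integral (z1 i)) \<le> double_integral i j (z1 i) (z2 j)"
proof -
  have double_integral: "double_integral i j (z1 i) (z2 j) = integral {x1..y1} inner_integral"
    unfolding double_integral_def z1_def z2_def end_interval_end_point inner_integral_def ..
  have qi: "inner_integral integrable_on {x1..y1}"
    by (rule integrable_subinterval_real[OF inner_integral_integrable]) (use R in auto)
  have Hi: "(\<lambda>s. H t s) integrable_on {x2..y2}" if t: "t \<in> {x1 - R / 4..y1 + R / 4}" for t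
    by (rule H_integrable[OF half_R gap12'[OF t]]) (use R in auto)
  show ?thesis
    unfolding double_integral
  proof (rule integral_ge_near_end[OF qi, where i = i])
    show "0 \<le> inner_integral t" if "t \<in> {x1..y1}" for t
      unfolding inner_integral_def by (rule integral_nonneg[OF Hi H_nonneg]) (use that R in auto)
    fix t assume "\<bar>t - end_point i x1 y1\<bar> \<le> R / 4"
    then have t: "\<bar>t - z1 i\<bar> \<le> R / 4" by (simp only: z1_def)
    have "exp (- 4) * inner_integral (z1 i) = integral {x2..y2} (\<lambda>s. exp (- 4) * H (z1 i) s)"
      unfolding inner_integral_def by simp
    also have "\<dots> \<le> integral {x2..y2} (\<lambda>s. H t s)"
    proof (rule integral_le)
      show "(\<lambda>s. exp (- 4) * H (z1 i) s) integrable_on {x2..y2}"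
        by (rule integrable_on_mult_right[OF H_z1_integrable])
      show "(\<lambda>s. H t s) integrable_on {x2..y2}"
      proof (rule Hi)
        show "t \<in> {x1 - R / 4..y1 + R / 4}" using t z1_in[of i] unfolding atLeastAtMost_iff by linarith
      qed
      show "exp (- 4) * H (z1 i) s \<le> H t s" if "s \<in> {x2..y2}" for s
        by (rule H_harnack[OF z1_disc R gap12[OF z1_in that] t])
    qed
    finally show "exp (- 4) * inner_integral (z1 i) \<le> inner_integral t" unfolding inner_integral_def .
  qed (use R gaps in auto)
qed

text \<open>
  Put \<open>E = 4 exp 4\<close>. The derivative \<open>I\<^sub>i\<close> is at most \<open>1/R\<close> and, by double_integral_lower, at most \<open>E I / R\<close>, hence
  at most \<open>E min(1,I) / R\<close>. This is the factor by which \<open>G''\<close> fails to be bounded by \<open>C G\<close>, so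
  \<open>|G'' I\<^sub>i I\<^sub>j| \<le> E C \<Psi> / R\<^sup>2\<close>, while \<open>|G' I\<^sub>i\<^sub>j| \<le> C \<Psi> / R\<^sup>2\<close>.
\<close>

lemma Psi_second_partial_bound:
  assumes C: "0 \<le> C" "\<And>I. 0 < I \<Longrightarrow> 0 < phi \<kappa> (exp (- I))"
    "\<And>I. 0 < I \<Longrightarrow> ((\<lambda>I. phi \<kappa> (exp (- I))) has_real_derivative G1 I) (at I)"
    "\<And>I. 0 < I \<Longrightarrow> (G1 has_real_derivative G2 I) (at I)"
    "\<And>I. 0 < I \<Longrightarrow> \<bar>G1 I\<bar> \<le> C * phi \<kappa> (exp (- I))"
    "\<And>I. 0 < I \<Longrightarrow> \<bar>G2 I\<bar> * min 1 I \<le> C * phi \<kappa> (exp (- I))"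
    and \<delta>: "0 < \<delta>" "\<delta> \<le> 2 * R" and c: "4 * (4 * exp 4 * C + C) \<le> c"
  shows "Psi_bounds \<kappa> c \<delta> D x1 y1 x2 y2"
proof -
  define p where "p = [x1, y1, x2, y2]"
  define F where "F = (\<lambda>v. Psi_tilde \<kappa> D (v ! 0, v ! 2) (v ! 1, v ! 3))"
  have main: "has_partial2 (if i then 0 else 1) (if j then 2 else 3) F p \<and>
     \<bar>partial2 (if i then 0 else 1) (if j then 2 else 3) F p\<bar> \<le> c / \<delta>\<^sup>2 * F p" for i j
  proof -
    define m n :: nat where "m = (if i then 0 else 1)" and "n = (if j then 2 else 3)"
    have nth: "p ! m = z1 i" "p[m := t] ! n = z2 j" for t
      by (simp_all add: p_def m_def n_def z1_def z2_def end_point_def)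
    have Fup: "F (p[m := t, n := u]) = phi \<kappa> (exp (- double_integral i j t u))" for t u
      by (simp add: F_def p_def m_def n_def Psi_tilde_def double_integral_def end_interval_def)
    define I where "I = double_integral i j (z1 i) (z2 j)"
    have Fp: "F p = phi \<kappa> (exp (- I))"
      unfolding I_def z1_def z2_def by (simp add: F_def p_def Psi_tilde_def double_integral_def end_interval_end_point)
    have "0 < R / 4 * (exp (- 4) * inner_integral (z1 i))" using R inner_integral_bounds(1)[of i] by simp
    then have Ip: "0 < I" using double_integral_lower[of i j] unfolding I_def by linarith
    have zz: "\<bar>z1 i - z1 i\<bar> < R / 4" using R by simp
    have "isCont (\<lambda>t. double_integral i j t (z2 j)) (z1 i)" by (rule DERIV_isCont[OF double_integral_deriv1])
    then have "((\<lambda>t. double_integral i j t (z2 j)) \<longlongrightarrow> I) (nhds (z1 i))"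
      using tendsto_at_iff_tendsto_nhds[of "\<lambda>t. double_integral i j t (z2 j)" "z1 i"] by (simp add: isCont_def I_def)
    then have ev: "\<forall>\<^sub>F t in nhds (z1 i). 0 < double_integral i j t (z2 j)"
      using Ip by (rule order_tendstoD)
    have ev2: "\<forall>\<^sub>F t in nhds (p ! m). ((\<lambda>u. F (p[m := t, n := u])) has_real_derivative
        G1 (double_integral i j t (z2 j)) * inner_derivative i j t) (at (p[m := t] ! n))"
      unfolding nth Fup using ev eventually_nhds_abs_less[OF zz]
      by eventually_elim (rule DERIV_chain2[OF C(3) double_integral_deriv2])
    define M where "M = G2 I * (end_sign i * inner_integral (z1 i)) * inner_derivative i j (z1 i) + end_sign j * (end_sign i * H (z1 i) (z2 j)) * G1 I"
    have dM: "((\<lambda>t. G1 (double_integral i j t (z2 j)) * inner_derivative i j t) has_real_derivative M) (at (p ! m))"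
      unfolding nth M_def I_def
      by (rule DERIV_mult[OF DERIV_chain2[OF C(4) double_integral_deriv1] inner_derivative_deriv]) (use Ip in \<open>simp add: I_def\<close>)
    note P2 = partial2I[OF ev2 dM]
    define \<Psi> where "\<Psi> = phi \<kappa> (exp (- I))"
    define E :: real where "E = 4 * exp 4"
    have E: "1 \<le> E" using exp_ge_add_one_self[of "4::real"] unfolding E_def by linarith
    have qE: "inner_integral (z1 i) \<le> E * I / R"
    proof -
      have "exp 4 * (R / 4 * (exp (- 4) * inner_integral (z1 i))) \<le> exp 4 * I"
        using double_integral_lower[of i j] unfolding I_def by (intro mult_left_mono) auto
      moreover have "exp 4 * (R / 4 * (exp (- 4) * inner_integral (z1 i))) = R / 4 * inner_integral (z1 i) * (exp 4 * exp (- 4))" by simp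
      moreover have "exp 4 * exp (- 4) = (1::real)" by (simp add: mult_exp_exp)
      ultimately have "R / 4 * inner_integral (z1 i) \<le> exp 4 * I" by (simp only: mult_1_right)
      then show ?thesis using R by (simp add: E_def pos_le_divide_eq mult.commute)
    qed
    have qmin: "inner_integral (z1 i) \<le> E * min 1 I / R"
    proof (cases "I \<le> 1")
      case True then show ?thesis using qE by (simp add: min_def)
    next
      case False
      have "1 / R \<le> E / R" using E R by (intro divide_right_mono) auto
      then show ?thesis using False inner_integral_bounds(2)[of i] by (simp add: min_def)
    qed
    have mI: "0 \<le> min 1 I" using Ip by simp
    have Jb: "\<bar>inner_derivative i j (z1 i)\<bar> \<le> 1 / R" by (rule inner_derivative_bound)
    have Hb: "H (z1 i) (z2 j) \<le> 1 / R\<^sup>2" by (rule H_bound_gap[OF R gap12[OF z1_in z2_in]])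
    have "\<bar>M\<bar> \<le> \<bar>G2 I * (end_sign i * inner_integral (z1 i)) * inner_derivative i j (z1 i)\<bar> + \<bar>end_sign j * (end_sign i * H (z1 i) (z2 j)) * G1 I\<bar>"
      unfolding M_def by (rule abs_triangle_ineq)
    also have "\<bar>G2 I * (end_sign i * inner_integral (z1 i)) * inner_derivative i j (z1 i)\<bar> = \<bar>G2 I\<bar> * inner_integral (z1 i) * \<bar>inner_derivative i j (z1 i)\<bar>"
      using inner_integral_bounds(1)[of i] by (simp add: abs_mult)
    also have "\<dots> \<le> \<bar>G2 I\<bar> * (E * min 1 I / R) * (1 / R)"
      using qmin Jb inner_integral_bounds(1)[of i] mI E R by (intro mult_mono mult_nonneg_nonneg divide_nonneg_pos) auto
    also have "\<dots> = (\<bar>G2 I\<bar> * min 1 I) * (E / R\<^sup>2)" by (simp add: power2_eq_square)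
    also have "\<dots> \<le> (C * \<Psi>) * (E / R\<^sup>2)"
      unfolding \<Psi>_def using C(6)[OF Ip] E R by (intro mult_right_mono) auto
    also have "\<bar>end_sign j * (end_sign i * H (z1 i) (z2 j)) * G1 I\<bar> = H (z1 i) (z2 j) * \<bar>G1 I\<bar>"
      using H_nonneg[of "z1 i" "z2 j"] by (simp add: abs_mult)
    also have "\<dots> \<le> (1 / R\<^sup>2) * (C * \<Psi>)"
      unfolding \<Psi>_def using Hb C(5)[OF Ip] H_nonneg[of "z1 i" "z2 j"] by (intro mult_mono) auto
    finally have "\<bar>M\<bar> \<le> (E * C + C) * (1 / R\<^sup>2) * \<Psi>" by (simp add: algebra_simps add_divide_distrib)
    also have "\<dots> \<le> (c / \<delta>\<^sup>2) * \<Psi>"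
    proof (rule mult_right_mono)
      have "\<delta>\<^sup>2 \<le> (2 * R)\<^sup>2" using \<delta> by (intro power_mono) auto
      then have "1 / (4 * R\<^sup>2) \<le> 1 / \<delta>\<^sup>2" using \<delta>(1) R by (intro divide_left_mono) (auto simp: power2_eq_square)
      have EC: "0 \<le> 4 * (E * C + C)" using E C(1) by simp
      have cE: "4 * (E * C + C) \<le> c" using c by (simp only: E_def)
      have "u * (1 / v) = 4 * u * (1 / (4 * v))" for u v :: real by simp
      then have "(E * C + C) * (1 / R\<^sup>2) = 4 * (E * C + C) * (1 / (4 * R\<^sup>2))" .
      also have "\<dots> \<le> 4 * (E * C + C) * (1 / \<delta>\<^sup>2)" by (rule mult_left_mono) fact+
      also have "\<dots> \<le> c * (1 / \<delta>\<^sup>2)" by (rule mult_right_mono[OF cE]) simp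
      finally show "(E * C + C) * (1 / R\<^sup>2) \<le> c / \<delta>\<^sup>2" by simp
      show "0 \<le> \<Psi>" using C(2)[OF Ip] by (simp add: \<Psi>_def)
    qed
    finally show ?thesis
      using P2 unfolding m_def[symmetric] n_def[symmetric] Fp \<Psi>_def by simp
  qed
  have "has_partial2 i j F p \<and> \<bar>partial2 i j F p\<bar> \<le> c / \<delta>\<^sup>2 * F p" if "i \<in> {0, 1}" "j \<in> {2, 3}" for i j
    using main[of "i = 0" "j = 2"] that by auto
  then show ?thesis unfolding Psi_bounds_def Let_def F_def[symmetric] p_def[symmetric] by blast
qed

end

section \<open>Uniformity in the end points\<close>

lemma min_with_dist_half_disc:
  assumes "x \<in> S" "\<delta> = min_with_dist m S (upper_half_plane - D)"
  shows "half_disc x \<delta> \<subseteq> D"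
proof (rule subsetI, rule ccontr)
  fix z assume z: "z \<in> half_disc x \<delta>" "z \<notin> D"
  then have B: "z \<in> upper_half_plane - D" by auto
  then have "\<delta> \<le> setdist (of_real ` S) (upper_half_plane - D)"
    unfolding assms(2) min_with_dist_def by auto
  also have "\<dots> \<le> dist (of_real x) z" using assms(1) B by (intro setdist_le_dist) auto
  finally show False using z by simp
qed

lemma min_with_dist_le: "min_with_dist m S B \<le> m"
  by (simp add: min_with_dist_def)

lemma half_disc_move:
  assumes "half_disc x \<delta> \<subseteq> D" "\<bar>x' - x\<bar> < \<delta> / 4"
  shows "half_disc x' (\<delta> / 2) \<subseteq> D"
proof -
  have "half_disc x' (\<delta> / 2) \<subseteq> half_disc x' (\<delta> - \<bar>x' - x\<bar>)"
    by (intro Int_mono subset_ball order_refl) (use assms(2) in linarith)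
  also have "\<dots> \<subseteq> D" by (rule real_analytic_boundary_point_nhd(2)[OF assms(1)]) (use assms(2) in linarith)
  finally show ?thesis .
qed

text \<open>
  If each point moves by less than \<open>\<delta>/4\<close>, half discs of radius \<open>3\<delta>/4\<close> and distances of at least \<open>\<delta>/2\<close>
  remain.
\<close>

lemma kernel_bounds_near:
  assumes D: "admissible1 D x1 y1" and \<delta>: "0 < delta1 D x1 y1" and c: "288 \<le> c"
    and near: "\<bar>x - x1\<bar> < delta1 D x1 y1 / 4" "\<bar>y - y1\<bar> < delta1 D x1 y1 / 4"
  shows "kernel_bounds c (delta1 D x1 y1) D x y"
proof -
  define \<delta> where "\<delta> = delta1 D x1 y1"
  have eq: "\<delta> = min_with_dist \<bar>x1 - y1\<bar> {x1, y1} (upper_half_plane - D)"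
    by (simp add: \<delta>_def delta1_def)
  interpret half_plane_domain D
    using D by unfold_locales (auto simp: admissible1_def)
  have "\<delta> \<le> \<bar>x1 - y1\<bar>" unfolding eq by (rule min_with_dist_le)
  then have "\<delta> / 2 \<le> \<bar>x - y\<bar>" using near unfolding \<delta>_def[symmetric] by linarith
  moreover have "half_disc x (\<delta> / 2) \<subseteq> D"
    by (rule half_disc_move[OF min_with_dist_half_disc[OF _ eq, of x1]]) (use near in \<open>auto simp: \<delta>_def\<close>)
  moreover have "half_disc y (\<delta> / 2) \<subseteq> D"
    by (rule half_disc_move[OF min_with_dist_half_disc[OF _ eq, of y1]]) (use near in \<open>auto simp: \<delta>_def\<close>)
  ultimately show ?thesis
    using kernel_bounds_of_half_discs[of x "\<delta> / 2" y \<delta> c] c \<delta> unfolding \<delta>_def by simp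
qed

lemma two_intervals_near:
  assumes D: "admissible2 D x1 y1 x2 y2" and ord: "x1 < y1" "y1 < x2" "x2 < y2"
    and \<delta>: "0 < delta2 D x1 y1 x2 y2"
    and near: "\<bar>x1' - x1\<bar> < delta2 D x1 y1 x2 y2 / 4" "\<bar>y1' - y1\<bar> < delta2 D x1 y1 x2 y2 / 4"
      "\<bar>x2' - x2\<bar> < delta2 D x1 y1 x2 y2 / 4" "\<bar>y2' - y2\<bar> < delta2 D x1 y1 x2 y2 / 4"
  shows "two_intervals D x1' y1' x2' y2' (delta2 D x1 y1 x2 y2 / 2)"
proof -
  define \<delta> where "\<delta> = delta2 D x1 y1 x2 y2"
  let ?W = "{x1, x2, y1, y2}"
  let ?M = "{\<bar>w1 - w2\<bar> |w1 w2. w1 \<in> ?W \<and> w2 \<in> ?W \<and> w1 \<noteq> w2}"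
  have eq: "\<delta> = min_with_dist (Min ?M) {x1, y1, x2, y2} (upper_half_plane - D)"
    unfolding \<delta>_def delta2_def by simp
  have "finite ((\<lambda>(w1, w2). \<bar>w1 - w2\<bar>) ` (?W \<times> ?W))" by simp
  then have fin: "finite ?M" by (rule rev_finite_subset) auto
  have le: "\<delta> \<le> \<bar>w1 - w2\<bar>" if "w1 \<in> ?W" "w2 \<in> ?W" "w1 \<noteq> w2" for w1 w2
  proof -
    have "\<delta> \<le> Min ?M" unfolding eq by (rule min_with_dist_le)
    also have "Min ?M \<le> \<bar>w1 - w2\<bar>" by (rule Min_le[OF fin]) (use that in blast)
    finally show ?thesis .
  qed
  have "\<delta> \<le> \<bar>x1 - y1\<bar>" "\<delta> \<le> \<bar>y1 - x2\<bar>" "\<delta> \<le> \<bar>x2 - y2\<bar>"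
    using le[of x1 y1] le[of y1 x2] le[of x2 y2] ord by auto
  then have gaps: "\<delta> / 2 \<le> y1' - x1'" "\<delta> / 2 \<le> x2' - y1'" "\<delta> / 2 \<le> y2' - x2'"
    using near ord unfolding \<delta>_def[symmetric] by linarith+
  have "two_intervals D x1' y1' x2' y2' (\<delta> / 2)"
  proof unfold_locales
    show "simply_connected_domain D" "D \<subseteq> upper_half_plane" using D by (auto simp: admissible2_def)
    show "half_disc x1' (\<delta> / 2) \<subseteq> D"
      by (rule half_disc_move[OF min_with_dist_half_disc[OF _ eq, of x1]]) (use near in \<open>auto simp: \<delta>_def\<close>)
    show "half_disc y1' (\<delta> / 2) \<subseteq> D"
      by (rule half_disc_move[OF min_with_dist_half_disc[OF _ eq, of y1]]) (use near in \<open>auto simp: \<delta>_def\<close>)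
    show "half_disc x2' (\<delta> / 2) \<subseteq> D"
      by (rule half_disc_move[OF min_with_dist_half_disc[OF _ eq, of x2]]) (use near in \<open>auto simp: \<delta>_def\<close>)
    show "half_disc y2' (\<delta> / 2) \<subseteq> D"
      by (rule half_disc_move[OF min_with_dist_half_disc[OF _ eq, of y2]]) (use near in \<open>auto simp: \<delta>_def\<close>)
  qed (use gaps \<delta> in \<open>simp_all add: \<delta>_def\<close>)
  then show ?thesis by (simp add: \<delta>_def)
qed

theorem lemma2p3:
  fixes \<kappa> :: real
  assumes "0 < \<kappa>" and "\<kappa> \<le> 4"
  shows "\<exists>c :: real. \<forall>x1 y1 x2 y2 :: real. x1 < y1 \<and> y1 < x2 \<and> x2 < y2 \<longrightarrow>
    (\<forall>D. admissible1 D x1 y1 \<and> delta1 D x1 y1 > 0 \<longrightarrow>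
       kernel_bounds c (delta1 D x1 y1) D x1 y1) \<and>
    (\<forall>D. admissible2 D x1 y1 x2 y2 \<and> delta2 D x1 y1 x2 y2 > 0 \<longrightarrow>
       Psi_bounds \<kappa> c (delta2 D x1 y1 x2 y2) D x1 y1 x2 y2) \<and>
    locally_uniform_bounds \<kappa> c x1 y1 x2 y2"
proof -
  obtain G1 G2 C where C: "0 \<le> C" "\<And>I. 0 < I \<Longrightarrow> 0 < phi \<kappa> (exp (- I))"
    "\<And>I. 0 < I \<Longrightarrow> ((\<lambda>I. phi \<kappa> (exp (- I))) has_real_derivative G1 I) (at I)"
    "\<And>I. 0 < I \<Longrightarrow> (G1 has_real_derivative G2 I) (at I)"
    "\<And>I. 0 < I \<Longrightarrow> \<bar>G1 I\<bar> \<le> C * phi \<kappa> (exp (- I))"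
    "\<And>I. 0 < I \<Longrightarrow> \<bar>G2 I\<bar> * min 1 I \<le> C * phi \<kappa> (exp (- I))"
    by (rule phi_exp_bounds[OF assms]) (rule that)
  define c where "c = max 288 (4 * (4 * exp 4 * C + C))"
  have c: "288 \<le> c" "4 * (4 * exp 4 * C + C) \<le> c" by (simp_all add: c_def)
  have Psi_near: "Psi_bounds \<kappa> c (delta2 D x1 y1 x2 y2) D x1' y1' x2' y2'"
    if D: "admissible2 D x1 y1 x2 y2" and ord: "x1 < y1" "y1 < x2" "x2 < y2"
      and \<delta>: "0 < delta2 D x1 y1 x2 y2"
      and near: "\<bar>x1' - x1\<bar> < delta2 D x1 y1 x2 y2 / 4" "\<bar>y1' - y1\<bar> < delta2 D x1 y1 x2 y2 / 4"
        "\<bar>x2' - x2\<bar> < delta2 D x1 y1 x2 y2 / 4" "\<bar>y2' - y2\<bar> < delta2 D x1 y1 x2 y2 / 4"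
    for D x1 y1 x2 y2 x1' y1' x2' y2'
  proof -
    have "delta2 D x1 y1 x2 y2 \<le> 2 * (delta2 D x1 y1 x2 y2 / 2)" by simp
    from two_intervals.Psi_second_partial_bound[OF two_intervals_near[OF D ord \<delta> near] C \<delta> this c(2)]
    show ?thesis .
  qed
  show ?thesis
  proof (intro exI[of _ c] allI impI conjI)
    fix x1 y1 x2 y2 :: real assume ord: "x1 < y1 \<and> y1 < x2 \<and> x2 < y2"
    show "kernel_bounds c (delta1 D x1 y1) D x1 y1" if "admissible1 D x1 y1 \<and> 0 < delta1 D x1 y1" for D
      using that c by (intro kernel_bounds_near) auto
    show "Psi_bounds \<kappa> c (delta2 D x1 y1 x2 y2) D x1 y1 x2 y2"
      if "admissible2 D x1 y1 x2 y2 \<and> 0 < delta2 D x1 y1 x2 y2" for D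
      using that ord by (intro Psi_near) auto
    show "locally_uniform_bounds \<kappa> c x1 y1 x2 y2"
      unfolding locally_uniform_bounds_def
    proof (intro allI impI)
      fix d :: real assume d: "0 < d"
      let ?U = "\<lambda>x. ball x (d / 4)"
      have near: "\<bar>x' - x\<bar> < e / 4" if "x' \<in> ?U x" "d \<le> e" for x x' e :: real
        using that by (auto simp: dist_real_def abs_minus_commute)
      have "\<forall>x1'\<in>?U x1. \<forall>y1'\<in>?U y1. \<forall>x2'\<in>?U x2. \<forall>y2'\<in>?U y2.
           (\<forall>D. admissible1 D x1 y1 \<and> d \<le> delta1 D x1 y1 \<longrightarrow>
              kernel_bounds c (delta1 D x1 y1) D x1' y1') \<and>
           (\<forall>D. admissible2 D x1 y1 x2 y2 \<and> d \<le> delta2 D x1 y1 x2 y2 \<longrightarrow>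
              Psi_bounds \<kappa> c (delta2 D x1 y1 x2 y2) D x1' y1' x2' y2')"
      proof (intro ballI conjI allI impI)
        fix x1' y1' x2' y2'
        assume U: "x1' \<in> ?U x1" "y1' \<in> ?U y1" "x2' \<in> ?U x2" "y2' \<in> ?U y2"
        show "kernel_bounds c (delta1 D x1 y1) D x1' y1'" if "admissible1 D x1 y1 \<and> d \<le> delta1 D x1 y1" for D
          by (rule kernel_bounds_near[OF conjunct1[OF that] _ c(1) near[OF U(1)] near[OF U(2)]]) (use that d in auto)
        show "Psi_bounds \<kappa> c (delta2 D x1 y1 x2 y2) D x1' y1' x2' y2'"
          if "admissible2 D x1 y1 x2 y2 \<and> d \<le> delta2 D x1 y1 x2 y2" for D
          by (rule Psi_near[OF conjunct1[OF that] _ _ _ _ near[OF U(1)] near[OF U(2)] near[OF U(3)] near[OF U(4)]])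
             (use that d ord in auto)
      qed
      moreover have "open (?U x)" "x \<in> ?U x" for x using d by auto
      ultimately show "\<exists>U1 V1 U2 V2. open U1 \<and> open V1 \<and> open U2 \<and> open V2 \<and>
        x1 \<in> U1 \<and> y1 \<in> V1 \<and> x2 \<in> U2 \<and> y2 \<in> V2 \<and>
        (\<forall>x1'\<in>U1. \<forall>y1'\<in>V1. \<forall>x2'\<in>U2. \<forall>y2'\<in>V2.
           (\<forall>D. admissible1 D x1 y1 \<and> d \<le> delta1 D x1 y1 \<longrightarrow>
              kernel_bounds c (delta1 D x1 y1) D x1' y1') \<and>
           (\<forall>D. admissible2 D x1 y1 x2 y2 \<and> d \<le> delta2 D x1 y1 x2 y2 \<longrightarrow>
              Psi_bounds \<kappa> c (delta2 D x1 y1 x2 y2) D x1' y1' x2' y2'))"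
        by (intro exI[of _ "?U x1"] exI[of _ "?U y1"] exI[of _ "?U x2"] exI[of _ "?U y2"] conjI) assumption+
    qed
  qed
qed

end
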